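(* Suppose the basic assumptions (1)–(5) hold in the template matching model $Y_i = f(X_i-\theta^* )+Z_i$. Assume, in addition, that $f$ is Lipschitz, that $\lambda$ is Lipschitz on an open set containing the support of $f(\cdot-\theta^* )$, and that $L$ has a Lipschitz first derivative. Unless $L$ itself is Lipschitz, assume also that the noise distribution has finite second moment. Then $\sqrt n(\hat\theta_n-\theta^* )$ is asymptotically normal (as $n\to\infty$) with mean $0$ and variance $$\tau^2 := \frac{C_{\phi,L}}{\mathbb{E}[f'(X-\theta^* )^2]},\qquad C_{\phi,L} := \frac{\mathbb{E}[L'(Z)^2]}{\mathbb{E}[L''(Z)]^2}.$$
   Context: Model. We observe $(X_1,Y_1),\dots,(X_n,Y_n)$ with $Y_i = f(X_i-\theta^* )+Z_i$, where $f:\mathbb{R}\to\mathbb{R}$ is a known function (the template) and $\theta^*\in\mathbb{R}$ is the unknown shift. The design points $X_i$ are iid with density $\lambda$; the noise variables $Z_i$ are iid with density $\phi$ and independent of the design points. $(X,Y)$ and $Z$ denote a generic observation and noise variable; $\mathbb{E}$ is expectation under the true shift $\theta^*$. M-estimator. Given a loss function $L:\mathbb{R}\to\mathbb{R}$, let $m_\theta(x,y) := L(y-f(x-\theta))$, $\widehat M_n(\theta) := \frac1n\sum_{i=1}^n m_\theta(X_i,Y_i)$, $M(\theta) := \mathbb{E}[m_\theta(X,Y)]$, and let $\hat\theta_n$ be a minimizer of $\widehat M_n$ over $\theta$. If $A$ is such that $f$ and $\lambda$ are both supported on $[-A,A]$, the model is $Y_i=Z_i$ for every $\theta$ outside $[-2A,2A]$,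 so the parameter is effectively restricted to the compact interval $[-2A,2A]$. Basic assumptions. (1) $f$ is compactly supported and càdlàg with none or finitely many discontinuities (in particular bounded); and for any $\theta\neq\theta^*$, $\int (f(x-\theta^* )-f(x-\theta))^2\lambda(x)\,dx>0$. (2) $\lambda$ is compactly supported. (3) $\phi$ is even. (4) $L$ is non-negative, even, non-decreasing away from the origin (i.e., on $[0,\infty)$), non-constant, and either Lipschitz or has a Lipschitz derivative. (5) $M$ is well-defined (finite); $\theta^*$ is the unique minimizer of $M$; and $\inf\{M(\theta):|\theta-\theta^*|\ge\delta\}>M(\theta^* )$ for every $\delta>0$. For a Lipschitz function $g$, $g'$ denotes its derivative, which exists almost everywhere and is bounded; thus $f'$ and $L''$ are defined almost everywhere.
   Formalization: The formal theorem additionally assumes that E[f'(X-θ* )²] and E[L''(Z)] are nonzero; these do not follow from the stated assumptions, and without them the variance τ² is undefined. *)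

theory Defs
  imports "HOL-Probability.Probability"
begin

definition compactly_supported :: "(real \<Rightarrow> real) \<Rightarrow> bool" where
  "compactly_supported g \<longleftrightarrow> compact (closure {x. g x \<noteq> 0})"

definition cadlag :: "(real \<Rightarrow> real) \<Rightarrow> bool" where
  "cadlag g \<longleftrightarrow> (\<forall>x. continuous (at_right x) g \<and> (\<exists>l. (g \<longlongrightarrow> l) (at_left x)))"

definition lipschitz_fun :: "(real \<Rightarrow> real) \<Rightarrow> bool" where
  "lipschitz_fun g \<longleftrightarrow> (\<exists>C. C-lipschitz_on UNIV g)"

definition has_lipschitz_deriv :: "(real \<Rightarrow> real) \<Rightarrow> bool" where
  "has_lipschitz_deriv g \<longleftrightarrow> (\<forall>x. g differentiable (at x)) \<and> lipschitz_fun (deriv g)"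

text \<open>
  The observations are indexed from 0, so the sample of size \<open>n\<close> consists of
  \<open>(X i, Y i)\<close> for \<open>i < n\<close>; the pair \<open>(X 0, Y 0)\<close> and the variable \<open>Z 0\<close> serve as the
  generic observation and the generic noise variable.  The true shift is \<open>\<theta>s\<close>.
\<close>

locale template_matching = prob_space P for P :: "'a measure" +
  fixes f lam phi :: "real \<Rightarrow> real" and \<theta>s :: real
    and X Y Z :: "nat \<Rightarrow> 'a \<Rightarrow> real"
  assumes lam_nonneg: "\<And>x. 0 \<le> lam x"
    and phi_nonneg: "\<And>z. 0 \<le> phi z"
    and X_density: "\<And>i. distributed P lborel (X i) (\<lambda>x. ennreal (lam x))"
    and Z_density: "\<And>i. distributed P lborel (Z i) (\<lambda>z. ennreal (phi z))"
    and X_indep: "indep_vars (\<lambda>_. borel) X UNIV"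
    and Z_indep: "indep_vars (\<lambda>_. borel) Z UNIV"
    and X_Z_indep:
      "indep_var (\<Pi>\<^sub>M i\<in>UNIV. borel) (\<lambda>\<omega> i. X i \<omega>) (\<Pi>\<^sub>M i\<in>UNIV. borel) (\<lambda>\<omega> i. Z i \<omega>)"
    and Y_eq: "\<And>i \<omega>. \<omega> \<in> space P \<Longrightarrow> Y i \<omega> = f (X i \<omega> - \<theta>s) + Z i \<omega>"

definition m_loss :: "(real \<Rightarrow> real) \<Rightarrow> (real \<Rightarrow> real) \<Rightarrow> real \<Rightarrow> real \<Rightarrow> real \<Rightarrow> real" where
  "m_loss L f \<theta> x y = L (y - f (x - \<theta>))"

definition emp_risk ::
  "(real \<Rightarrow> real) \<Rightarrow> (real \<Rightarrow> real) \<Rightarrow> (nat \<Rightarrow> 'a \<Rightarrow> real) \<Rightarrow> (nat \<Rightarrow> 'a \<Rightarrow> real)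
    \<Rightarrow> nat \<Rightarrow> 'a \<Rightarrow> real \<Rightarrow> real" where
  "emp_risk L f X Y n \<omega> \<theta> = (\<Sum>i<n. m_loss L f \<theta> (X i \<omega>) (Y i \<omega>)) / real n"

definition risk ::
  "'a measure \<Rightarrow> (real \<Rightarrow> real) \<Rightarrow> (real \<Rightarrow> real) \<Rightarrow> (nat \<Rightarrow> 'a \<Rightarrow> real)
    \<Rightarrow> (nat \<Rightarrow> 'a \<Rightarrow> real) \<Rightarrow> real \<Rightarrow> real" where
  "risk P L f X Y \<theta> = (\<integral>\<omega>. m_loss L f \<theta> (X 0 \<omega>) (Y 0 \<omega>) \<partial>P)"

text \<open>
  At points of non-differentiability \<open>deriv\<close> returns an unspecified constant.  For Lipschitz
  \<open>f\<close> and \<open>deriv L\<close> these points form a Lebesgue null set, and \<open>X 0 - \<theta>s\<close> and \<open>Z 0\<close> have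
  densities, so the expectations below do not depend on that constant.
\<close>

definition C_noise :: "'a measure \<Rightarrow> (real \<Rightarrow> real) \<Rightarrow> (nat \<Rightarrow> 'a \<Rightarrow> real) \<Rightarrow> real" where
  "C_noise P L Z =
     (\<integral>\<omega>. (deriv L (Z 0 \<omega>))\<^sup>2 \<partial>P) / (\<integral>\<omega>. deriv (deriv L) (Z 0 \<omega>) \<partial>P)\<^sup>2"

definition asym_var ::
  "'a measure \<Rightarrow> (real \<Rightarrow> real) \<Rightarrow> (real \<Rightarrow> real) \<Rightarrow> real \<Rightarrow> (nat \<Rightarrow> 'a \<Rightarrow> real)
    \<Rightarrow> (nat \<Rightarrow> 'a \<Rightarrow> real) \<Rightarrow> real" where
  "asym_var P L f \<theta>s X Z = C_noise P L Z / (\<integral>\<omega>. (deriv f (X 0 \<omega> - \<theta>s))\<^sup>2 \<partial>P)"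

end

theory Submission imports Defs begin

text \<open>
  Write \<open>U = X - \<theta>s\<close> and describe a candidate shift by its displacement \<open>t\<close> from \<open>\<theta>s\<close>.  At an
  observation \<open>w = (u, z)\<close> the loss then exceeds its value at \<open>t = 0\<close> by
  \<open>L (z + f u - f (u - t)) - L z\<close>.  Since \<open>f\<close> is only Lipschitz, this need not be differentiable in \<open>t\<close>,
  but it is Lipschitz in \<open>t\<close>, with almost everywhere derivative
  \<open>q t w = L' (z + f u - f (u - t)) * f' (u - t)\<close>, and hence it is the integral of \<open>q s w\<close> over \<open>s\<close>
  from \<open>0\<close> to \<open>t\<close>.  Consequently the paths of the empirical process are absolutely continuous as well:
  their derivative is the centred and normalised score sum \<open>S\<^sub>n\<close>.

  This is what makes the argument short.  The parameter is one-dimensional, so the supremum of the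
  empirical process over an interval is dominated by the integral of \<open>\<bar>S\<^sub>n\<bar>\<close> over it.  Fubini's theorem,
  together with the bound of \<open>E \<bar>S\<^sub>n s\<bar>\<close> by the \<open>L\<^sup>2\<close> norm of \<open>q s\<close>, takes the place of chaining and of
  peeling.  On the scale \<open>h = sqrt n * t\<close> the criterion is, up to a constant,
  \<open>n * R (h / sqrt n) + \<integral> S\<^sub>n (u / sqrt n) du\<close>, the integral running from \<open>0\<close> to \<open>h\<close>, where \<open>R\<close> is the
  excess risk.  Three facts about it give the theorem.

  \<^item> Rate.  The excess risk satisfies \<open>R t \<ge> c * t\<^sup>2\<close> on the bounded range of displacements outside of which the
    criterion is constant.  A minimiser with \<open>\<bar>h\<bar> \<ge> K\<close> therefore forces the integral to be as large as
    \<open>c * h\<^sup>2\<close>, and then \<open>\<bar>S\<^sub>n\<bar>\<close> integrated against \<open>2 / (K\<^sup>2 + u\<^sup>2)\<close> is at least \<open>c\<close>.  The expectation of the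
    latter is \<open>O(1 / K)\<close>.  The same bound contains consistency.

  \<^item> Linearisation.  On \<open>\<bar>h\<bar> \<le> K\<close> the integral differs from \<open>h * S\<^sub>n 0\<close> by at most the integral of
    \<open>\<bar>S\<^sub>n (u / sqrt n) - S\<^sub>n 0\<bar>\<close>, whose mean tends to \<open>0\<close> because almost every point is a Lebesgue point of \<open>f'\<close>
    and of \<open>f'\<^sup>2\<close>.

  \<^item> Curvature.  Since the noise is symmetric, \<open>R t\<close> is the expectation of a symmetric second difference of
    \<open>L\<close> at \<open>Z\<close>, and dominated convergence gives \<open>R t / t\<^sup>2 \<longlonglongrightarrow> V / 2\<close> as \<open>t\<close> tends to \<open>0\<close>, with
    \<open>V = E L'' (Z) * E f' (U)\<^sup>2\<close>.

  So the rescaled criterion is uniformly close to \<open>h * S\<^sub>n 0 + V * h\<^sup>2 / 2\<close> on bounded sets, its minimiser is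
  \<open>- S\<^sub>n 0 / V\<close> up to a term vanishing in probability, and the central limit theorem applies to
  \<open>S\<^sub>n 0\<close>, whose summands \<open>L' (Z) * f' (U)\<close> are centred with variance \<open>E L' (Z)\<^sup>2 * E f' (U)\<^sup>2\<close>.  The general
  statement about minimisers is \<open>minimiser_asymptotically_normal\<close>.
\<close>

section \<open>Lipschitz functions as integrals of their derivatives\<close>

text \<open>
  Lebesgue differentiation along boxes that have the point as a corner yields the derivative from the right;
  the derivative from the left will follow by reflecting the line.
\<close>

lemma indefinite_integral_right_derivative_AE:
  fixes F g :: "real \<Rightarrow> real"
  assumes int: "\<And>a b. integrable lborel (\<lambda>x. indicator {a..b} x * g x)"
    and F: "\<And>a b. a \<le> b \<Longrightarrow> F b - F a = (\<integral>x. indicator {a..b} x * g x \<partial>lborel)"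
  shows "AE x in lborel. ((\<lambda>h. (F (x + h) - F x) / h) \<longlongrightarrow> g x) (at_right 0)"
proof -
  have si: "set_integrable lborel {a..b} g" for a b
    using int[of a b] by (simp add: set_integrable_def)
  have hk: "g integrable_on cbox a b" for a b
    using set_borel_integral_eq_integral(1)[OF si] by simp
  have eq: "integral {a..b} g = F b - F a" if "a \<le> b" for a b
    using set_borel_integral_eq_integral(2)[OF si, of a b] F[OF that]
    by (simp add: set_lebesgue_integral_def)
  obtain N where N: "negligible N"
     and lim: "\<And>x e. \<lbrakk>x \<notin> N; 0 < e\<rbrakk> \<Longrightarrow>
               \<exists>d>0. \<forall>h. 0 < h \<and> h < d \<longrightarrow>
                 norm(integral (cbox x (x + h *\<^sub>R One)) g /\<^sub>R h ^ DIM(real) - g x) < e"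
    using integrable_ccontinuous_explicit[OF hk] by blast
  have "N \<in> null_sets lebesgue" using N by (simp add: negligible_iff_null_sets)
  then have "AE x in lebesgue. x \<notin> N" by (rule AE_not_in)
  then have "AE x in lebesgue. ((\<lambda>h. (F (x + h) - F x) / h) \<longlongrightarrow> g x) (at_right 0)"
  proof eventually_elim
    case (elim x)
    show ?case
    proof (rule tendstoI)
      fix e :: real assume "0 < e"
      from lim[OF elim this] obtain d where d: "d > 0"
        and *: "\<And>h. 0 < h \<Longrightarrow> h < d \<Longrightarrow> \<bar>integral {x..x + h} g / h - g x\<bar> < e"
        by (auto simp: divide_inverse_commute)
      show "\<forall>\<^sub>F h in at_right 0. dist ((F (x + h) - F x) / h) (g x) < e"
        unfolding eventually_at_right_field
        by (intro exI[of _ d]) (use d * eq in \<open>auto simp: dist_real_def\<close>)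
    qed
  qed
  then show ?thesis by (simp add: AE_completion_iff)
qed

text \<open>
  The predicate itself need not be measurable; only the exceptional null set is transported.
\<close>

lemma AE_lborel_affine:
  fixes c t :: real
  assumes "AE x in lborel. Q x" "c \<noteq> 0"
  shows "AE x in lborel. Q (t + c * x)"
proof -
  obtain N where N: "N \<in> null_sets lborel" "{x. \<not> Q x} \<subseteq> N"
    using assms(1) by (force elim!: AE_E simp: null_sets_def)
  then have "N \<in> sets borel" by (auto simp: null_sets_def)
  then have "AE x in lborel. t + c * x \<notin> N"
    using AE_not_in[OF N(1)] assms(2) by (intro AE_borel_affine) (auto simp: pred_def)
  then show ?thesis using N(2) by (auto elim!: eventually_mono)
qed

lemma indefinite_integral_has_derivative_AE:
  fixes F g :: "real \<Rightarrow> real"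
  assumes int: "\<And>a b. integrable lborel (\<lambda>x. indicator {a..b} x * g x)"
    and F: "\<And>a b. a \<le> b \<Longrightarrow> F b - F a = (\<integral>x. indicator {a..b} x * g x \<partial>lborel)"
  shows "AE x in lborel. (F has_real_derivative g x) (at x)"
proof -
  have ind: "indicator {a..b} (- x) = (indicator {- b..- a} x :: real)" for a b x :: real
    by (auto simp: indicator_def)
  have int': "integrable lborel (\<lambda>x. indicator {a..b} x * g (- x))" for a b
    using lborel_integrable_real_affine[OF int[of "-b" "-a"], of "-1" 0] by (simp add: ind)
  have F': "- F (- b) - - F (- a) = (\<integral>x. indicator {a..b} x * g (- x) \<partial>lborel)"
    if "a \<le> b" for a b
    using lborel_integral_real_affine[of "-1" "\<lambda>x. indicator {-b..-a} x * g x" 0] F[of "-b" "-a"] that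
    by (simp add: ind)
  have R: "AE x in lborel. ((\<lambda>h. (F (x + h) - F x) / h) \<longlongrightarrow> g x) (at_right 0)"
    by (rule indefinite_integral_right_derivative_AE[OF int F])
  have "AE x in lborel. ((\<lambda>h. (- F (- (x + h)) - - F (- x)) / h) \<longlongrightarrow> g (- x)) (at_right 0)"
    by (rule indefinite_integral_right_derivative_AE[OF int' F'])
  from AE_lborel_affine[OF this, of "-1" 0]
  have L: "AE x in lborel. ((\<lambda>h. (F x - F (x - h)) / h) \<longlongrightarrow> g x) (at_right 0)"
    by simp
  show ?thesis
    using R L
  proof eventually_elim
    case (elim x)
    have "((\<lambda>h. (F (x + h) - F x) / h) \<longlongrightarrow> g x) (at_left 0)"
      unfolding filterlim_at_left_to_right[of _ _ 0]
      using elim(2) by (simp add: minus_divide_left)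
    with elim(1) show ?case
      unfolding DERIV_def filterlim_at_split by blast
  qed
qed

text \<open>
  Adding a multiple of the identity makes \<open>f\<close> monotone, so that it is the distribution function of a
  Stieltjes measure.  The analogous measure for \<open>- f\<close> adds up with it to a multiple of Lebesgue measure; hence
  both are absolutely continuous, and the Radon-Nikodym density, corrected by the slope that was added, is an
  almost everywhere derivative of \<open>f\<close>.
\<close>

lemma lipschitz_eq_integral_of_bounded_density:
  fixes f :: "real \<Rightarrow> real"
  assumes lip: "C-lipschitz_on UNIV f"
  obtains g where "g \<in> borel_measurable borel" "\<And>x. \<bar>g x\<bar> \<le> C"
    "\<And>a b. a \<le> b \<Longrightarrow> f b - f a = (\<integral>x. indicator {a..b} x * g x \<partial>lborel)"
    "AE x in lborel. (f has_real_derivative g x) (at x)"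
proof -
  have C: "C \<ge> 0" using lip by (rule lipschitz_on_nonneg)
  have lipD: "\<bar>f x - f y\<bar> \<le> C * \<bar>x - y\<bar>" for x y
    using lipschitz_onD[OF lip, of x y] by (simp add: dist_real_def)
  \<comment> \<open>Any slope \<open>D\<close> with \<open>D \<ge> C\<close> makes both functions monotone; \<open>C + 1\<close> is in addition positive.\<close>
  define D where "D = C + 1"
  define F where "F x = f x + D * x" for x
  define G where "G x = D * x - f x" for x
  have cont_f: "continuous_on A f" for A
    using lipschitz_on_continuous_on[OF lip] continuous_on_subset by blast
  have mono: "F x \<le> F y" "G x \<le> G y" if "x \<le> y" for x y
  proof -
    have "C * (y - x) \<le> D * (y - x)" using that by (intro mult_right_mono) (auto simp: D_def)
    then show "F x \<le> F y" "G x \<le> G y"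
      using lipD[of x y] that by (auto simp: F_def G_def algebra_simps)
  qed
  have contF: "continuous_on A F" and contG: "continuous_on A G" for A
    unfolding F_def G_def by (intro continuous_intros cont_f)+
  have rc: "continuous (at_right a) F" "continuous (at_right a) G" for a
    using contF[of UNIV] contG[of UNIV]
    by (auto simp: continuous_on_eq_continuous_at intro: continuous_at_imp_continuous_at_within)
  let ?M = "interval_measure F" and ?N = "interval_measure G"
  have Ioo: "emeasure (interval_measure H) {a<..<b} = ennreal (H b - H a)"
    if "a \<le> b" "\<And>x y. x \<le> y \<Longrightarrow> H x \<le> H y" "\<And>A. continuous_on A H" for a b H
  proof -
    have rc: "continuous (at_right x) H" for x
      using that(3)[of UNIV]
      by (auto simp: continuous_on_eq_continuous_at intro: continuous_at_imp_continuous_at_within)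
    have "emeasure (interval_measure H) {b..b} = ennreal (H b - H b)"
      by (intro emeasure_interval_measure_Icc that order_refl)
    then have "{b} \<in> null_sets (interval_measure H)" by (auto simp: null_sets_def)
    moreover have "{a<..<b} = {a<..b} - {b}" by auto
    ultimately have "emeasure (interval_measure H) {a<..<b} = emeasure (interval_measure H) {a<..b}"
      by (simp add: emeasure_Diff_null_set)
    also have "\<dots> = ennreal (H b - H a)"
      by (intro emeasure_interval_measure_Ioc that rc)
    finally show ?thesis .
  qed
  \<comment> \<open>The normalised sum of the two Stieltjes measures; both charge \<open>{l<..<u}\<close> with the sum \<open>2 * D * (u - l)\<close>.\<close>
  define S where "S = measure_of UNIV (sets borel) (\<lambda>A. (emeasure ?M A + emeasure ?N A) / ennreal (2 * D))"
  have D0: "0 < D" using C by (simp add: D_def)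
  have setsS [simp]: "sets S = sets borel"
    unfolding S_def using sets.sigma_sets_eq[of "borel :: real measure"] by (simp add: sets_measure_of_conv)
  have emS: "emeasure S A = (emeasure ?M A + emeasure ?N A) / ennreal (2 * D)" if "A \<in> sets borel" for A
    unfolding S_def
  proof (rule emeasure_measure_of_sigma)
    show "sigma_algebra UNIV (sets (borel :: real measure))"
      using sets.sigma_algebra_axioms[of "borel :: real measure"] by simp
    show "countably_additive (sets borel)
      (\<lambda>A. (emeasure ?M A + emeasure ?N A) / ennreal (2 * D))"
    proof (rule countably_additiveI)
      fix A :: "nat \<Rightarrow> real set"
      assume A: "range A \<subseteq> sets borel" "disjoint_family A"
      show "(\<Sum>i. (emeasure ?M (A i) + emeasure ?N (A i)) / ennreal (2 * D))
        = (emeasure ?M (\<Union> (range A)) + emeasure ?N (\<Union> (range A))) / ennreal (2 * D)"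
        using A
        by (simp add: ennreal_suminf_divide suminf_add[symmetric] suminf_emeasure)
    qed
  qed (use that in \<open>auto simp: positive_def\<close>)
  have "lborel = S"
  proof (rule lborel_eqI)
    fix l u :: real assume "\<And>b. b \<in> Basis \<Longrightarrow> l \<bullet> b \<le> u \<bullet> b"
    then have lu: "l \<le> u" by simp
    have "(ennreal (F u - F l) + ennreal (G u - G l)) / ennreal (2 * D) = ennreal (u - l)"
      using mono[OF lu] D0 lu
      by (simp add: ennreal_plus[symmetric] divide_ennreal F_def G_def field_simps del: ennreal_plus)
    then show "emeasure S (box l u) = ennreal (\<Prod>b\<in>Basis. (u - l) \<bullet> b)"
      using Ioo[OF lu mono(1) contF] Ioo[OF lu mono(2) contG] by (simp add: emS box_real)
  qed simp
  then have "absolutely_continuous lborel ?M"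
    using emS D0 by (auto simp: absolutely_continuous_def null_sets_def ennreal_divide_eq_0_iff)
  then obtain r where r: "r \<in> borel_measurable lborel" "density lborel r = ?M"
    using sigma_finite_measure.Radon_Nikodym[OF sigma_finite_lborel, of ?M] by auto
  have nnr: "(\<integral>\<^sup>+x. r x * indicator {a..b} x \<partial>lborel) = ennreal (F b - F a)" if "a \<le> b" for a b
    using emeasure_interval_measure_Icc[OF that mono(1) contF] r emeasure_density[of r lborel "{a..b}"]
    by simp
  have fin: "AE x in lborel. r x \<noteq> \<infinity>"
  proof -
    have "AE x in lborel. \<forall>n::nat. r x * indicator {- real n..real n} x \<noteq> \<infinity>"
      unfolding AE_all_countable
    proof
      fix n :: nat
      show "AE x in lborel. r x * indicator {- real n..real n} x \<noteq> \<infinity>"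
        by (rule nn_integral_PInf_AE) (use r nnr[of "- real n" "real n"] in auto)
    qed
    then show ?thesis
    proof eventually_elim
      case (elim x)
      obtain n :: nat where "\<bar>x\<bar> \<le> real n" using real_arch_simple by blast
      then have "x \<in> {- real n..real n}" by auto
      with elim show ?case by (metis indicator_simps(1) mult.right_neutral)
    qed
  qed
  define g0 where "g0 x = enn2real (r x)" for x
  have g0m [measurable]: "g0 \<in> borel_measurable borel" using r by (simp add: g0_def[abs_def])
  have hb: "has_bochner_integral lborel (\<lambda>x. indicator {a..b} x * g0 x) (F b - F a)" if "a \<le> b" for a b
  proof (rule has_bochner_integral_nn_integral)
    have "(\<integral>\<^sup>+x. ennreal (indicator {a..b} x * g0 x) \<partial>lborel) = (\<integral>\<^sup>+x. r x * indicator {a..b} x \<partial>lborel)"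
      using fin
      by (intro nn_integral_cong_AE, eventually_elim)
         (auto simp: g0_def indicator_def less_top[symmetric] top_unique)
    then show "(\<integral>\<^sup>+x. ennreal (indicator {a..b} x * g0 x) \<partial>lborel) = ennreal (F b - F a)"
      using nnr[OF that] by simp
    show "(\<lambda>x. indicator {a..b} x * g0 x) \<in> borel_measurable lborel" by measurable
  qed (use mono that in \<open>auto simp: g0_def\<close>)
  have int0: "integrable lborel (\<lambda>x. indicator {a..b} x * g0 x)" for a b
    using hb[of a b] by (cases "a \<le> b") (auto simp: integrable.simps)
  have F0: "AE x in lborel. (F has_real_derivative g0 x) (at x)"
    by (rule indefinite_integral_has_derivative_AE[OF int0])
       (use hb in \<open>auto simp: has_bochner_integral_iff\<close>)
  have f0: "AE x in lborel. (f has_real_derivative (g0 x - D)) (at x)"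
    using F0
  proof eventually_elim
    case (elim x)
    have "((\<lambda>x. F x - D * x) has_real_derivative (g0 x - D)) (at x)"
      using elim by (auto intro!: derivative_eq_intros)
    then show ?case by (simp add: F_def)
  qed
  \<comment> \<open>Truncation on a null set, so that the bound holds everywhere.\<close>
  define g where "g x = (if \<bar>g0 x - D\<bar> \<le> C then g0 x - D else 0)" for x
  have gm: "g \<in> borel_measurable borel" unfolding g_def[abs_def] by measurable
  have bound: "\<bar>d\<bar> \<le> C" if "(f has_real_derivative d) (at x)" for d x
  proof (rule tendsto_upperbound[OF tendsto_rabs])
    show "((\<lambda>h. (f (x + h) - f x) / h) \<longlongrightarrow> d) (at 0)" using that by (simp add: DERIV_def)
    show "\<forall>\<^sub>F h in at 0. \<bar>(f (x + h) - f x) / h\<bar> \<le> C"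
      using lipD[of "x + _" x] by (auto simp: eventually_at_filter divide_simps)
  qed simp
  have g_eq: "AE x in lborel. g x = g0 x - D"
    using f0 by eventually_elim (auto simp: g_def dest: bound)
  show ?thesis
  proof
    show "g \<in> borel_measurable borel" by (rule gm)
    show "\<bar>g x\<bar> \<le> C" for x using C by (simp add: g_def)
    show "AE x in lborel. (f has_real_derivative g x) (at x)"
      using f0 g_eq by eventually_elim simp
    fix a b :: real assume ab: "a \<le> b"
    have "(\<integral>x. indicator {a..b} x * g x \<partial>lborel)
        = (\<integral>x. indicator {a..b} x * g0 x - D * indicator {a..b} x \<partial>lborel)"
      using g_eq gm by (intro integral_cong_AE) (auto elim!: eventually_mono simp: indicator_def)
    also have "\<dots> = (F b - F a) - D * (b - a)"
      using hb[OF ab] ab by (subst Bochner_Integration.integral_diff) (auto simp: has_bochner_integral_iff)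
    finally show "f b - f a = (\<integral>x. indicator {a..b} x * g x \<partial>lborel)"
      by (simp add: F_def algebra_simps)
  qed
qed

text \<open>
  The kernel of the oriented integral from \<open>0\<close> to \<open>t\<close>: integrating \<open>signed_interval t s * k s\<close> over the line gives
  this integral for either sign of \<open>t\<close>, with one formula that is jointly measurable in \<open>t\<close> and \<open>s\<close>.
\<close>

definition signed_interval :: "real \<Rightarrow> real \<Rightarrow> real" where
  "signed_interval t s = indicator {0..t} s - indicator {t..0} s"

lemma signed_interval_measurable [measurable]:
  "case_prod signed_interval \<in> borel_measurable (borel \<Otimes>\<^sub>M borel)"
proof -
  have "case_prod signed_interval = (\<lambda>(t, s). (if 0 \<le> s \<and> s \<le> t then 1 else 0) - (if t \<le> s \<and> s \<le> 0 then 1 else (0::real)))"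
    by (auto simp: signed_interval_def indicator_def fun_eq_iff)
  also have "\<dots> \<in> borel_measurable (borel \<Otimes>\<^sub>M borel)" by measurable
  finally show ?thesis .
qed

lemma signed_interval_measurable' [measurable]: "signed_interval t \<in> borel_measurable borel"
  unfolding signed_interval_def[abs_def] by measurable

lemma abs_signed_interval_le: "\<bar>signed_interval t s\<bar> \<le> indicator {- \<bar>t\<bar>..\<bar>t\<bar>} s"
  by (auto simp: signed_interval_def indicator_def)

lemma integrable_signed_interval_bounded:
  fixes k :: "real \<Rightarrow> real"
  assumes "k \<in> borel_measurable borel" "\<And>s. \<bar>k s\<bar> \<le> C"
  shows "integrable lborel (\<lambda>s. signed_interval t s * k s)"
proof (rule Bochner_Integration.integrable_bound)
  show "integrable lborel (\<lambda>s. C * indicator {- \<bar>t\<bar>..\<bar>t\<bar>} s)" by simp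
  have "0 \<le> C" using assms(2)[of 0] by linarith
  have "\<bar>signed_interval t s\<bar> * \<bar>k s\<bar> \<le> indicator {- \<bar>t\<bar>..\<bar>t\<bar>} s * C" for s
    by (rule mult_mono) (use assms abs_signed_interval_le[of t s] in auto)
  then have "\<bar>signed_interval t s * k s\<bar> \<le> \<bar>C * indicator {- \<bar>t\<bar>..\<bar>t\<bar>} s\<bar>" for s
    using \<open>0 \<le> C\<close> by (simp add: abs_mult mult.commute)
  then show "AE s in lborel. norm (signed_interval t s * k s) \<le> norm (C * indicator {- \<bar>t\<bar>..\<bar>t\<bar>} s)"
    by simp
  show "(\<lambda>s. signed_interval t s * k s) \<in> borel_measurable lborel" using assms(1) by simp
qed

lemma integral_signed_interval_diff:
  fixes k :: "real \<Rightarrow> real"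
  assumes "k \<in> borel_measurable borel" "\<And>s. \<bar>k s\<bar> \<le> C" "a \<le> b"
  shows "(\<integral>s. signed_interval b s * k s \<partial>lborel) - (\<integral>s. signed_interval a s * k s \<partial>lborel)
       = (\<integral>s. indicator {a..b} s * k s \<partial>lborel)"
proof -
  have "(\<integral>s. signed_interval b s * k s \<partial>lborel) - (\<integral>s. signed_interval a s * k s \<partial>lborel)
      = (\<integral>s. signed_interval b s * k s - signed_interval a s * k s \<partial>lborel)"
    using assms by (intro Bochner_Integration.integral_diff[symmetric] integrable_signed_interval_bounded)
  also have "\<dots> = (\<integral>s. indicator {a..b} s * k s \<partial>lborel)"
  proof (rule integral_cong_AE)
    show "AE s in lborel. signed_interval b s * k s - signed_interval a s * k s = indicator {a..b} s * k s"
      using AE_lborel_singleton[of a] AE_lborel_singleton[of b] AE_lborel_singleton[of 0]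
      by eventually_elim (use \<open>a \<le> b\<close> in \<open>auto simp: signed_interval_def indicator_def\<close>)
  qed (use assms(1) in auto)
  finally show ?thesis .
qed

lemma integral_signed_interval: "(\<integral>s. signed_interval t s \<partial>lborel) = t"
proof (cases "0 \<le> t")
  case True
  have "(\<integral>s. signed_interval t s \<partial>lborel) = (\<integral>s. indicator {0..t} s \<partial>lborel)"
    using AE_lborel_singleton[of 0] True
    by (intro integral_cong_AE) (auto elim!: eventually_mono simp: signed_interval_def indicator_def)
  then show ?thesis using True by simp
next
  case False
  have "(\<integral>s. signed_interval t s \<partial>lborel) = (\<integral>s. - indicator {t..0} s \<partial>lborel)"
    using False
    by (intro Bochner_Integration.integral_cong) (auto simp: signed_interval_def indicator_def)
  then show ?thesis using False by simp
qed

text \<open>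
  The fundamental theorem of calculus for Lipschitz functions: any Borel function that is almost everywhere a
  derivative agrees almost everywhere with the density found above.
\<close>

lemma lipschitz_eq_integral_of_derivative:
  fixes h k :: "real \<Rightarrow> real"
  assumes lip: "C-lipschitz_on UNIV h" and k: "k \<in> borel_measurable borel"
    and der: "AE x in lborel. (h has_real_derivative k x) (at x)"
  shows "h t - h 0 = (\<integral>s. signed_interval t s * k s \<partial>lborel)"
proof -
  obtain g where g: "g \<in> borel_measurable borel" "\<And>x. \<bar>g x\<bar> \<le> C"
    "\<And>a b. a \<le> b \<Longrightarrow> h b - h a = (\<integral>x. indicator {a..b} x * g x \<partial>lborel)"
    "AE x in lborel. (h has_real_derivative g x) (at x)"
    using lipschitz_eq_integral_of_bounded_density[OF lip] by blast
  have "signed_interval 0 = (\<lambda>_. 0)" by (auto simp: signed_interval_def fun_eq_iff)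
  then have z: "(\<integral>s. signed_interval 0 s * g s \<partial>lborel) = 0" by simp
  have "h t - h 0 = (\<integral>s. signed_interval t s * g s \<partial>lborel)"
    using integral_signed_interval_diff[OF g(1,2), of 0 t] integral_signed_interval_diff[OF g(1,2), of t 0]
      g(3)[of 0 t] g(3)[of t 0] z
    by (cases "0 \<le> t") auto
  also have "AE x in lborel. g x = k x"
    using g(4) der by eventually_elim (rule DERIV_unique)
  then have "(\<integral>s. signed_interval t s * g s \<partial>lborel) = (\<integral>s. signed_interval t s * k s \<partial>lborel)"
    using g(1) k by (intro integral_cong_AE) (auto elim!: eventually_mono)
  finally show ?thesis .
qed

lemma integrable_window_bounded:
  fixes g :: "real \<Rightarrow> real"
  assumes "g \<in> borel_measurable borel" "\<And>x. \<bar>g x\<bar> \<le> C"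
  shows "integrable lborel (\<lambda>x. indicator {a..b} x * g x)"
proof (rule Bochner_Integration.integrable_bound)
  show "integrable lborel (\<lambda>x. C * indicator {a..b} x)" by (cases "a \<le> b") auto
  show "AE x in lborel. norm (indicator {a..b} x * g x) \<le> norm (C * indicator {a..b} x)"
    using assms(2) by (auto simp: indicator_def intro: order_trans[OF _ abs_ge_self])
qed (use assms(1) in auto)

text \<open>
  The window \<open>[x - r * K, x + r * K]\<close> is symmetric, so its average of \<open>g\<close> is a difference quotient of an
  indefinite integral of \<open>g\<close> at \<open>x\<close>.
\<close>

lemma integral_rescaled_window_tendsto_AE:
  fixes g :: "real \<Rightarrow> real"
  assumes g: "g \<in> borel_measurable borel" "\<And>x. \<bar>g x\<bar> \<le> C" and K: "0 \<le> K"
  shows "AE x in lborel. ((\<lambda>r. \<integral>u. indicator {-K..K} u * g (x - r * u) \<partial>lborel)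
            \<longlongrightarrow> 2 * K * g x) (at_right 0)"
proof -
  define F where "F t = (\<integral>s. signed_interval t s * g s \<partial>lborel)" for t
  have F: "F b - F a = (\<integral>s. indicator {a..b} s * g s \<partial>lborel)" if "a \<le> b" for a b
    unfolding F_def by (rule integral_signed_interval_diff[OF g that])
  have int: "integrable lborel (\<lambda>x. indicator {a..b} x * g x)" for a b
    by (rule integrable_window_bounded[OF g])
  have "AE x in lborel. (F has_real_derivative g x) (at x)"
    using int F by (rule indefinite_integral_has_derivative_AE)
  then show ?thesis
  proof eventually_elim
    case (elim x)
    have "((\<lambda>r. F (x + r * K) - F (x - r * K)) has_real_derivative (g x * K - g x * - K)) (at 0)"
      by (rule DERIV_diff; rule DERIV_chain2[where f = F]) (use elim in \<open>auto intro!: derivative_eq_intros\<close>)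
    then have "((\<lambda>r. (F (x + r * K) - F (x - r * K)) / r) \<longlongrightarrow> 2 * K * g x) (at 0)"
      by (simp add: DERIV_def algebra_simps)
    then have "((\<lambda>r. (F (x + r * K) - F (x - r * K)) / r) \<longlongrightarrow> 2 * K * g x) (at_right 0)"
      by (simp add: filterlim_at_split)
    moreover have "\<forall>\<^sub>F r in at_right 0. (F (x + r * K) - F (x - r * K)) / r
         = (\<integral>u. indicator {-K..K} u * g (x - r * u) \<partial>lborel)"
    proof (rule eventually_at_right_less[THEN eventually_mono])
      fix r :: real assume r: "0 < r"
      have ind: "indicator {x - r * K..x + r * K} (x + - r * u) = (indicator {-K..K} u :: real)" for u
        using mult_le_cancel_left_pos[OF r, of "-u" K] mult_le_cancel_left_pos[OF r, of u K]
        by (auto simp: indicator_def)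
      have "F (x + r * K) - F (x - r * K) = (\<integral>s. indicator {x - r * K..x + r * K} s * g s \<partial>lborel)"
        using mult_nonneg_nonneg[of r K] r K by (intro F) simp
      also have "\<dots> = r * (\<integral>u. indicator {-K..K} u * g (x - r * u) \<partial>lborel)"
        using r lborel_integral_real_affine[of "-r" "\<lambda>s. indicator {x - r * K..x + r * K} s * g s" x]
        unfolding ind by simp
      finally show "(F (x + r * K) - F (x - r * K)) / r
         = (\<integral>u. indicator {-K..K} u * g (x - r * u) \<partial>lborel)" using r by simp
    qed
    ultimately show ?case by (rule Lim_transform_eventually)
  qed
qed

text \<open>
  Almost every point is a Lebesgue point in the square mean.  Expanding the square reduces this to the
  convergence of the window averages of \<open>g\<close> and of \<open>g\<^sup>2\<close>.
\<close>

lemma square_oscillation_in_shrinking_window_tendsto_AE: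
  fixes g :: "real \<Rightarrow> real"
  assumes g [measurable]: "g \<in> borel_measurable borel" and bd: "\<And>x. \<bar>g x\<bar> \<le> C" and K: "0 \<le> K"
  shows "AE x in lborel. ((\<lambda>r. \<integral>u. indicator {-K..K} u * (g (x - r * u) - g x)\<^sup>2 \<partial>lborel)
            \<longlongrightarrow> 0) (at_right 0)"
proof -
  have bd2: "\<bar>(g x)\<^sup>2\<bar> \<le> C\<^sup>2" for x
    using bd[of x] by (simp add: abs_le_square_iff[symmetric])
  have int: "integrable lborel (\<lambda>u. indicator {-K..K} u * h (x - r * u))"
    if "h \<in> borel_measurable borel" "\<And>x. \<bar>h x\<bar> \<le> B" for h :: "real \<Rightarrow> real" and B x r
    by (rule integrable_window_bounded[where C = B]) (use that in auto)
  have "AE x in lborel. ((\<lambda>r. \<integral>u. indicator {-K..K} u * (g (x - r * u))\<^sup>2 \<partial>lborel)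
            \<longlongrightarrow> 2 * K * (g x)\<^sup>2) (at_right 0)"
    by (rule integral_rescaled_window_tendsto_AE[OF _ bd2 K]) simp
  moreover have "AE x in lborel. ((\<lambda>r. \<integral>u. indicator {-K..K} u * g (x - r * u) \<partial>lborel)
            \<longlongrightarrow> 2 * K * g x) (at_right 0)"
    by (rule integral_rescaled_window_tendsto_AE[OF g bd K])
  ultimately show ?thesis
  proof eventually_elim
    case (elim x)
    have eq: "(\<integral>u. indicator {-K..K} u * (g (x - r * u) - g x)\<^sup>2 \<partial>lborel)
       = (\<integral>u. indicator {-K..K} u * (g (x - r * u))\<^sup>2 \<partial>lborel)
         - 2 * g x * (\<integral>u. indicator {-K..K} u * g (x - r * u) \<partial>lborel) + (g x)\<^sup>2 * (2 * K)" for r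
    proof -
      have "(\<integral>u. indicator {-K..K} u * (g (x - r * u) - g x)\<^sup>2 \<partial>lborel)
        = (\<integral>u. indicator {-K..K} u * (g (x - r * u))\<^sup>2 - 2 * g x * (indicator {-K..K} u * g (x - r * u))
          + (g x)\<^sup>2 * indicator {-K..K} u \<partial>lborel)"
        by (intro Bochner_Integration.integral_cong) (auto simp: power2_diff algebra_simps)
      also have "\<dots> = (\<integral>u. indicator {-K..K} u * (g (x - r * u))\<^sup>2 \<partial>lborel)
         - 2 * g x * (\<integral>u. indicator {-K..K} u * g (x - r * u) \<partial>lborel) + (g x)\<^sup>2 * (2 * K)"
        using int[of "\<lambda>x. (g x)\<^sup>2", OF _ bd2] int[OF g bd] K
        by (subst Bochner_Integration.integral_add, simp, simp,
            subst Bochner_Integration.integral_diff) auto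
      finally show ?thesis .
    qed
    have "((\<lambda>r. (\<integral>u. indicator {-K..K} u * (g (x - r * u))\<^sup>2 \<partial>lborel)
         - 2 * g x * (\<integral>u. indicator {-K..K} u * g (x - r * u) \<partial>lborel) + (g x)\<^sup>2 * (2 * K))
         \<longlongrightarrow> 2 * K * (g x)\<^sup>2 - 2 * g x * (2 * K * g x) + (g x)\<^sup>2 * (2 * K)) (at_right 0)"
      by (intro tendsto_intros elim)
    also have "2 * K * (g x)\<^sup>2 - 2 * g x * (2 * K * g x) + (g x)\<^sup>2 * (2 * K) = 0"
      by (simp add: power2_eq_square)
    finally show ?case unfolding eq .
  qed
qed

text \<open>
  By continuity the Cauchy criterion for the difference quotients can be tested on rational increments, so the
  set of points of differentiability is Borel.  On it \<open>deriv f\<close> is a limit of difference quotients, and off it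
  \<open>deriv f\<close> is constant by the convention of \<open>deriv\<close>.
\<close>

lemma borel_measurable_deriv:
  fixes f :: "real \<Rightarrow> real"
  assumes "continuous_on UNIV f"
  shows "deriv f \<in> borel_measurable borel"
proof -
  have [measurable]: "f \<in> borel_measurable borel"
    using assms by (rule borel_measurable_continuous_onI)
  define q where "q h x = (f (x + h) - f x) / h" for h x
  have [measurable]: "q h \<in> borel_measurable borel" for h unfolding q_def[abs_def] by measurable
  have q_cont: "isCont (\<lambda>h. q h x) h" if "h \<noteq> 0" for h x
  proof -
    have "isCont f (x + h)" using assms by (simp add: continuous_on_eq_continuous_at)
    then have "isCont (\<lambda>h. f (x + h)) h" by (rule isCont_o2[rotated]) (intro continuous_intros)
    then show ?thesis using that unfolding q_def
      by (intro isCont_divide isCont_diff continuous_const continuous_ident) auto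
  qed
  define Q where "Q m = {h \<in> \<rat>. h \<noteq> 0 \<and> \<bar>h\<bar> < 1 / real (Suc m)}" for m
  have Q_rat: "(\<forall>h\<in>Q m. R h) \<longleftrightarrow> (\<forall>r::rat. of_rat r \<in> Q m \<longrightarrow> R (of_rat r))" for R m
    by (auto simp: Q_def Rats_def)
  define D where "D = {x. \<forall>k. \<exists>m. \<forall>h\<in>Q m. \<forall>h'\<in>Q m. \<bar>q h x - q h' x\<bar> \<le> 1 / real (Suc k)}"
  have D_sets: "D \<in> sets borel"
    unfolding D_def Q_rat by measurable
  have D_iff: "x \<in> D \<longleftrightarrow> (\<exists>d. (f has_real_derivative d) (at x))" for x
  proof
    assume x: "x \<in> D"
    have near: "\<exists>m. \<forall>h h'. h \<noteq> 0 \<longrightarrow> \<bar>h\<bar> < 1 / real (Suc m) \<longrightarrow> h' \<noteq> 0 \<longrightarrow> \<bar>h'\<bar> < 1 / real (Suc m)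
         \<longrightarrow> \<bar>q h x - q h' x\<bar> \<le> 1 / real (Suc k)" for k
    proof -
      from x obtain m where m: "\<And>h h'. h \<in> Q m \<Longrightarrow> h' \<in> Q m \<Longrightarrow> \<bar>q h x - q h' x\<bar> \<le> 1 / real (Suc k)"
        unfolding D_def by blast
      define O' where "O' = {h. \<bar>h\<bar> < 1 / real (Suc m)} - {0::real}"
      have "open O'" unfolding O'_def
        by (intro open_Diff open_Collect_less continuous_intros) auto
      have dense: "G h \<le> B" if "\<And>r. r \<in> Q m \<Longrightarrow> G r \<le> B" "h \<in> O'" "isCont G h" for G :: "real \<Rightarrow> real" and B h
      proof (rule ccontr)
        assume "\<not> G h \<le> B"
        then have "eventually (\<lambda>r. G r > B) (nhds h)"
          using order_tendstoD(1)[OF that(3)[unfolded continuous_at tendsto_at_iff_tendsto_nhds], of B] by simp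
        moreover have "eventually (\<lambda>r. r \<in> O') (nhds h)"
          using \<open>open O'\<close> that(2) by (rule eventually_nhds_in_open)
        ultimately have "eventually (\<lambda>r. G r > B \<and> r \<in> O') (nhds h)" by (rule eventually_conj)
        then obtain S where S: "open S" "h \<in> S" "\<And>r. r \<in> S \<Longrightarrow> G r > B \<and> r \<in> O'"
          unfolding eventually_nhds by blast
        obtain e where e: "e > 0" "ball h e \<subseteq> S" using S(1,2) by (rule openE)
        obtain r where r: "r \<in> \<rat>" "h < r" "r < h + e"
          using Rats_dense_in_real[of h "h + e"] e(1) by auto
        then have "r \<in> S" using e(2) by (auto simp: dist_real_def)
        with r(1)
        show False using S(3)[of r] that(1)[of r] by (auto simp: O'_def Q_def)
      qed
      have "\<bar>q h x - q h' x\<bar> \<le> 1 / real (Suc k)" if h: "h \<in> O'" "h' \<in> O'" for h h'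
      proof (rule dense[of "\<lambda>h. \<bar>q h x - q h' x\<bar>", OF _ h(1)])
        show "isCont (\<lambda>h. \<bar>q h x - q h' x\<bar>) h"
          using h by (intro continuous_intros q_cont) (auto simp: O'_def)
        fix r assume r: "r \<in> Q m"
        show "\<bar>q r x - q h' x\<bar> \<le> 1 / real (Suc k)"
        proof (rule dense[of "\<lambda>h'. \<bar>q r x - q h' x\<bar>", OF _ h(2)])
          show "isCont (\<lambda>h'. \<bar>q r x - q h' x\<bar>) h'"
            using h by (intro continuous_intros q_cont) (auto simp: O'_def)
        qed (use m r in auto)
      qed
      then show ?thesis by (intro exI[of _ m]) (auto simp: O'_def)
    qed
    have "Cauchy (\<lambda>n. q (1 / real (Suc n)) x)"
    proof (rule metric_CauchyI)
      fix e :: real assume "0 < e"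
      then obtain k where k: "1 / real (Suc k) < e" using nat_approx_posE by blast
      from near[of k] obtain m where m: "\<And>h h'. h \<noteq> 0 \<Longrightarrow> \<bar>h\<bar> < 1 / real (Suc m) \<Longrightarrow> h' \<noteq> 0 \<Longrightarrow>
        \<bar>h'\<bar> < 1 / real (Suc m) \<Longrightarrow> \<bar>q h x - q h' x\<bar> \<le> 1 / real (Suc k)" by blast
      show "\<exists>M. \<forall>i\<ge>M. \<forall>j\<ge>M. dist (q (1 / real (Suc i)) x) (q (1 / real (Suc j)) x) < e"
      proof (intro exI allI impI)
        fix i j assume "Suc m \<le> i" "Suc m \<le> j"
        then show "dist (q (1 / real (Suc i)) x) (q (1 / real (Suc j)) x) < e"
          using m[of "1 / real (Suc i)" "1 / real (Suc j)"] k by (simp add: dist_real_def frac_less2)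
      qed
    qed
    then obtain d where d: "(\<lambda>n. q (1 / real (Suc n)) x) \<longlonglongrightarrow> d"
      using Cauchy_convergent_iff convergent_def by blast
    have "((\<lambda>h. q h x) \<longlongrightarrow> d) (at 0)"
    proof (rule tendstoI)
      fix e :: real assume "0 < e"
      then obtain k where k: "1 / real (Suc k) < e" using nat_approx_posE by blast
      from near[of k] obtain m where m: "\<And>h h'. h \<noteq> 0 \<Longrightarrow> \<bar>h\<bar> < 1 / real (Suc m) \<Longrightarrow> h' \<noteq> 0 \<Longrightarrow>
        \<bar>h'\<bar> < 1 / real (Suc m) \<Longrightarrow> \<bar>q h x - q h' x\<bar> \<le> 1 / real (Suc k)" by blast
      have "\<bar>q h x - d\<bar> \<le> 1 / real (Suc k)" if "h \<noteq> 0" "\<bar>h\<bar> < 1 / real (Suc m)" for h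
      proof (rule tendsto_upperbound)
        show "(\<lambda>n. \<bar>q h x - q (1 / real (Suc n)) x\<bar>) \<longlonglongrightarrow> \<bar>q h x - d\<bar>"
          by (intro tendsto_intros d)
        show "\<forall>\<^sub>F n in sequentially. \<bar>q h x - q (1 / real (Suc n)) x\<bar> \<le> 1 / real (Suc k)"
          using eventually_ge_at_top[of "Suc m"]
        proof eventually_elim
          case (elim n)
          then show ?case using m[OF that, of "1 / real (Suc n)"] by (simp add: frac_less2)
        qed
      qed simp
      then show "\<forall>\<^sub>F h in at 0. dist (q h x) d < e"
        unfolding eventually_at using k
        by (intro exI[of _ "1 / real (Suc m)"]) (auto simp: dist_real_def simp del: of_nat_Suc intro: le_less_trans)
    qed
    then show "\<exists>d. (f has_real_derivative d) (at x)" unfolding DERIV_def q_def by blast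
  next
    assume "\<exists>d. (f has_real_derivative d) (at x)"
    then obtain d where d: "((\<lambda>h. q h x) \<longlongrightarrow> d) (at 0)" by (auto simp: DERIV_def q_def)
    show "x \<in> D" unfolding D_def
    proof safe
      fix k
      define c where "c = 1 / real (Suc k)"
      have "c > 0" by (simp add: c_def)
      with tendstoD[OF d, of "c / 2"] obtain e where e: "e > 0"
        and *: "\<And>h. h \<noteq> 0 \<Longrightarrow> \<bar>h\<bar> < e \<Longrightarrow> \<bar>q h x - d\<bar> < c / 2"
        by (auto simp: eventually_at dist_real_def)
      obtain m where m: "1 / real (Suc m) < e" using nat_approx_posE[OF e] by blast
      have "\<bar>q h x - q h' x\<bar> \<le> c" if "h \<in> Q m" "h' \<in> Q m" for h h'
      proof -
        have "\<bar>q h x - d\<bar> < c / 2" "\<bar>q h' x - d\<bar> < c / 2"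
          using *[of h] *[of h'] that m by (auto simp: Q_def)
        then show ?thesis by linarith
      qed
      then show "\<exists>m. \<forall>h\<in>Q m. \<forall>h'\<in>Q m. \<bar>q h x - q h' x\<bar> \<le> 1 / real (Suc k)"
        unfolding c_def by blast
    qed
  qed
  have lim: "(\<lambda>n. q (1 / real (Suc n)) x) \<longlonglongrightarrow> deriv f x" if "x \<in> D" for x
  proof -
    from that D_iff obtain d where d: "(f has_real_derivative d) (at x)" by blast
    then have "((\<lambda>h. q h x) \<longlongrightarrow> deriv f x) (at 0)"
      using DERIV_imp_deriv[OF d] by (simp add: DERIV_def q_def)
    then show ?thesis
      by (rule filterlim_compose) (simp add: filterlim_at LIMSEQ_Suc[OF lim_1_over_n] del: of_nat_Suc)
  qed
  have const: "deriv f x = (SOME d::real. False)" if "x \<notin> D" for x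
    using that D_iff[of x] by (simp add: deriv_def)
  have "deriv f = (\<lambda>x. lim (\<lambda>n. if x \<in> D then q (1 / real (Suc n)) x else (SOME d. False)))"
  proof
    fix x
    show "deriv f x = lim (\<lambda>n. if x \<in> D then q (1 / real (Suc n)) x else (SOME d. False))"
      by (cases "x \<in> D") (simp_all add: limI[OF lim] const del: of_nat_Suc)
  qed
  also have "\<dots> \<in> borel_measurable borel"
    using D_sets by measurable
  finally show ?thesis .
qed

section \<open>Independent pairs, moment bounds and perturbed weak limits\<close>

text \<open>
  Two families that are independent of each other, and independent within, form a family of independent pairs.
  It suffices to factorise the probabilities of finite intersections of rectangles, which generate the product
  sigma-algebra.
\<close>

lemma (in prob_space) indep_vars_Pair:
  assumes X: "indep_vars (\<lambda>_. M1) X UNIV" and Z: "indep_vars (\<lambda>_. M2) Z UNIV"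
    and XZ: "indep_var (\<Pi>\<^sub>M i\<in>UNIV. M1) (\<lambda>\<omega> i. X i \<omega>) (\<Pi>\<^sub>M i\<in>UNIV. M2) (\<lambda>\<omega> i. Z i \<omega>)"
  shows "indep_vars (\<lambda>_. M1 \<Otimes>\<^sub>M M2) (\<lambda>i \<omega>. (X i \<omega>, Z i \<omega>)) (UNIV :: 'i set)"
proof -
  have Xm [measurable]: "random_variable M1 (X i)" and Zm [measurable]: "random_variable M2 (Z i)" for i
    using X Z by (auto simp: indep_vars_def2)
  let ?E = "\<lambda>i. {X i -` A \<inter> Z i -` B \<inter> space M |A B. A \<in> sets M1 \<and> B \<in> sets M2}"
  have prod: "prob (\<Inter>j\<in>J. X j -` A j \<inter> Z j -` B j \<inter> space M)
     = (\<Prod>j\<in>J. prob (X j -` A j \<inter> space M)) * (\<Prod>j\<in>J. prob (Z j -` B j \<inter> space M))"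
    if J: "J \<noteq> {}" "finite J" and A: "\<And>j. j \<in> J \<Longrightarrow> A j \<in> sets M1" and B: "\<And>j. j \<in> J \<Longrightarrow> B j \<in> sets M2"
    for J :: "'i set" and A B
  proof -
    define XA where "XA = {x \<in> space (\<Pi>\<^sub>M i\<in>UNIV. M1). \<forall>j\<in>J. x j \<in> A j}"
    define ZB where "ZB = {x \<in> space (\<Pi>\<^sub>M i\<in>UNIV. M2). \<forall>j\<in>J. x j \<in> B j}"
    have XA: "XA \<in> sets (\<Pi>\<^sub>M i\<in>UNIV. M1)" unfolding XA_def
      using J(2) A by (intro sets.sets_Collect_finite_All) auto
    have ZB: "ZB \<in> sets (\<Pi>\<^sub>M i\<in>UNIV. M2)" unfolding ZB_def
      using J(2) B by (intro sets.sets_Collect_finite_All) auto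
    have "(\<Inter>j\<in>J. X j -` A j \<inter> Z j -` B j \<inter> space M)
        = (\<lambda>\<omega>. (\<lambda>i. X i \<omega>, \<lambda>i. Z i \<omega>)) -` (XA \<times> ZB) \<inter> space M"
      using J measurable_space[OF Xm] measurable_space[OF Zm]
      by (auto simp: XA_def ZB_def space_PiM PiE_def)
    also have "prob \<dots> = prob ((\<lambda>\<omega> i. X i \<omega>) -` XA \<inter> space M) * prob ((\<lambda>\<omega> i. Z i \<omega>) -` ZB \<inter> space M)"
      by (rule indep_varD[OF XZ XA ZB])
    also have "(\<lambda>\<omega> i. X i \<omega>) -` XA \<inter> space M = (\<Inter>j\<in>J. X j -` A j \<inter> space M)"
      using J measurable_space[OF Xm] by (auto simp: XA_def space_PiM PiE_def)
    also have "(\<lambda>\<omega> i. Z i \<omega>) -` ZB \<inter> space M = (\<Inter>j\<in>J. Z j -` B j \<inter> space M)"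
      using J measurable_space[OF Zm] by (auto simp: ZB_def space_PiM PiE_def)
    finally show ?thesis
      using indep_varsD[OF X J] indep_varsD[OF Z J] A B by simp
  qed
  have "indep_sets ?E UNIV"
  proof (rule indep_setsI)
    fix C J assume J: "J \<noteq> {}" "finite J" and "\<forall>j\<in>J. C j \<in> ?E j"
    then have "\<forall>j\<in>J. \<exists>AB. C j = X j -` fst AB \<inter> Z j -` snd AB \<inter> space M \<and> fst AB \<in> sets M1 \<and> snd AB \<in> sets M2"
      by fastforce
    then obtain AB where AB: "\<And>j. j \<in> J \<Longrightarrow> C j = X j -` fst (AB j) \<inter> Z j -` snd (AB j) \<inter> space M"
      "\<And>j. j \<in> J \<Longrightarrow> fst (AB j) \<in> sets M1" "\<And>j. j \<in> J \<Longrightarrow> snd (AB j) \<in> sets M2"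
      by metis
    have "prob (\<Inter>j\<in>J. C j) = (\<Prod>j\<in>J. prob (X j -` fst (AB j) \<inter> space M) * prob (Z j -` snd (AB j) \<inter> space M))"
      using prod[OF J AB(2,3)] AB(1) by (simp add: prod.distrib)
    also have "\<dots> = (\<Prod>j\<in>J. prob (C j))"
    proof (rule prod.cong)
      fix j assume j: "j \<in> J"
      show "prob (X j -` fst (AB j) \<inter> space M) * prob (Z j -` snd (AB j) \<inter> space M) = prob (C j)"
        using prod[of "{j}" "\<lambda>j. fst (AB j)" "\<lambda>j. snd (AB j)"] AB j by simp
    qed simp
    finally show "prob (\<Inter>j\<in>J. C j) = (\<Prod>j\<in>J. prob (C j))" .
  next
    fix i show "?E i \<subseteq> events" by auto
  qed
  then have "indep_sets (\<lambda>i. sigma_sets (space M) (?E i)) UNIV"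
  proof (rule indep_sets_sigma)
    fix i show "Int_stable (?E i)"
    proof (rule Int_stableI)
      fix a b assume "a \<in> ?E i" "b \<in> ?E i"
      then obtain A B A' B' where "a = X i -` A \<inter> Z i -` B \<inter> space M" "b = X i -` A' \<inter> Z i -` B' \<inter> space M"
        "A \<in> sets M1" "B \<in> sets M2" "A' \<in> sets M1" "B' \<in> sets M2" by blast
      then show "a \<inter> b \<in> ?E i"
        by (intro CollectI exI[of _ "A \<inter> A'"] exI[of _ "B \<inter> B'"]) auto
    qed
  qed
  moreover have "{(\<lambda>\<omega>. (X i \<omega>, Z i \<omega>)) -` A \<inter> space M |A. A \<in> sets (M1 \<Otimes>\<^sub>M M2)} = sigma_sets (space M) (?E i)" for i
  proof -
    let ?R = "{a \<times> b |a b. a \<in> sets M1 \<and> b \<in> sets M2}"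
    have "{(\<lambda>\<omega>. (X i \<omega>, Z i \<omega>)) -` A \<inter> space M |A. A \<in> sets (M1 \<Otimes>\<^sub>M M2)}
      = sigma_sets (space M) {(\<lambda>\<omega>. (X i \<omega>, Z i \<omega>)) -` A \<inter> space M |A. A \<in> ?R}"
      unfolding sets_pair_measure
      by (rule sigma_sets_vimage_commute) (use measurable_space[OF Xm] measurable_space[OF Zm] in auto)
    also have "{(\<lambda>\<omega>. (X i \<omega>, Z i \<omega>)) -` A \<inter> space M |A. A \<in> ?R} = ?E i"
    proof (intro subset_antisym subsetI)
      fix x assume "x \<in> {(\<lambda>\<omega>. (X i \<omega>, Z i \<omega>)) -` A \<inter> space M |A. A \<in> ?R}"
      then obtain a b where "x = (\<lambda>\<omega>. (X i \<omega>, Z i \<omega>)) -` (a \<times> b) \<inter> space M" "a \<in> sets M1" "b \<in> sets M2" by blast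
      then show "x \<in> ?E i" by (intro CollectI exI[of _ a] exI[of _ b]) auto
    next
      fix x assume "x \<in> ?E i"
      then obtain a b where "x = X i -` a \<inter> Z i -` b \<inter> space M" "a \<in> sets M1" "b \<in> sets M2" by blast
      then show "x \<in> {(\<lambda>\<omega>. (X i \<omega>, Z i \<omega>)) -` A \<inter> space M |A. A \<in> ?R}"
        by (intro CollectI exI[of _ "a \<times> b"]) auto
    qed
    finally show ?thesis .
  qed
  ultimately show ?thesis by (simp add: indep_vars_def2)
qed

lemma (in prob_space) expectation_abs_le_sqrt:
  fixes Y :: "'a \<Rightarrow> real"
  assumes [measurable]: "Y \<in> borel_measurable M" and sq: "integrable M (\<lambda>\<omega>. (Y \<omega>)\<^sup>2)"
  shows "integrable M Y" "expectation (\<lambda>\<omega>. \<bar>Y \<omega>\<bar>) \<le> sqrt (expectation (\<lambda>\<omega>. (Y \<omega>)\<^sup>2))"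
proof -
  show int: "integrable M Y" by (rule square_integrable_imp_integrable[OF _ sq]) simp
  have "0 \<le> variance (\<lambda>\<omega>. \<bar>Y \<omega>\<bar>)" by (rule variance_positive)
  also have "\<dots> = expectation (\<lambda>\<omega>. (Y \<omega>)\<^sup>2) - (expectation (\<lambda>\<omega>. \<bar>Y \<omega>\<bar>))\<^sup>2"
    using int sq by (subst variance_eq) auto
  finally show "expectation (\<lambda>\<omega>. \<bar>Y \<omega>\<bar>) \<le> sqrt (expectation (\<lambda>\<omega>. (Y \<omega>)\<^sup>2))"
    by (intro real_le_rsqrt) simp
qed

lemma (in prob_space) second_moment_sum_indep:
  fixes Y :: "nat \<Rightarrow> 'a \<Rightarrow> real"
  assumes indep: "indep_vars (\<lambda>_. borel) Y UNIV"
    and sq: "\<And>i. integrable M (\<lambda>\<omega>. (Y i \<omega>)\<^sup>2)" and mean: "\<And>i. expectation (Y i) = 0"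
  shows "integrable M (\<lambda>\<omega>. (\<Sum>i<n. Y i \<omega>)\<^sup>2) \<and>
    expectation (\<lambda>\<omega>. (\<Sum>i<n. Y i \<omega>)\<^sup>2) = (\<Sum>i<n. expectation (\<lambda>\<omega>. (Y i \<omega>)\<^sup>2))"
proof (induction n)
  case (Suc n)
  have [measurable]: "Y i \<in> borel_measurable M" for i using indep by (auto simp: indep_vars_def2)
  have int: "integrable M (Y i)" for i by (rule expectation_abs_le_sqrt(1)) (use sq in auto)
  let ?S = "\<lambda>\<omega>. \<Sum>i<n. Y i \<omega>"
  have ind: "indep_var borel (Y n) borel ?S"
    by (rule indep_vars_sum) (auto intro: indep_vars_subset[OF indep])
  have intS: "integrable M ?S" using int by simp
  have cross: "integrable M (\<lambda>\<omega>. Y n \<omega> * ?S \<omega>)" "expectation (\<lambda>\<omega>. Y n \<omega> * ?S \<omega>) = 0"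
    using indep_var_integrable[OF ind int intS] indep_var_lebesgue_integral[OF ind int intS] mean by auto
  have eq: "(\<Sum>i<Suc n. Y i \<omega>)\<^sup>2 = (?S \<omega>)\<^sup>2 + 2 * (Y n \<omega> * ?S \<omega>) + (Y n \<omega>)\<^sup>2" for \<omega>
    by (simp add: power2_sum algebra_simps)
  show ?case unfolding eq using Suc sq[of n] cross by simp
qed simp

text \<open>
  The normalisation by \<open>sqrt n\<close> makes the second moment of the sum that of a single centred summand, whatever
  \<open>n\<close> is.  For \<open>n = 0\<close> the sum is empty and division by zero gives \<open>0\<close>.
\<close>

lemma (in prob_space) normalised_centred_sum_L1_bound:
  fixes W :: "nat \<Rightarrow> 'a \<Rightarrow> 'w" and h :: "'w \<Rightarrow> real"
  assumes indep: "indep_vars (\<lambda>_. N) W UNIV"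
    and distr: "\<And>i. distr M N (W i) = distr M N (W 0)"
    and h [measurable]: "h \<in> borel_measurable N"
    and sq: "integrable M (\<lambda>\<omega>. (h (W 0 \<omega>))\<^sup>2)"
  shows "integrable M (\<lambda>\<omega>. (\<Sum>i<n. h (W i \<omega>) - expectation (\<lambda>\<omega>. h (W 0 \<omega>))) / sqrt (real n))"
    and "expectation (\<lambda>\<omega>. \<bar>(\<Sum>i<n. h (W i \<omega>) - expectation (\<lambda>\<omega>. h (W 0 \<omega>))) / sqrt (real n)\<bar>)
           \<le> sqrt (expectation (\<lambda>\<omega>. (h (W 0 \<omega>))\<^sup>2))"
proof -
  have Wm [measurable]: "W i \<in> measurable M N" for i using indep by (auto simp: indep_vars_def2)
  have int_eq: "expectation (\<lambda>\<omega>. k (W i \<omega>)) = expectation (\<lambda>\<omega>. k (W 0 \<omega>))"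
    if [measurable]: "k \<in> borel_measurable N" for k :: "'w \<Rightarrow> real" and i
    using integral_distr[OF Wm that, of i] integral_distr[OF Wm that, of 0] distr[of i] by simp
  have int_iff: "integrable M (\<lambda>\<omega>. k (W i \<omega>)) \<longleftrightarrow> integrable M (\<lambda>\<omega>. k (W 0 \<omega>))"
    if [measurable]: "k \<in> borel_measurable N" for k :: "'w \<Rightarrow> real" and i
    using integrable_distr_eq[OF Wm that, of i] integrable_distr_eq[OF Wm that, of 0] distr[of i] by simp
  define m where "m = expectation (\<lambda>\<omega>. h (W 0 \<omega>))"
  define Y where "Y i \<omega> = h (W i \<omega>) - m" for i \<omega>
  have int: "integrable M (\<lambda>\<omega>. h (W 0 \<omega>))" by (rule expectation_abs_le_sqrt(1)) (use sq in auto)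
  have sqY0: "integrable M (\<lambda>\<omega>. (h (W 0 \<omega>) - m)\<^sup>2)"
    unfolding power2_diff using int sq by (simp add: mult.assoc)
  have sqY: "integrable M (\<lambda>\<omega>. (Y i \<omega>)\<^sup>2)" for i
    using int_iff[of "\<lambda>w. (h w - m)\<^sup>2" i] sqY0 by (simp add: Y_def)
  have intY: "integrable M (\<lambda>\<omega>. h (W i \<omega>))" for i using int_iff[of h i] int by simp
  have mean: "expectation (Y i) = 0" for i
    using intY[of i] int_eq[of h i] prob_space by (simp add: Y_def[abs_def] m_def)
  have indY: "indep_vars (\<lambda>_. borel) Y UNIV"
    unfolding Y_def[abs_def] by (rule indep_vars_compose2[OF indep, where Y = "\<lambda>_ w. h w - m"]) simp
  have varY: "expectation (\<lambda>\<omega>. (Y i \<omega>)\<^sup>2) \<le> expectation (\<lambda>\<omega>. (h (W 0 \<omega>))\<^sup>2)" for i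
  proof -
    have "expectation (\<lambda>\<omega>. (Y i \<omega>)\<^sup>2) = expectation (\<lambda>\<omega>. (h (W 0 \<omega>) - m)\<^sup>2)"
      using int_eq[of "\<lambda>w. (h w - m)\<^sup>2" i] by (simp add: Y_def)
    also have "\<dots> = expectation (\<lambda>\<omega>. (h (W 0 \<omega>))\<^sup>2) - m\<^sup>2"
      unfolding m_def using variance_eq[OF int sq] .
    finally show ?thesis by simp
  qed
  note S = second_moment_sum_indep[OF indY sqY mean, of n]
  let ?T = "\<lambda>\<omega>. (\<Sum>i<n. Y i \<omega>) / sqrt (real n)"
  have Tm: "?T \<in> borel_measurable M" unfolding Y_def by measurable
  have Tsq: "integrable M (\<lambda>\<omega>. (?T \<omega>)\<^sup>2)" using S by (simp add: power_divide)
  have "expectation (\<lambda>\<omega>. (?T \<omega>)\<^sup>2) = (\<Sum>i<n. expectation (\<lambda>\<omega>. (Y i \<omega>)\<^sup>2)) / real n"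
    using S by (simp add: power_divide)
  also have "\<dots> \<le> (\<Sum>i<n. expectation (\<lambda>\<omega>. (h (W 0 \<omega>))\<^sup>2)) / real n"
    by (intro divide_right_mono sum_mono varY) simp
  also have "\<dots> \<le> expectation (\<lambda>\<omega>. (h (W 0 \<omega>))\<^sup>2)" by (cases "n = 0") auto
  finally have T2: "expectation (\<lambda>\<omega>. (?T \<omega>)\<^sup>2) \<le> expectation (\<lambda>\<omega>. (h (W 0 \<omega>))\<^sup>2)" .
  show "integrable M (\<lambda>\<omega>. (\<Sum>i<n. h (W i \<omega>) - expectation (\<lambda>\<omega>. h (W 0 \<omega>))) / sqrt (real n))"
    using expectation_abs_le_sqrt(1)[OF Tm Tsq] by (simp add: Y_def m_def)
  show "expectation (\<lambda>\<omega>. \<bar>(\<Sum>i<n. h (W i \<omega>) - expectation (\<lambda>\<omega>. h (W 0 \<omega>))) / sqrt (real n)\<bar>)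
           \<le> sqrt (expectation (\<lambda>\<omega>. (h (W 0 \<omega>))\<^sup>2))"
    using order_trans[OF expectation_abs_le_sqrt(2)[OF Tm Tsq]] T2 by (simp add: Y_def m_def)
qed

lemma norm_iexp_diff_le: "norm (iexp x - iexp y) \<le> \<bar>x - y\<bar>"
proof -
  have "iexp y * iexp (x - y) = iexp x"
    unfolding exp_add[symmetric] by (simp add: algebra_simps)
  then have "iexp x - iexp y = iexp y * (iexp (x - y) - 1)"
    by (simp only: right_diff_distrib mult_1_right)
  then have "norm (iexp x - iexp y) = norm (iexp (x - y) - 1)" by (simp add: norm_mult)
  also have "\<dots> \<le> \<bar>x - y\<bar>" using iexp_approx1[of "x - y" 0] by simp
  finally show ?thesis .
qed

text \<open>
  A Slutsky argument on characteristic functions: since \<open>iexp\<close> is Lipschitz and bounded, those of \<open>B n\<close> and of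
  \<open>\<tau> * A n\<close> have the same limit.
\<close>

lemma (in prob_space) weak_conv_scaled_perturbation:
  fixes A B :: "nat \<Rightarrow> 'a \<Rightarrow> real"
  assumes A [measurable]: "\<And>n. A n \<in> borel_measurable M" and B [measurable]: "\<And>n. B n \<in> borel_measurable M"
    and \<mu>: "real_distribution \<mu>" and conv: "weak_conv_m (\<lambda>n. distr M borel (A n)) \<mu>"
    and close: "\<And>\<eta>. \<eta> > 0 \<Longrightarrow> (\<lambda>n. prob {\<omega> \<in> space M. \<bar>B n \<omega> - \<tau> * A n \<omega>\<bar> > \<eta>}) \<longlonglongrightarrow> 0"
  shows "weak_conv_m (\<lambda>n. distr M borel (B n)) (distr \<mu> borel (\<lambda>x. \<tau> * x))"
proof (rule levy_continuity)
  interpret \<mu>: real_distribution \<mu> by fact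
  show "real_distribution (distr M borel (B n))" for n by (rule real_distribution_distr) simp
  show "real_distribution (distr \<mu> borel (\<lambda>x. \<tau> * x))" by (rule \<mu>.real_distribution_distr) simp
  fix t
  have charA: "char (distr M borel (A n)) s = (CLINT \<omega>|M. iexp (s * A n \<omega>))" for n s
    unfolding char_def by (subst integral_distr) auto
  have charB: "char (distr M borel (B n)) s = (CLINT \<omega>|M. iexp (s * B n \<omega>))" for n s
    unfolding char_def by (subst integral_distr) auto
  have intA: "complex_integrable M (\<lambda>\<omega>. iexp (s * A n \<omega>))" for n s
    by (rule integrable_const_bound[where B = 1]) auto
  have intB: "complex_integrable M (\<lambda>\<omega>. iexp (s * B n \<omega>))" for n s
    by (rule integrable_const_bound[where B = 1]) auto
  have diff: "norm (char (distr M borel (B n)) t - char (distr M borel (A n)) (t * \<tau>))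
      \<le> \<bar>t\<bar> * \<eta> + 2 * prob {\<omega> \<in> space M. \<bar>B n \<omega> - \<tau> * A n \<omega>\<bar> > \<eta>}" if "\<eta> > 0" for n \<eta>
  proof -
    let ?E = "{\<omega> \<in> space M. \<bar>B n \<omega> - \<tau> * A n \<omega>\<bar> > \<eta>}"
    have E: "?E \<in> events" by measurable
    have intE: "integrable M (\<lambda>\<omega>. 2 * (indicator ?E \<omega> :: real))"
      using E by (intro integrable_mult_right integrable_real_indicator) (auto simp: emeasure_eq_measure)
    have "char (distr M borel (B n)) t - char (distr M borel (A n)) (t * \<tau>)
      = (CLINT \<omega>|M. iexp (t * B n \<omega>) - iexp (t * \<tau> * A n \<omega>))"
      unfolding charA charB by (rule Bochner_Integration.integral_diff[OF intB intA, symmetric])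
    also have "norm \<dots> \<le> (LINT \<omega>|M. norm (iexp (t * B n \<omega>) - iexp (t * \<tau> * A n \<omega>)))"
      by (rule integral_norm_bound)
    also have "\<dots> \<le> (LINT \<omega>|M. \<bar>t\<bar> * \<eta> + 2 * indicator ?E \<omega>)"
    proof (rule integral_mono)
      show "integrable M (\<lambda>\<omega>. norm (iexp (t * B n \<omega>) - iexp (t * \<tau> * A n \<omega>)))"
        using intA intB by (intro integrable_norm Bochner_Integration.integrable_diff)
      show "integrable M (\<lambda>\<omega>. \<bar>t\<bar> * \<eta> + 2 * indicator ?E \<omega>)"
        using intE by (intro Bochner_Integration.integrable_add) auto
      fix \<omega> assume \<omega>: "\<omega> \<in> space M"
      show "norm (iexp (t * B n \<omega>) - iexp (t * \<tau> * A n \<omega>)) \<le> \<bar>t\<bar> * \<eta> + 2 * indicator ?E \<omega>"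
      proof (cases "\<omega> \<in> ?E")
        case True
        have "norm (iexp (t * B n \<omega>) - iexp (t * \<tau> * A n \<omega>)) \<le> 2"
          by (rule order_trans[OF norm_triangle_ineq4]) simp
        then show ?thesis using True that by (simp add: add_increasing)
      next
        case False
        have "norm (iexp (t * B n \<omega>) - iexp (t * \<tau> * A n \<omega>)) \<le> \<bar>t * B n \<omega> - t * \<tau> * A n \<omega>\<bar>"
          by (rule norm_iexp_diff_le)
        also have "\<dots> = \<bar>t\<bar> * \<bar>B n \<omega> - \<tau> * A n \<omega>\<bar>" by (simp add: abs_mult[symmetric] algebra_simps)
        also have "\<dots> \<le> \<bar>t\<bar> * \<eta>" using False \<omega> by (intro mult_left_mono) auto
        finally show ?thesis using False by simp
      qed
    qed
    also have "\<dots> = \<bar>t\<bar> * \<eta> + 2 * prob ?E"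
      using E prob_space intE by (subst Bochner_Integration.integral_add) auto
    finally show ?thesis .
  qed
  have "(\<lambda>n. char (distr M borel (B n)) t - char (distr M borel (A n)) (t * \<tau>)) \<longlonglongrightarrow> 0"
  proof (rule LIMSEQ_I)
    fix r :: real assume r: "0 < r"
    define \<eta> where "\<eta> = r / (2 * (\<bar>t\<bar> + 1))"
    have \<eta>: "\<eta> > 0" using r by (simp add: \<eta>_def)
    have t\<eta>: "\<bar>t\<bar> * \<eta> < r / 2" using r by (simp add: \<eta>_def field_simps)
    have "\<forall>\<^sub>F n in sequentially. prob {\<omega> \<in> space M. \<bar>B n \<omega> - \<tau> * A n \<omega>\<bar> > \<eta>} < r / 4"
      by (rule order_tendstoD[OF close[OF \<eta>]]) (use r in simp)
    then have "\<forall>\<^sub>F n in sequentially.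
        norm (char (distr M borel (B n)) t - char (distr M borel (A n)) (t * \<tau>) - 0) < r"
    proof eventually_elim
      case (elim n)
      show ?case using diff[OF \<eta>, of n] elim t\<eta> by simp
    qed
    then show "\<exists>no. \<forall>n\<ge>no. norm (char (distr M borel (B n)) t - char (distr M borel (A n)) (t * \<tau>) - 0) < r"
      by (simp add: eventually_sequentially)
  qed
  moreover have "(\<lambda>n. char (distr M borel (A n)) (t * \<tau>)) \<longlonglongrightarrow> char \<mu> (t * \<tau>)"
    by (rule levy_continuity1[OF real_distribution_distr \<mu> conv]) simp
  ultimately have "(\<lambda>n. char (distr M borel (B n)) t) \<longlonglongrightarrow> char \<mu> (t * \<tau>)"
    using tendsto_add by fastforce
  also have "char \<mu> (t * \<tau>) = char (distr \<mu> borel (\<lambda>x. \<tau> * x)) t"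
    unfolding char_def by (subst integral_distr) (auto simp: mult.assoc)
  finally show "(\<lambda>n. char (distr M borel (B n)) t) \<longlonglongrightarrow> char (distr \<mu> borel (\<lambda>x. \<tau> * x)) t" .
qed

lemma distr_std_normal_scale:
  assumes "\<tau> \<noteq> 0"
  shows "distr std_normal_distribution borel (\<lambda>x. \<tau> * x) = density lborel (normal_density 0 \<bar>\<tau>\<bar>)"
proof -
  interpret prob_space std_normal_distribution by (rule prob_space_normal_density) simp
  have "distributed std_normal_distribution lborel (\<lambda>x. x) (normal_density 0 1)"
    by (simp add: distributed_def distr_id2 cong: distr_cong)
  from normal_density_affine[OF this, of \<tau> 0] assms
  have "distributed std_normal_distribution lborel (\<lambda>x. \<tau> * x) (normal_density 0 \<bar>\<tau>\<bar>)" by simp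
  then show ?thesis by (simp add: distributed_def cong: distr_cong)
qed

text \<open>
  The weight used for the rate.  Its integral is of the order \<open>1 / K\<close>, while on \<open>{-\<bar>h\<bar>..\<bar>h\<bar>}\<close> it is at least
  \<open>1 / h\<^sup>2\<close> as soon as \<open>K \<le> \<bar>h\<bar>\<close>.
\<close>

lemma integral_cauchy_weight:
  fixes K :: real
  assumes K: "0 < K"
  shows "integrable lborel (\<lambda>u. 2 / (K\<^sup>2 + u\<^sup>2))" and "(\<integral>u. 2 / (K\<^sup>2 + u\<^sup>2) \<partial>lborel) = 2 * pi / K"
proof -
  have int1: "integrable lborel (\<lambda>x::real. inverse (1 + x\<^sup>2))"
    using integrable_inverse_1_plus_square by (simp add: set_integrable_def)
  have val1: "(\<integral>x. inverse (1 + (x::real)\<^sup>2) \<partial>lborel) = pi"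
    using LBINT_inverse_1_plus_square
    by (simp add: interval_lebesgue_integral_def set_lebesgue_integral_def)
  have eq: "2 / (K\<^sup>2 + u\<^sup>2) = (2 / K\<^sup>2) * inverse (1 + (0 + (1 / K) * u)\<^sup>2)" for u
  proof -
    have "1 + (0 + (1 / K) * u)\<^sup>2 = (K\<^sup>2 + u\<^sup>2) / K\<^sup>2"
      using K by (simp add: power_divide add_divide_distrib)
    then show ?thesis using K by simp
  qed
  show "integrable lborel (\<lambda>u. 2 / (K\<^sup>2 + u\<^sup>2))"
    unfolding eq using lborel_integrable_real_affine[OF int1, of "1 / K" 0] K
    by (intro integrable_mult_right) simp
  have "pi = (1 / K) * (\<integral>u. inverse (1 + (0 + (1 / K) * u)\<^sup>2) \<partial>lborel)"
    using lborel_integral_real_affine[of "1 / K" "\<lambda>x::real. inverse (1 + x\<^sup>2)" 0] K val1 by simp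
  then have "(\<integral>u. inverse (1 + (0 + (1 / K) * u)\<^sup>2) \<partial>lborel) = K * pi"
    using K by (simp add: field_simps)
  then show "(\<integral>u. 2 / (K\<^sup>2 + u\<^sup>2) \<partial>lborel) = 2 * pi / K"
    unfolding eq integral_mult_right_zero using K by (simp add: power2_eq_square)
qed

text \<open>
  Fubini's theorem and Markov's inequality: bounds on the marginal first moments of a process control a weighted
  integral of its absolute path.
\<close>

lemma (in prob_space) weighted_path_Markov:
  fixes S :: "real \<Rightarrow> 'a \<Rightarrow> real" and \<rho> B :: "real \<Rightarrow> real"
  assumes S [measurable]: "(\<lambda>(u, \<omega>). S u \<omega>) \<in> borel_measurable (lborel \<Otimes>\<^sub>M M)"
    and \<rho> [measurable]: "\<rho> \<in> borel_measurable borel" and \<rho>0: "\<And>u. 0 \<le> \<rho> u"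
    and bound: "\<And>u. (\<integral>\<^sup>+\<omega>. ennreal \<bar>S u \<omega>\<bar> \<partial>M) \<le> ennreal (B u)" and B0: "\<And>u. 0 \<le> B u"
    and int: "integrable lborel (\<lambda>u. \<rho> u * B u)" and c: "0 < c"
  shows "{\<omega> \<in> space M. ennreal c \<le> (\<integral>\<^sup>+u. ennreal (\<rho> u * \<bar>S u \<omega>\<bar>) \<partial>lborel)} \<in> events"
    and "prob {\<omega> \<in> space M. ennreal c \<le> (\<integral>\<^sup>+u. ennreal (\<rho> u * \<bar>S u \<omega>\<bar>) \<partial>lborel)}
           \<le> (\<integral>u. \<rho> u * B u \<partial>lborel) / c"
proof -
  interpret pair: pair_sigma_finite lborel M ..
  define A where "A \<omega> = (\<integral>\<^sup>+u. ennreal (\<rho> u * \<bar>S u \<omega>\<bar>) \<partial>lborel)" for \<omega>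
  have m: "(\<lambda>(u, \<omega>). ennreal (\<rho> u * \<bar>S u \<omega>\<bar>)) \<in> borel_measurable (lborel \<Otimes>\<^sub>M M)"
    by measurable
  have m': "(\<lambda>(\<omega>, u). ennreal (\<rho> u * \<bar>S u \<omega>\<bar>)) \<in> borel_measurable (M \<Otimes>\<^sub>M lborel)"
    using measurable_pair_swap[OF m] by (simp add: split_beta)
  have Am [measurable]: "A \<in> borel_measurable M"
    unfolding A_def[abs_def] using sigma_finite_measure.borel_measurable_nn_integral[OF sigma_finite_lborel m'] by simp
  have "(\<integral>\<^sup>+\<omega>. A \<omega> \<partial>M) = (\<integral>\<^sup>+u. \<integral>\<^sup>+\<omega>. ennreal (\<rho> u * \<bar>S u \<omega>\<bar>) \<partial>M \<partial>lborel)"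
    unfolding A_def by (rule pair.Fubini'[OF m])
  also have "\<dots> = (\<integral>\<^sup>+u. ennreal (\<rho> u) * (\<integral>\<^sup>+\<omega>. ennreal \<bar>S u \<omega>\<bar> \<partial>M) \<partial>lborel)"
    using \<rho>0 by (intro nn_integral_cong) (simp add: ennreal_mult nn_integral_cmult)
  also have "\<dots> \<le> (\<integral>\<^sup>+u. ennreal (\<rho> u * B u) \<partial>lborel)"
    using \<rho>0 B0 bound by (intro nn_integral_mono) (simp add: ennreal_mult mult_left_mono)
  also have "\<dots> = ennreal (\<integral>u. \<rho> u * B u \<partial>lborel)"
    using \<rho>0 B0 int by (intro nn_integral_eq_integral) auto
  finally have EA: "(\<integral>\<^sup>+\<omega>. A \<omega> \<partial>M) \<le> ennreal (\<integral>u. \<rho> u * B u \<partial>lborel)" .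
  have set_eq: "{\<omega> \<in> space M. ennreal c \<le> A \<omega>} = {\<omega> \<in> space M. 1 \<le> ennreal (1 / c) * A \<omega>}"
  proof -
    have "ennreal c \<le> a \<longleftrightarrow> 1 \<le> ennreal (1 / c) * a" for a
    proof -
      have cc: "ennreal (1 / c) * ennreal c = 1" using c by (simp add: ennreal_mult[symmetric])
      show ?thesis
      proof
        assume "ennreal c \<le> a"
        then have "ennreal (1 / c) * ennreal c \<le> ennreal (1 / c) * a" by (rule mult_left_mono) simp
        then show "1 \<le> ennreal (1 / c) * a" using cc by simp
      next
        assume "1 \<le> ennreal (1 / c) * a"
        then have "ennreal c * 1 \<le> ennreal c * (ennreal (1 / c) * a)" by (rule mult_left_mono) simp
        also have "\<dots> = (ennreal (1 / c) * ennreal c) * a" by (simp only: ac_simps)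
        also have "\<dots> = a" unfolding cc by simp
        finally show "ennreal c \<le> a" by simp
      qed
    qed
    then show ?thesis by auto
  qed
  show "{\<omega> \<in> space M. ennreal c \<le> (\<integral>\<^sup>+u. ennreal (\<rho> u * \<bar>S u \<omega>\<bar>) \<partial>lborel)} \<in> events"
    unfolding A_def[symmetric] by measurable
  have "emeasure M {\<omega> \<in> space M. ennreal c \<le> A \<omega>} \<le> ennreal (1 / c) * (\<integral>\<^sup>+\<omega>. A \<omega> * indicator (space M) \<omega> \<partial>M)"
    unfolding set_eq by (rule nn_integral_Markov_inequality) auto
  also have "(\<integral>\<^sup>+\<omega>. A \<omega> * indicator (space M) \<omega> \<partial>M) = (\<integral>\<^sup>+\<omega>. A \<omega> \<partial>M)"
    by (intro nn_integral_cong) simp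
  also have "ennreal (1 / c) * \<dots> \<le> ennreal (1 / c) * ennreal (\<integral>u. \<rho> u * B u \<partial>lborel)"
    by (intro mult_left_mono EA) simp
  also have "\<dots> = ennreal ((\<integral>u. \<rho> u * B u \<partial>lborel) / c)"
    using c \<rho>0 B0 by (simp add: ennreal_mult[symmetric])
  finally show "prob {\<omega> \<in> space M. ennreal c \<le> (\<integral>\<^sup>+u. ennreal (\<rho> u * \<bar>S u \<omega>\<bar>) \<partial>lborel)}
           \<le> (\<integral>u. \<rho> u * B u \<partial>lborel) / c"
    using c \<rho>0 B0 unfolding A_def[symmetric]
    by (simp add: emeasure_eq_measure)
qed

section \<open>Minimisers of contrasts with absolutely continuous paths\<close>

text \<open>
  A one-dimensional statistical criterion whose increments are integrals of a score \<open>q\<close> with a square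
  integrable envelope \<open>b\<close>.  The parameter is the displacement from the true value, which is thus \<open>0\<close>.
\<close>

locale integrated_score_model = prob_space M for M :: "'a measure" +
  fixes N :: "'w measure" and W :: "nat \<Rightarrow> 'a \<Rightarrow> 'w" and q :: "real \<Rightarrow> 'w \<Rightarrow> real" and b :: "'w \<Rightarrow> real"
  assumes W_indep: "indep_vars (\<lambda>_. N) W UNIV"
    and W_distr: "\<And>i. distr M N (W i) = distr M N (W 0)"
    and q_measurable: "(\<lambda>(s, w). q s w) \<in> borel_measurable (borel \<Otimes>\<^sub>M N)"
    and b_measurable [measurable]: "b \<in> borel_measurable N"
    and q_bound: "\<And>s w. \<bar>q s w\<bar> \<le> b w"
    and b_square: "integrable M (\<lambda>\<omega>. (b (W 0 \<omega>))\<^sup>2)"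
begin

definition mean_score :: "real \<Rightarrow> real" where
  "mean_score s = expectation (\<lambda>\<omega>. q s (W 0 \<omega>))"

text \<open>
  The derivative of the centred empirical criterion, on the scale in which the displacement \<open>t\<close> is
  \<open>u / sqrt n\<close>.
\<close>

definition score_process :: "nat \<Rightarrow> real \<Rightarrow> 'a \<Rightarrow> real" where
  "score_process n u \<omega> =
     (\<Sum>i<n. q (u / sqrt (real n)) (W i \<omega>) - mean_score (u / sqrt (real n))) / sqrt (real n)"

definition loss_increment :: "real \<Rightarrow> 'w \<Rightarrow> real" where
  "loss_increment t w = (\<integral>s. signed_interval t s * q s w \<partial>lborel)"

definition excess_risk :: "real \<Rightarrow> real" where
  "excess_risk t = expectation (\<lambda>\<omega>. loss_increment t (W 0 \<omega>))"

definition envelope_norm :: real where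
  "envelope_norm = sqrt (expectation (\<lambda>\<omega>. (b (W 0 \<omega>))\<^sup>2))"

definition score_variation :: "real \<Rightarrow> real" where
  "score_variation s = expectation (\<lambda>\<omega>. (q s (W 0 \<omega>) - q 0 (W 0 \<omega>))\<^sup>2)"

lemma W_measurable [measurable]: "W i \<in> measurable M N"
  using W_indep by (auto simp: indep_vars_def2)

lemma q_measurable_compose [measurable]:
  assumes "f \<in> borel_measurable L" "g \<in> measurable L N"
  shows "(\<lambda>x. q (f x) (g x)) \<in> borel_measurable L"
  using measurable_compose[OF measurable_Pair[OF assms] q_measurable] by simp

lemma mean_score_measurable [measurable]: "mean_score \<in> borel_measurable borel"
  unfolding mean_score_def[abs_def] by measurable

lemma score_process_measurable_pair:
  "(\<lambda>(u, \<omega>). score_process n u \<omega>) \<in> borel_measurable (lborel \<Otimes>\<^sub>M M)"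
  unfolding score_process_def by measurable

lemma score_process_measurable [measurable]: "score_process n u \<in> borel_measurable M"
  unfolding score_process_def[abs_def] by measurable

lemma score_process_measurable_path: "\<omega> \<in> space M \<Longrightarrow> (\<lambda>u. score_process n u \<omega>) \<in> borel_measurable borel"
  using measurable_Pair2'[of \<omega> M lborel] score_process_measurable_pair
  by (auto dest: measurable_compose)

lemma b_nonneg: "0 \<le> b w"
  using q_bound[of 0 w] by linarith

lemma q_square_integrable: "integrable M (\<lambda>\<omega>. (q s (W 0 \<omega>))\<^sup>2)"
  by (rule Bochner_Integration.integrable_bound[OF b_square])
     (use q_bound b_nonneg in \<open>auto simp: abs_le_square_iff[symmetric]\<close>)

lemma q_integrable: "integrable M (\<lambda>\<omega>. q s (W 0 \<omega>))"
  by (rule expectation_abs_le_sqrt(1)) (use q_square_integrable in auto)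

lemma b_integrable: "integrable M (\<lambda>\<omega>. b (W 0 \<omega>))"
  by (rule expectation_abs_le_sqrt(1)) (use b_square in auto)

lemma mean_score_bound: "\<bar>mean_score s\<bar> \<le> expectation (\<lambda>\<omega>. b (W 0 \<omega>))"
  unfolding mean_score_def
  by (rule order_trans[OF integral_abs_bound integral_mono]) (use q_integrable b_integrable q_bound in auto)

lemma score_process_L1: "(\<integral>\<^sup>+\<omega>. ennreal \<bar>score_process n u \<omega>\<bar> \<partial>M) \<le> ennreal envelope_norm"
proof -
  let ?h = "q (u / sqrt (real n))"
  note S = normalised_centred_sum_L1_bound[OF W_indep W_distr, of ?h n, folded mean_score_def, folded score_process_def]
  have "(\<integral>\<^sup>+\<omega>. ennreal \<bar>score_process n u \<omega>\<bar> \<partial>M) = ennreal (expectation (\<lambda>\<omega>. \<bar>score_process n u \<omega>\<bar>))"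
    using S(1) q_square_integrable by (intro nn_integral_eq_integral) auto
  also have "\<dots> \<le> ennreal envelope_norm"
  proof (rule ennreal_leI)
    have "expectation (\<lambda>\<omega>. \<bar>score_process n u \<omega>\<bar>) \<le> sqrt (expectation (\<lambda>\<omega>. (?h (W 0 \<omega>))\<^sup>2))"
      using S(2) q_square_integrable by simp
    also have "\<dots> \<le> envelope_norm" unfolding envelope_norm_def
      using q_square_integrable b_square q_bound b_nonneg
      by (intro real_sqrt_le_mono integral_mono) (auto simp: abs_le_square_iff[symmetric])
    finally show "expectation (\<lambda>\<omega>. \<bar>score_process n u \<omega>\<bar>) \<le> envelope_norm" .
  qed
  finally show ?thesis .
qed

lemma score_process_increment_L1:
  "(\<integral>\<^sup>+\<omega>. ennreal \<bar>score_process n u \<omega> - score_process n 0 \<omega>\<bar> \<partial>M)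
     \<le> ennreal (sqrt (score_variation (u / sqrt (real n))))"
proof -
  let ?s = "u / sqrt (real n)"
  let ?h = "\<lambda>w. q ?s w - q 0 w"
  have sq: "integrable M (\<lambda>\<omega>. (?h (W 0 \<omega>))\<^sup>2)"
  proof (rule Bochner_Integration.integrable_bound)
    show "integrable M (\<lambda>\<omega>. 4 * (b (W 0 \<omega>))\<^sup>2)" using b_square by simp
    show "AE \<omega> in M. norm ((?h (W 0 \<omega>))\<^sup>2) \<le> norm (4 * (b (W 0 \<omega>))\<^sup>2)"
    proof (rule AE_I2)
      fix \<omega>
      have "\<bar>?h (W 0 \<omega>)\<bar> \<le> \<bar>2 * b (W 0 \<omega>)\<bar>"
        using q_bound[of ?s "W 0 \<omega>"] q_bound[of 0 "W 0 \<omega>"] by linarith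
      then show "norm ((?h (W 0 \<omega>))\<^sup>2) \<le> norm (4 * (b (W 0 \<omega>))\<^sup>2)"
        by (simp add: abs_le_square_iff power_mult_distrib)
    qed
  qed simp
  have eq: "score_process n u \<omega> - score_process n 0 \<omega>
    = (\<Sum>i<n. ?h (W i \<omega>) - expectation (\<lambda>\<omega>. ?h (W 0 \<omega>))) / sqrt (real n)" for \<omega>
    using q_integrable
    by (simp add: score_process_def mean_score_def diff_divide_distrib[symmetric] sum_subtractf[symmetric] algebra_simps)
  note S = normalised_centred_sum_L1_bound[OF W_indep W_distr, of ?h n, folded eq]
  have "(\<integral>\<^sup>+\<omega>. ennreal \<bar>score_process n u \<omega> - score_process n 0 \<omega>\<bar> \<partial>M)
      = ennreal (expectation (\<lambda>\<omega>. \<bar>score_process n u \<omega> - score_process n 0 \<omega>\<bar>))"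
    using S(1) sq by (intro nn_integral_eq_integral) auto
  also have "\<dots> \<le> ennreal (sqrt (score_variation ?s))"
    unfolding score_variation_def using S(2) sq by (intro ennreal_leI) simp
  finally show ?thesis .
qed

lemma score_process_path_bounded: "\<exists>C. \<forall>u. \<bar>score_process n u \<omega>\<bar> \<le> C"
proof (intro exI allI)
  fix u
  have "\<bar>\<Sum>i<n. q (u / sqrt (real n)) (W i \<omega>) - mean_score (u / sqrt (real n))\<bar>
     \<le> (\<Sum>i<n. b (W i \<omega>) + expectation (\<lambda>\<omega>. b (W 0 \<omega>)))"
  proof (rule order_trans[OF sum_abs sum_mono])
    fix i
    show "\<bar>q (u / sqrt (real n)) (W i \<omega>) - mean_score (u / sqrt (real n))\<bar>
      \<le> b (W i \<omega>) + expectation (\<lambda>\<omega>. b (W 0 \<omega>))"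
      using q_bound[of "u / sqrt (real n)" "W i \<omega>"] mean_score_bound[of "u / sqrt (real n)"] by linarith
  qed
  then show "\<bar>score_process n u \<omega>\<bar> \<le> (\<Sum>i<n. b (W i \<omega>) + expectation (\<lambda>\<omega>. b (W 0 \<omega>))) / sqrt (real n)"
    unfolding score_process_def by (simp add: abs_divide divide_right_mono)
qed

lemma integrable_signed_interval_score:
  "\<omega> \<in> space M \<Longrightarrow> integrable lborel (\<lambda>u. signed_interval h u * score_process n u \<omega>)"
  using score_process_path_bounded[of n \<omega>] score_process_measurable_path
  by (auto intro: integrable_signed_interval_bounded)

lemma q_measurable_path: "w \<in> space N \<Longrightarrow> (\<lambda>s. q s w) \<in> borel_measurable borel"
  by measurable

lemma loss_increment_0 [simp]: "loss_increment 0 w = 0"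
  by (simp add: loss_increment_def signed_interval_def)

text \<open>
  Fubini's theorem; the envelope times the length of the interval provides integrability.
\<close>

lemma excess_risk_eq_integral: "excess_risk t = (\<integral>s. signed_interval t s * mean_score s \<partial>lborel)"
proof -
  interpret pair: pair_sigma_finite M lborel ..
  let ?f = "\<lambda>(\<omega>, s). signed_interval t s * q s (W 0 \<omega>)"
  have fm: "?f \<in> borel_measurable (M \<Otimes>\<^sub>M lborel)" by measurable
  have path: "integrable lborel (\<lambda>s. signed_interval t s * q s w)" if "w \<in> space N" for w
    using q_measurable_path[OF that] q_bound by (intro integrable_signed_interval_bounded)
  have W_space: "W 0 \<omega> \<in> space N" if "\<omega> \<in> space M" for \<omega>
    using measurable_space[OF W_measurable that] .
  have "integrable (M \<Otimes>\<^sub>M lborel) ?f"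
  proof (rule pair.Fubini_integrable[OF fm])
    show "AE \<omega> in M. integrable lborel (\<lambda>s. ?f (\<omega>, s))"
      using path W_space by (intro AE_I2) simp
    show "integrable M (\<lambda>\<omega>. \<integral>s. norm (?f (\<omega>, s)) \<partial>lborel)"
    proof (rule Bochner_Integration.integrable_bound)
      show "integrable M (\<lambda>\<omega>. 2 * \<bar>t\<bar> * b (W 0 \<omega>))" using b_integrable by simp
      show "(\<lambda>\<omega>. \<integral>s. norm (?f (\<omega>, s)) \<partial>lborel) \<in> borel_measurable M"
        unfolding prod.case by measurable
      show "AE \<omega> in M. norm (\<integral>s. norm (?f (\<omega>, s)) \<partial>lborel) \<le> norm (2 * \<bar>t\<bar> * b (W 0 \<omega>))"
      proof (rule AE_I2)
        fix \<omega> assume \<omega>: "\<omega> \<in> space M"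
        have "(\<integral>s. norm (?f (\<omega>, s)) \<partial>lborel) \<le> (\<integral>s. indicator {- \<bar>t\<bar>..\<bar>t\<bar>} s * b (W 0 \<omega>) \<partial>lborel)"
        proof (rule integral_mono)
          show "integrable lborel (\<lambda>s. norm (?f (\<omega>, s)))"
            using path[OF W_space[OF \<omega>]] by (simp only: prod.case) (rule integrable_norm)
          show "integrable lborel (\<lambda>s. indicator {- \<bar>t\<bar>..\<bar>t\<bar>} s * b (W 0 \<omega>))" by simp
          show "norm (?f (\<omega>, s)) \<le> indicator {- \<bar>t\<bar>..\<bar>t\<bar>} s * b (W 0 \<omega>)" for s
            using abs_signed_interval_le[of t s] q_bound[of s "W 0 \<omega>"] b_nonneg[of "W 0 \<omega>"]
            by (simp add: abs_mult mult_mono)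
        qed
        also have "\<dots> = 2 * \<bar>t\<bar> * b (W 0 \<omega>)" by simp
        finally show "norm (\<integral>s. norm (?f (\<omega>, s)) \<partial>lborel) \<le> norm (2 * \<bar>t\<bar> * b (W 0 \<omega>))"
          by simp
      qed
    qed
  qed
  from pair.Fubini_integral[OF this]
  have "excess_risk t = (\<integral>s. \<integral>\<omega>. signed_interval t s * q s (W 0 \<omega>) \<partial>M \<partial>lborel)"
    unfolding excess_risk_def loss_increment_def by simp
  then show ?thesis by (simp add: mean_score_def)
qed

lemma integral_signed_interval_rescale:
  assumes "0 < r"
  shows "(\<integral>s. signed_interval (h / r) s * k s \<partial>lborel) = (\<integral>u. signed_interval h u * k (u / r) \<partial>lborel) / r"
proof -
  have ind: "signed_interval (h / r) (0 + (1 / r) * u) = signed_interval h u" for u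
    using assms by (simp add: signed_interval_def indicator_def divide_le_cancel zero_le_divide_iff divide_le_0_iff)
  have "(\<integral>s. signed_interval (h / r) s * k s \<partial>lborel)
    = \<bar>1 / r\<bar> *\<^sub>R (\<integral>u. signed_interval (h / r) (0 + (1 / r) * u) * k (0 + (1 / r) * u) \<partial>lborel)"
    by (rule lborel_integral_real_affine) (use assms in simp)
  then show ?thesis unfolding ind using assms by simp
qed

text \<open>
  The decomposition on which everything rests.  On the scale \<open>h\<close> the centred empirical criterion is the
  oriented integral of the score process from \<open>0\<close> to \<open>h\<close>.
\<close>

lemma empirical_increment_eq:
  assumes n: "1 \<le> n" and \<omega>: "\<omega> \<in> space M"
  shows "(\<Sum>i<n. loss_increment (h / sqrt (real n)) (W i \<omega>))
     = real n * excess_risk (h / sqrt (real n)) + (\<integral>u. signed_interval h u * score_process n u \<omega> \<partial>lborel)"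
proof -
  let ?r = "sqrt (real n)"
  have r: "0 < ?r" using n by simp
  have W_space: "W i \<omega> \<in> space N" for i using measurable_space[OF W_measurable \<omega>] .
  have intq: "integrable lborel (\<lambda>u. signed_interval h u * q (u / ?r) (W i \<omega>))" for i
    using W_space q_bound by (intro integrable_signed_interval_bounded) auto
  have intm: "integrable lborel (\<lambda>u. signed_interval h u * mean_score (u / ?r))"
    using mean_score_bound by (intro integrable_signed_interval_bounded) auto
  have "(\<integral>u. signed_interval h u * score_process n u \<omega> \<partial>lborel)
    = (\<integral>u. (\<Sum>i<n. signed_interval h u * q (u / ?r) (W i \<omega>) - signed_interval h u * mean_score (u / ?r)) / ?r \<partial>lborel)"
    by (intro Bochner_Integration.integral_cong refl)
       (simp add: score_process_def sum_distrib_left right_diff_distrib)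
  also have "\<dots> = (\<Sum>i<n. (\<integral>u. signed_interval h u * q (u / ?r) (W i \<omega>) \<partial>lborel)
       - (\<integral>u. signed_interval h u * mean_score (u / ?r) \<partial>lborel)) / ?r"
    using intq intm by (simp add: Bochner_Integration.integral_sum)
  also have "\<dots> = (\<Sum>i<n. loss_increment (h / ?r) (W i \<omega>) - excess_risk (h / ?r))"
    unfolding loss_increment_def excess_risk_eq_integral integral_signed_interval_rescale[OF r]
    by (simp add: sum_divide_distrib diff_divide_distrib)
  finally show ?thesis by (simp add: sum_subtractf)
qed

text \<open>
  If the criterion at \<open>h\<close> is no larger than at \<open>0\<close>, the oriented integral must compensate the quadratic growth
  \<open>c * h\<^sup>2\<close> of the risk.  Dividing by \<open>h\<^sup>2\<close> leads to a weighted integral that does not depend on \<open>h\<close>, so that all far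
  candidates are handled by a single event.
\<close>

lemma score_large_of_far_minimiser:
  assumes n: "1 \<le> n" and \<omega>: "\<omega> \<in> space M" and K: "0 < K" "K \<le> \<bar>h\<bar>" and c: "0 < c"
    and quad: "c * (h / sqrt (real n))\<^sup>2 \<le> excess_risk (h / sqrt (real n))"
    and nonpos: "(\<Sum>i<n. loss_increment (h / sqrt (real n)) (W i \<omega>)) \<le> 0"
  shows "ennreal c \<le> (\<integral>\<^sup>+u. ennreal (2 / (K\<^sup>2 + u\<^sup>2) * \<bar>score_process n u \<omega>\<bar>) \<partial>lborel)"
proof -
  let ?I = "\<integral>u. signed_interval h u * score_process n u \<omega> \<partial>lborel"
  have m [measurable]: "(\<lambda>u. score_process n u \<omega>) \<in> borel_measurable borel"
    using \<omega> by (rule score_process_measurable_path)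
  have h: "h\<^sup>2 > 0" using K by auto
  have Kh: "K\<^sup>2 \<le> h\<^sup>2" using K by (simp add: abs_le_square_iff[symmetric])
  have "c * h\<^sup>2 = real n * (c * (h / sqrt (real n))\<^sup>2)" using n by (simp add: power_divide)
  also have "\<dots> \<le> real n * excess_risk (h / sqrt (real n))" by (intro mult_left_mono quad) simp
  also have "\<dots> \<le> \<bar>?I\<bar>" using empirical_increment_eq[OF n \<omega>, of h] nonpos by linarith
  finally have "ennreal (h\<^sup>2 * c) \<le> ennreal \<bar>?I\<bar>" by (intro ennreal_leI) (simp add: mult.commute)
  also have "\<dots> \<le> (\<integral>\<^sup>+u. ennreal \<bar>signed_interval h u * score_process n u \<omega>\<bar> \<partial>lborel)"
    using integral_norm_bound_ennreal[OF integrable_signed_interval_score[OF \<omega>]] by simp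
  also have "\<dots> \<le> (\<integral>\<^sup>+u. ennreal (h\<^sup>2) * ennreal (2 / (K\<^sup>2 + u\<^sup>2) * \<bar>score_process n u \<omega>\<bar>) \<partial>lborel)"
  proof (rule nn_integral_mono)
    fix u
    have "\<bar>signed_interval h u\<bar> \<le> h\<^sup>2 * (2 / (K\<^sup>2 + u\<^sup>2))"
    proof (cases "\<bar>u\<bar> \<le> \<bar>h\<bar>")
      case True
      then have "u\<^sup>2 \<le> h\<^sup>2" by (simp add: abs_le_square_iff)
      with Kh have "K\<^sup>2 + u\<^sup>2 \<le> 2 * h\<^sup>2" by simp
      moreover have "0 < K\<^sup>2 + u\<^sup>2" using K by (simp add: add_pos_nonneg)
      ultimately have "1 \<le> h\<^sup>2 * (2 / (K\<^sup>2 + u\<^sup>2))" by (simp add: field_simps)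
      moreover have "\<bar>signed_interval h u\<bar> \<le> 1"
        using abs_signed_interval_le[of h u] by (rule order_trans) (simp add: indicator_def)
      ultimately show ?thesis by linarith
    next
      case False
      then have "\<bar>signed_interval h u\<bar> \<le> 0"
        by (auto simp: signed_interval_def indicator_def)
      also have "0 \<le> h\<^sup>2 * (2 / (K\<^sup>2 + u\<^sup>2))" by simp
      finally show ?thesis .
    qed
    then have "\<bar>signed_interval h u * score_process n u \<omega>\<bar> \<le> h\<^sup>2 * (2 / (K\<^sup>2 + u\<^sup>2)) * \<bar>score_process n u \<omega>\<bar>"
      unfolding abs_mult by (rule mult_right_mono) simp
    then have "ennreal \<bar>signed_interval h u * score_process n u \<omega>\<bar>
        \<le> ennreal (h\<^sup>2 * (2 / (K\<^sup>2 + u\<^sup>2) * \<bar>score_process n u \<omega>\<bar>))"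
      by (intro ennreal_leI) (simp add: mult.assoc)
    then show "ennreal \<bar>signed_interval h u * score_process n u \<omega>\<bar>
        \<le> ennreal (h\<^sup>2) * ennreal (2 / (K\<^sup>2 + u\<^sup>2) * \<bar>score_process n u \<omega>\<bar>)"
      by (subst (asm) ennreal_mult) auto
  qed
  also have "\<dots> = ennreal (h\<^sup>2) * (\<integral>\<^sup>+u. ennreal (2 / (K\<^sup>2 + u\<^sup>2) * \<bar>score_process n u \<omega>\<bar>) \<partial>lborel)"
    by (rule nn_integral_cmult) measurable
  finally have "ennreal (h\<^sup>2) * ennreal c
      \<le> ennreal (h\<^sup>2) * (\<integral>\<^sup>+u. ennreal (2 / (K\<^sup>2 + u\<^sup>2) * \<bar>score_process n u \<omega>\<bar>) \<partial>lborel)"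
    using c by (simp add: ennreal_mult)
  then show ?thesis using h by (subst (asm) ennreal_mult_le_mult_iff) auto
qed

lemma score_large_probability:
  assumes "0 < K" "0 < c"
  shows "{\<omega> \<in> space M. ennreal c \<le> (\<integral>\<^sup>+u. ennreal (2 / (K\<^sup>2 + u\<^sup>2) * \<bar>score_process n u \<omega>\<bar>) \<partial>lborel)} \<in> events"
    and "prob {\<omega> \<in> space M. ennreal c \<le> (\<integral>\<^sup>+u. ennreal (2 / (K\<^sup>2 + u\<^sup>2) * \<bar>score_process n u \<omega>\<bar>) \<partial>lborel)}
      \<le> (2 * pi * envelope_norm / c) / K"
proof -
  have e: "0 \<le> envelope_norm" by (simp add: envelope_norm_def)
  have int: "integrable lborel (\<lambda>u. 2 / (K\<^sup>2 + u\<^sup>2) * envelope_norm)"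
    by (rule integrable_mult_left) (use integral_cauchy_weight(1)[OF assms(1)] in simp)
  have val: "(\<integral>u. 2 / (K\<^sup>2 + u\<^sup>2) * envelope_norm \<partial>lborel) = 2 * pi / K * envelope_norm"
    unfolding integral_mult_left_zero integral_cauchy_weight(2)[OF assms(1)] ..
  note P = weighted_path_Markov[OF score_process_measurable_pair, of "\<lambda>u. 2 / (K\<^sup>2 + u\<^sup>2)",
      OF _ _ score_process_L1 e int assms(2)]
  show "{\<omega> \<in> space M. ennreal c \<le> (\<integral>\<^sup>+u. ennreal (2 / (K\<^sup>2 + u\<^sup>2) * \<bar>score_process n u \<omega>\<bar>) \<partial>lborel)} \<in> events"
    by (rule P(1)) auto
  have "prob {\<omega> \<in> space M. ennreal c \<le> (\<integral>\<^sup>+u. ennreal (2 / (K\<^sup>2 + u\<^sup>2) * \<bar>score_process n u \<omega>\<bar>) \<partial>lborel)}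
      \<le> (\<integral>u. 2 / (K\<^sup>2 + u\<^sup>2) * envelope_norm \<partial>lborel) / c"
    by (rule P(2)) auto
  then show "prob {\<omega> \<in> space M. ennreal c \<le> (\<integral>\<^sup>+u. ennreal (2 / (K\<^sup>2 + u\<^sup>2) * \<bar>score_process n u \<omega>\<bar>) \<partial>lborel)}
      \<le> (2 * pi * envelope_norm / c) / K"
    unfolding val by (simp add: mult.commute mult.left_commute)
qed

lemma score_at_0_large_probability:
  assumes a: "0 < a"
  shows "prob {\<omega> \<in> space M. a \<le> \<bar>score_process n 0 \<omega>\<bar>} \<le> envelope_norm / a"
proof -
  have e: "0 \<le> envelope_norm" by (simp add: envelope_norm_def)
  have "emeasure M {\<omega> \<in> space M. 1 \<le> ennreal (1 / a) * ennreal \<bar>score_process n 0 \<omega>\<bar>}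
    \<le> ennreal (1 / a) * (\<integral>\<^sup>+\<omega>. ennreal \<bar>score_process n 0 \<omega>\<bar> * indicator (space M) \<omega> \<partial>M)"
    by (rule nn_integral_Markov_inequality) auto
  also have "(\<integral>\<^sup>+\<omega>. ennreal \<bar>score_process n 0 \<omega>\<bar> * indicator (space M) \<omega> \<partial>M)
      = (\<integral>\<^sup>+\<omega>. ennreal \<bar>score_process n 0 \<omega>\<bar> \<partial>M)"
    by (intro nn_integral_cong) simp
  also have "ennreal (1 / a) * \<dots> \<le> ennreal (1 / a) * ennreal envelope_norm"
    by (intro mult_left_mono score_process_L1) simp
  also have "\<dots> = ennreal (envelope_norm / a)" using a e by (simp add: ennreal_mult[symmetric])
  also have "{\<omega> \<in> space M. 1 \<le> ennreal (1 / a) * ennreal \<bar>score_process n 0 \<omega>\<bar>}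
      = {\<omega> \<in> space M. a \<le> \<bar>score_process n 0 \<omega>\<bar>}"
    using a by (auto simp: ennreal_mult[symmetric] ennreal_1[symmetric] field_simps simp del: ennreal_1)
  finally show ?thesis using a e by (simp add: emeasure_eq_measure)
qed

text \<open>
  The score process is nearly constant on bounded intervals of the local scale, provided the score is
  mean square continuous at \<open>0\<close> on average over shrinking intervals.
\<close>

lemma score_oscillation_probability:
  assumes K: "0 < K" and \<delta>: "0 < \<delta>"
    and var: "((\<lambda>r. \<integral>u. indicator {-K..K} u * score_variation (r * u) \<partial>lborel) \<longlongrightarrow> 0) (at_right 0)"
  defines "E \<equiv> \<lambda>n. {\<omega> \<in> space M. ennreal \<delta> \<le>
      (\<integral>\<^sup>+u. ennreal (indicator {-K..K} u * \<bar>score_process n u \<omega> - score_process n 0 \<omega>\<bar>) \<partial>lborel)}"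
  shows "E n \<in> events" and "(\<lambda>n. prob (E n)) \<longlonglongrightarrow> 0"
proof -
  have sv0: "0 \<le> score_variation s" for s by (simp add: score_variation_def)
  have [measurable]: "score_variation \<in> borel_measurable borel"
    unfolding score_variation_def[abs_def] by measurable
  have bd: "score_variation s \<le> 4 * envelope_norm\<^sup>2" for s
  proof -
    have "score_variation s \<le> expectation (\<lambda>\<omega>. 4 * (b (W 0 \<omega>))\<^sup>2)"
      unfolding score_variation_def
    proof (rule integral_mono')
      show "integrable M (\<lambda>\<omega>. 4 * (b (W 0 \<omega>))\<^sup>2)" using b_square by simp
      fix \<omega>
      have "\<bar>q s (W 0 \<omega>) - q 0 (W 0 \<omega>)\<bar> \<le> \<bar>2 * b (W 0 \<omega>)\<bar>"
        using q_bound[of s "W 0 \<omega>"] q_bound[of 0 "W 0 \<omega>"] by linarith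
      then show "(q s (W 0 \<omega>) - q 0 (W 0 \<omega>))\<^sup>2 \<le> 4 * (b (W 0 \<omega>))\<^sup>2"
        by (simp add: abs_le_square_iff power_mult_distrib)
    qed auto
    then show ?thesis by (simp add: envelope_norm_def)
  qed
  have meas: "(\<lambda>(u, \<omega>). score_process n u \<omega> - score_process n 0 \<omega>) \<in> borel_measurable (lborel \<Otimes>\<^sub>M M)" for n
  proof -
    have "(\<lambda>x. score_process n (fst x) (snd x)) \<in> borel_measurable (lborel \<Otimes>\<^sub>M M)"
      using score_process_measurable_pair[of n] by (simp add: split_beta)
    then show ?thesis by (simp add: split_beta)
  qed
  \<comment> \<open>Linear in \<open>x\<close>, unlike the square root; so an integrated second moment that tends to \<open>0\<close> suffices.\<close>
  have sqrt_le: "sqrt x \<le> a + x / a" if "0 < a" "0 \<le> x" for x a :: real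
  proof -
    have "0 \<le> (sqrt x - a)\<^sup>2" by simp
    then have "2 * a * sqrt x \<le> x + a\<^sup>2" using that by (simp add: power2_diff mult.commute mult.left_commute)
    moreover have "0 \<le> a * sqrt x" using that by simp
    moreover have "a * (a + x / a) = a\<^sup>2 + x" using that by (simp add: distrib_left power2_eq_square)
    ultimately have "a * sqrt x \<le> a * (a + x / a)" by linarith
    then show ?thesis using that by simp
  qed
  have intv: "integrable lborel (\<lambda>u. indicator {-K..K} u * score_variation (u / sqrt (real n)))" for n
    using bd sv0 by (intro integrable_window_bounded[where C = "4 * envelope_norm\<^sup>2"]) auto
  have int: "integrable lborel (\<lambda>u. indicator {-K..K} u * (a + score_variation (u / sqrt (real n)) / a))" for n a
    using bd sv0 by (intro integrable_window_bounded[where C = "\<bar>a\<bar> + 4 * envelope_norm\<^sup>2 / \<bar>a\<bar>"])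
      (auto intro!: order_trans[OF abs_triangle_ineq] add_mono divide_right_mono simp: abs_divide)
  have val: "(\<integral>u. indicator {-K..K} u * (a + score_variation (u / sqrt (real n)) / a) \<partial>lborel)
     = 2 * K * a + (\<integral>u. indicator {-K..K} u * score_variation (u / sqrt (real n)) \<partial>lborel) / a" for n a
  proof -
    have "(\<integral>u. indicator {-K..K} u * (a + score_variation (u / sqrt (real n)) / a) \<partial>lborel)
      = (\<integral>u. a * indicator {-K..K} u + indicator {-K..K} u * score_variation (u / sqrt (real n)) / a \<partial>lborel)"
      by (intro Bochner_Integration.integral_cong) (auto simp: algebra_simps)
    also have "\<dots> = 2 * K * a + (\<integral>u. indicator {-K..K} u * score_variation (u / sqrt (real n)) \<partial>lborel) / a"
      using intv[of n] K by (subst Bochner_Integration.integral_add) auto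
    finally show ?thesis .
  qed
  have P: "E n \<in> events" "prob (E n) \<le>
     (2 * K * a + (\<integral>u. indicator {-K..K} u * score_variation (u / sqrt (real n)) \<partial>lborel) / a) / \<delta>"
    if a: "0 < a" for a n
  proof -
    have bound: "(\<integral>\<^sup>+\<omega>. ennreal \<bar>score_process n u \<omega> - score_process n 0 \<omega>\<bar> \<partial>M)
        \<le> ennreal (a + score_variation (u / sqrt (real n)) / a)" for u
      by (rule order_trans[OF score_process_increment_L1 ennreal_leI[OF sqrt_le[OF a sv0]]])
    have nn: "0 \<le> a + score_variation (u / sqrt (real n)) / a" for u using a sv0 by simp
    note Q = weighted_path_Markov[OF meas, of "indicator {-K..K}", OF _ _ bound nn int \<delta>]
    show "E n \<in> events" unfolding E_def by (rule Q(1)) auto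
    show "prob (E n) \<le>
     (2 * K * a + (\<integral>u. indicator {-K..K} u * score_variation (u / sqrt (real n)) \<partial>lborel) / a) / \<delta>"
      unfolding E_def val[symmetric] by (rule Q(2)) auto
  qed
  show "E n \<in> events" by (rule P(1)[of 1]) simp
  have lim: "(\<lambda>n. \<integral>u. indicator {-K..K} u * score_variation (u / sqrt (real n)) \<partial>lborel) \<longlonglongrightarrow> 0"
  proof -
    have "filterlim (\<lambda>n. 1 / sqrt (real n)) (at_right 0) sequentially"
      unfolding filterlim_at
      by (auto intro!: tendsto_divide_0[OF tendsto_const] filterlim_at_top_imp_at_infinity
            filterlim_compose[OF sqrt_at_top] filterlim_real_sequentially
            eventually_sequentiallyI[of 1])
    from filterlim_compose[OF var this] show ?thesis by simp
  qed
  show "(\<lambda>n. prob (E n)) \<longlonglongrightarrow> 0"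
  proof (rule LIMSEQ_I)
    fix e :: real assume e: "0 < e"
    define a where "a = e * \<delta> / (8 * K)"
    have a: "0 < a" using e K \<delta> by (simp add: a_def)
    have "\<forall>\<^sub>F n in sequentially. (\<integral>u. indicator {-K..K} u * score_variation (u / sqrt (real n)) \<partial>lborel) < a * \<delta> * e / 4"
      by (rule order_tendstoD(2)[OF lim]) (use a \<delta> e in simp)
    then have "\<forall>\<^sub>F n in sequentially. norm (prob (E n) - 0) < e"
    proof eventually_elim
      case (elim n)
      let ?D = "\<integral>u. indicator {-K..K} u * score_variation (u / sqrt (real n)) \<partial>lborel"
      have "?D / a < \<delta> * e / 4" using elim a by (simp add: field_simps)
      moreover have "2 * K * a = \<delta> * e / 4" using K by (simp add: a_def)
      ultimately have "2 * K * a + ?D / a < e * \<delta>"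
        using mult_pos_pos[OF \<delta> e] by (simp only: mult.commute[of e \<delta>])
      then have "(2 * K * a + ?D / a) / \<delta> < e" by (simp only: pos_divide_less_eq[OF \<delta>])
      then show ?case using P(2)[OF a, of n] by simp
    qed
    then show "\<exists>no. \<forall>n\<ge>no. norm (prob (E n) - 0) < e" by (simp add: eventually_sequentially)
  qed
qed

text \<open>
  Locally the criterion is close to the parabola \<open>h * S\<^sub>n 0 + V * h\<^sup>2 / 2\<close>: replacing the score process by its value at \<open>0\<close> costs
  at most its oscillation, and replacing the risk by its second order expansion costs at most \<open>\<delta>\<close>.
\<close>

lemma empirical_increment_local_bound:
  assumes n: "1 \<le> n" and \<omega>: "\<omega> \<in> space M" and h: "\<bar>h\<bar> \<le> K" and \<delta>: "0 < \<delta>"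
    and osc: "(\<integral>\<^sup>+u. ennreal (indicator {-K..K} u * \<bar>score_process n u \<omega> - score_process n 0 \<omega>\<bar>) \<partial>lborel) < ennreal \<delta>"
    and risk: "\<bar>real n * excess_risk (h / sqrt (real n)) - V * h\<^sup>2 / 2\<bar> \<le> \<delta>"
  shows "\<bar>(\<Sum>i<n. loss_increment (h / sqrt (real n)) (W i \<omega>)) - (h * score_process n 0 \<omega> + V * h\<^sup>2 / 2)\<bar> \<le> 2 * \<delta>"
proof -
  let ?I = "\<integral>u. signed_interval h u * score_process n u \<omega> \<partial>lborel"
  let ?s = "score_process n 0 \<omega>"
  have m [measurable]: "(\<lambda>u. score_process n u \<omega>) \<in> borel_measurable borel"
    using \<omega> by (rule score_process_measurable_path)
  have int1: "integrable lborel (\<lambda>u. signed_interval h u * ?s)"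
    by (intro integrable_signed_interval_bounded[of _ "\<bar>?s\<bar>"]) auto
  have "?I - h * ?s = ?I - (\<integral>u. signed_interval h u * ?s \<partial>lborel)"
    by (simp add: integral_signed_interval)
  also have "\<dots> = (\<integral>u. signed_interval h u * score_process n u \<omega> - signed_interval h u * ?s \<partial>lborel)"
    by (rule Bochner_Integration.integral_diff[OF integrable_signed_interval_score[OF \<omega>] int1, symmetric])
  finally have eq: "?I - h * ?s = \<dots>" .
  have "ennreal \<bar>?I - h * ?s\<bar>
    \<le> (\<integral>\<^sup>+u. ennreal \<bar>signed_interval h u * score_process n u \<omega> - signed_interval h u * ?s\<bar> \<partial>lborel)"
    unfolding eq
    using integral_norm_bound_ennreal[OF Bochner_Integration.integrable_diff[OF integrable_signed_interval_score[OF \<omega>] int1]]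
    by simp
  also have "\<dots> \<le> (\<integral>\<^sup>+u. ennreal (indicator {-K..K} u * \<bar>score_process n u \<omega> - ?s\<bar>) \<partial>lborel)"
  proof (intro nn_integral_mono ennreal_leI)
    fix u
    have "\<bar>signed_interval h u\<bar> \<le> indicator {-K..K} u"
      using h by (intro order_trans[OF abs_signed_interval_le]) (auto simp: indicator_def)
    then show "\<bar>signed_interval h u * score_process n u \<omega> - signed_interval h u * ?s\<bar>
        \<le> indicator {-K..K} u * \<bar>score_process n u \<omega> - ?s\<bar>"
      unfolding right_diff_distrib[symmetric] abs_mult by (rule mult_right_mono) simp
  qed
  also note osc
  finally have "\<bar>?I - h * ?s\<bar> < \<delta>" using \<delta> by (simp add: ennreal_less_iff)
  then show ?thesis using empirical_increment_eq[OF n \<omega>, of h] risk by linarith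
qed

lemma risk_quadratic_approximation:
  assumes curv: "((\<lambda>t. excess_risk t / t\<^sup>2) \<longlongrightarrow> V / 2) (at 0)" and K: "0 < K" and \<delta>: "0 < \<delta>"
  shows "\<forall>\<^sub>F n in sequentially. \<forall>h. \<bar>h\<bar> \<le> K \<longrightarrow>
    \<bar>real n * excess_risk (h / sqrt (real n)) - V * h\<^sup>2 / 2\<bar> \<le> \<delta>"
proof -
  from tendstoD[OF curv, of "\<delta> / K\<^sup>2"] K \<delta> obtain d where d: "0 < d"
    and near: "\<And>t. t \<noteq> 0 \<Longrightarrow> \<bar>t\<bar> < d \<Longrightarrow> \<bar>excess_risk t / t\<^sup>2 - V / 2\<bar> < \<delta> / K\<^sup>2"
    by (auto simp: eventually_at dist_real_def)
  have "\<forall>\<^sub>F n in sequentially. (K / d)\<^sup>2 < real n"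
    using filterlim_real_sequentially unfolding filterlim_at_top_dense by blast
  then show ?thesis
  proof eventually_elim
    case (elim n)
    then have n: "0 < real n" by (rule le_less_trans[rotated]) simp
    have "K / d < sqrt (real n)" using elim by (rule real_less_rsqrt)
    then have Kn: "K / sqrt (real n) < d" using n d by (simp add: field_simps)
    show ?case
    proof (intro allI impI)
      fix h assume h: "\<bar>h\<bar> \<le> K"
      show "\<bar>real n * excess_risk (h / sqrt (real n)) - V * h\<^sup>2 / 2\<bar> \<le> \<delta>"
      proof (cases "h = 0")
        case True
        then show ?thesis using \<delta> by (simp add: excess_risk_def)
      next
        case False
        let ?t = "h / sqrt (real n)"
        have "\<bar>?t\<bar> \<le> K / sqrt (real n)" using h n by (simp add: divide_right_mono)
        then have t: "\<bar>?t\<bar> < d" "?t \<noteq> 0" using Kn False n by auto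
        have "real n * excess_risk ?t - V * h\<^sup>2 / 2 = h\<^sup>2 * (excess_risk ?t / ?t\<^sup>2 - V / 2)"
          using False n by (simp add: power_divide right_diff_distrib)
        also have "\<bar>\<dots>\<bar> = h\<^sup>2 * \<bar>excess_risk ?t / ?t\<^sup>2 - V / 2\<bar>" by (simp add: abs_mult)
        also have "\<dots> \<le> K\<^sup>2 * (\<delta> / K\<^sup>2)"
          using near[OF t(2,1)] h K by (intro mult_mono) (auto simp: abs_le_square_iff[symmetric])
        also have "\<dots> = \<delta>" using K by simp
        finally show ?thesis .
      qed
    qed
  qed
qed

text \<open>
  The minimiser follows the vertex \<open>h' = - S\<^sub>n 0 / V\<close> of the parabola.  Outside of three rare events, both the
  minimiser and the vertex lie in \<open>{-K..K}\<close>, where the criterion is within \<open>2 * \<delta>\<close> of the parabola.  Then the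
  parabola at the minimiser exceeds its minimum by at most \<open>4 * \<delta>\<close>, which bounds the squared distance to the
  vertex by \<open>8 * \<delta> / V = \<eta>\<^sup>2\<close>.
\<close>

lemma minimiser_score_expansion:
  fixes \<theta> :: "nat \<Rightarrow> 'a \<Rightarrow> real"
  assumes V: "0 < V" and c: "0 < c" and T: "0 < T"
    and quad: "\<And>t. \<bar>t\<bar> \<le> T \<Longrightarrow> c * t\<^sup>2 \<le> excess_risk t"
    and curv: "((\<lambda>t. excess_risk t / t\<^sup>2) \<longlongrightarrow> V / 2) (at 0)"
    and var: "\<And>K. 0 < K \<Longrightarrow>
      ((\<lambda>r. \<integral>u. indicator {-K..K} u * score_variation (r * u) \<partial>lborel) \<longlongrightarrow> 0) (at_right 0)"
    and meas [measurable]: "\<And>n. \<theta> n \<in> borel_measurable M"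
    and min: "\<And>n. 1 \<le> n \<Longrightarrow> AE \<omega> in M. \<forall>t.
      (\<Sum>i<n. loss_increment (\<theta> n \<omega>) (W i \<omega>)) \<le> (\<Sum>i<n. loss_increment t (W i \<omega>))"
    and tail: "AE \<omega> in M. \<forall>n t. T \<le> \<bar>t\<bar> \<longrightarrow>
      (\<Sum>i<n. loss_increment t (W i \<omega>)) = (\<Sum>i<n. loss_increment T (W i \<omega>))"
    and \<eta>: "0 < \<eta>"
  shows "(\<lambda>n. prob {\<omega> \<in> space M. \<eta> < \<bar>sqrt (real n) * \<theta> n \<omega> + score_process n 0 \<omega> / V\<bar>}) \<longlonglongrightarrow> 0"
proof (rule LIMSEQ_I)
  fix e :: real assume e: "0 < e"
  have e0: "0 \<le> envelope_norm" by (simp add: envelope_norm_def)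
  define c1 where "c1 = 2 * pi * envelope_norm / c"
  define c2 where "c2 = envelope_norm / V"
  \<comment> \<open>\<open>c1 / K\<close> and \<open>c2 / K\<close> bound the probabilities that the minimiser and the vertex leave \<open>{-K..K}\<close>.\<close>
  define K where "K = 3 * (c1 + c2) / e + 1"
  have c1: "0 \<le> c1" using e0 c by (simp add: c1_def)
  have c2: "0 \<le> c2" using e0 V by (simp add: c2_def)
  have K0: "0 < K" using c1 c2 e by (auto simp: K_def intro!: add_nonneg_pos)
  have "e * K = 3 * (c1 + c2) + e"
    unfolding K_def distrib_left using e by simp
  then have "c1 + c2 < e / 3 * K" using e by simp
  then have "c1 < e / 3 * K" "c2 < e / 3 * K" using c1 c2 by auto
  then have K1: "c1 / K < e / 3" and K2: "c2 / K < e / 3"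
    by (simp_all only: pos_divide_less_eq[OF K0])
  define \<delta> where "\<delta> = V * \<eta>\<^sup>2 / 8"
  have \<delta>: "0 < \<delta>" using V \<eta> by (simp add: \<delta>_def)
  define far where "far n = {\<omega> \<in> space M. ennreal c \<le>
      (\<integral>\<^sup>+u. ennreal (2 / (K\<^sup>2 + u\<^sup>2) * \<bar>score_process n u \<omega>\<bar>) \<partial>lborel)}" for n
  define osc where "osc n = {\<omega> \<in> space M. ennreal \<delta> \<le>
      (\<integral>\<^sup>+u. ennreal (indicator {-K..K} u * \<bar>score_process n u \<omega> - score_process n 0 \<omega>\<bar>) \<partial>lborel)}" for n
  define big where "big n = {\<omega> \<in> space M. V * K \<le> \<bar>score_process n 0 \<omega>\<bar>}" for n
  have far: "far n \<in> events" "prob (far n) \<le> c1 / K" for n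
    using score_large_probability[OF K0 c, of n] by (auto simp: far_def c1_def)
  have osc: "osc n \<in> events" "(\<lambda>n. prob (osc n)) \<longlonglongrightarrow> 0" for n
    using score_oscillation_probability[OF K0 \<delta> var[OF K0]] unfolding osc_def by auto
  have big: "big n \<in> events" for n unfolding big_def by measurable
  have bigp: "prob (big n) \<le> c2 / K" for n
    using score_at_0_large_probability[of "V * K" n] V K0 unfolding big_def c2_def by simp
  have "\<forall>\<^sub>F n in sequentially. prob (osc n) < e / 3"
    by (rule order_tendstoD(2)[OF osc(2)]) (use e in simp)
  moreover have "\<forall>\<^sub>F n in sequentially. (K / T)\<^sup>2 < real n"
    using filterlim_real_sequentially unfolding filterlim_at_top_dense by blast
  moreover have "\<forall>\<^sub>F n in sequentially. 1 \<le> n" by (rule eventually_ge_at_top)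
  moreover note risk_quadratic_approximation[OF curv K0 \<delta>]
  ultimately have "\<forall>\<^sub>F n in sequentially.
    norm (prob {\<omega> \<in> space M. \<eta> < \<bar>sqrt (real n) * \<theta> n \<omega> + score_process n 0 \<omega> / V\<bar>} - 0) < e"
  proof eventually_elim
    case (elim n)
    note n = elim(3) and risk = elim(4)[rule_format]
    let ?r = "sqrt (real n)"
    have r: "0 < ?r" using n by simp
    have "K / T < ?r" using elim(2) by (rule real_less_rsqrt)
    then have KT: "K \<le> ?r * T" using T by (simp add: field_simps)
    let ?bad = "{\<omega> \<in> space M. \<eta> < \<bar>?r * \<theta> n \<omega> + score_process n 0 \<omega> / V\<bar>}"
    have "AE \<omega> in M. \<omega> \<in> ?bad \<longrightarrow> \<omega> \<in> far n \<union> osc n \<union> big n"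
      using min[OF n] tail AE_space
    proof eventually_elim
      case (elim \<omega>)
      note minD = elim(1)[rule_format] and tailD = elim(2)[rule_format] and \<omega> = elim(3)
      show ?case
      proof (rule impI, rule ccontr)
        assume bad: "\<omega> \<in> ?bad" and "\<omega> \<notin> far n \<union> osc n \<union> big n"
        then have nfar: "\<omega> \<notin> far n" and nosc: "\<omega> \<notin> osc n" and nbig: "\<omega> \<notin> big n" by auto
        let ?s = "score_process n 0 \<omega>"
        define h where "h = ?r * \<theta> n \<omega>"
        define h' where "h' = - ?s / V"
        define H where "H x = (\<Sum>i<n. loss_increment (x / ?r) (W i \<omega>))" for x
        have H_min: "H h \<le> H x" for x
          using minD[of "x / ?r"] r by (simp add: H_def h_def)
        \<comment> \<open>Beyond the range where the criterion varies, the boundary point \<open>T\<close> minimises it too.\<close>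
        have hK: "\<bar>h\<bar> < K"
        proof (rule ccontr)
          assume "\<not> \<bar>h\<bar> < K"
          then have hK: "K \<le> \<bar>h\<bar>" by simp
          define x where "x = (if \<bar>\<theta> n \<omega>\<bar> \<le> T then h else ?r * T)"
          have xK: "K \<le> \<bar>x\<bar>" using hK KT by (auto simp: x_def)
          have xT: "\<bar>x / ?r\<bar> \<le> T" 
          proof (cases "\<bar>\<theta> n \<omega>\<bar> \<le> T")
            case True
            then have "x / ?r = \<theta> n \<omega>" using r by (simp add: x_def h_def)
            then show ?thesis using True by (simp only:)
          next
            case False
            then have "x / ?r = T" using r by (simp add: x_def)
            then show ?thesis using T by (simp only: abs_of_pos order_refl)
          qed
          have "H x = H h"
            using tailD[of "\<theta> n \<omega>" n] r by (auto simp: x_def h_def H_def)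
          also have "\<dots> \<le> H 0" by (rule H_min)
          also have "H 0 = 0" by (simp add: H_def)
          finally have "ennreal c \<le> (\<integral>\<^sup>+u. ennreal (2 / (K\<^sup>2 + u\<^sup>2) * \<bar>score_process n u \<omega>\<bar>) \<partial>lborel)"
            unfolding H_def by (intro score_large_of_far_minimiser[OF n \<omega> K0 xK c quad[OF xT]])
          then show False using nfar \<omega> by (simp add: far_def)
        qed
        have h'K: "\<bar>h'\<bar> < K"
          using nbig \<omega> V by (simp add: big_def h'_def field_simps)
        have osc_lt: "(\<integral>\<^sup>+u. ennreal (indicator {-K..K} u * \<bar>score_process n u \<omega> - ?s\<bar>) \<partial>lborel) < ennreal \<delta>"
          using nosc \<omega> by (simp add: osc_def not_le)
        have loc: "\<bar>H x - (x * ?s + V * x\<^sup>2 / 2)\<bar> \<le> 2 * \<delta>" if "\<bar>x\<bar> \<le> K" for x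
          unfolding H_def by (rule empirical_increment_local_bound[OF n \<omega> that \<delta> osc_lt risk[OF that]])
        have "(h * ?s + V * h\<^sup>2 / 2) - (h' * ?s + V * h'\<^sup>2 / 2) \<le> 4 * \<delta>"
          using loc[of h] loc[of h'] hK h'K H_min[of h'] by linarith
        moreover have s: "?s = - V * h'" using V by (simp add: h'_def)
        have "(h * ?s + V * h\<^sup>2 / 2) - (h' * ?s + V * h'\<^sup>2 / 2) = V / 2 * (h - h')\<^sup>2"
          unfolding s by (simp add: power2_eq_square field_simps)
        ultimately have "V / 2 * (h - h')\<^sup>2 \<le> V / 2 * \<eta>\<^sup>2" by (simp add: \<delta>_def)
        then have "(h - h')\<^sup>2 \<le> \<eta>\<^sup>2" using V by (simp del: times_divide_eq_left)
        then have "\<bar>h - h'\<bar> \<le> \<eta>" using \<eta> by (simp add: abs_le_square_iff[symmetric])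
        then show False using bad by (simp add: h_def h'_def)
      qed
    qed
    then have "prob ?bad \<le> prob (far n \<union> osc n \<union> big n)"
      using far osc big by (intro finite_measure_mono_AE) auto
    also have "\<dots> \<le> prob (far n \<union> osc n) + prob (big n)"
      using far osc big by (intro measure_Un_le) auto
    also have "\<dots> \<le> prob (far n) + prob (osc n) + prob (big n)"
      using far osc by (intro add_right_mono measure_Un_le) auto
    also have "\<dots> < e / 3 + e / 3 + e / 3"
      using far(2)[of n] bigp[of n] K1 K2 elim(1) by linarith
    finally show ?case by simp
  qed
  then show "\<exists>no. \<forall>n\<ge>no.
    norm (prob {\<omega> \<in> space M. \<eta> < \<bar>sqrt (real n) * \<theta> n \<omega> + score_process n 0 \<omega> / V\<bar>} - 0) < e"
    by (simp add: eventually_sequentially)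
qed

text \<open>
  By the expansion above the rescaled minimiser inherits the normal limit of the score at \<open>0\<close>.  The constancy
  of the criterion beyond \<open>T\<close> compensates for the quadratic growth of the risk being required on
  \<open>{-T..T}\<close> only.
\<close>

theorem minimiser_asymptotically_normal:
  fixes \<theta> :: "nat \<Rightarrow> 'a \<Rightarrow> real"
  assumes V: "0 < V" and c: "0 < c" and T: "0 < T"
    and quad: "\<And>t. \<bar>t\<bar> \<le> T \<Longrightarrow> c * t\<^sup>2 \<le> excess_risk t"
    and curv: "((\<lambda>t. excess_risk t / t\<^sup>2) \<longlongrightarrow> V / 2) (at 0)"
    and var: "\<And>K. 0 < K \<Longrightarrow>
      ((\<lambda>r. \<integral>u. indicator {-K..K} u * score_variation (r * u) \<partial>lborel) \<longlongrightarrow> 0) (at_right 0)"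
    and meas [measurable]: "\<And>n. \<theta> n \<in> borel_measurable M"
    and min: "\<And>n. 1 \<le> n \<Longrightarrow> AE \<omega> in M. \<forall>t.
      (\<Sum>i<n. loss_increment (\<theta> n \<omega>) (W i \<omega>)) \<le> (\<Sum>i<n. loss_increment t (W i \<omega>))"
    and tail: "AE \<omega> in M. \<forall>n t. T \<le> \<bar>t\<bar> \<longrightarrow>
      (\<Sum>i<n. loss_increment t (W i \<omega>)) = (\<Sum>i<n. loss_increment T (W i \<omega>))"
    and mean0: "mean_score 0 = 0"
    and \<sigma>: "0 < \<sigma>" "expectation (\<lambda>\<omega>. (q 0 (W 0 \<omega>))\<^sup>2) = \<sigma>\<^sup>2"
  shows "weak_conv_m (\<lambda>n. distr M borel (\<lambda>\<omega>. sqrt (real n) * \<theta> n \<omega>))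
           (density lborel (normal_density 0 (\<sigma> / V)))"
proof -
  let ?Y = "\<lambda>i \<omega>. q 0 (W i \<omega>)"
  have Ym: "random_variable borel (?Y i)" for i by measurable
  have qN: "q 0 \<in> borel_measurable N" by measurable
  have distrY: "distr M borel (?Y i) = distr M borel (?Y 0)" for i
    using distr_distr[OF qN W_measurable[of i]] distr_distr[OF qN W_measurable[of 0]] W_distr[of i]
    by (simp add: comp_def)
  have eqE: "expectation (\<lambda>\<omega>. k (?Y i \<omega>)) = expectation (\<lambda>\<omega>. k (?Y 0 \<omega>))"
    if [measurable]: "k \<in> borel_measurable borel" for k :: "real \<Rightarrow> real" and i
    using integral_distr[OF Ym that, of i] integral_distr[OF Ym that, of 0] distrY[of i] by simp
  have sq: "integrable M (\<lambda>\<omega>. (?Y i \<omega>)\<^sup>2)" for i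
    using integrable_distr_eq[OF Ym[of i], of "\<lambda>y. y\<^sup>2"] integrable_distr_eq[OF Ym[of 0], of "\<lambda>y. y\<^sup>2"]
      distrY[of i] q_square_integrable[of 0] by simp
  have mean: "expectation (?Y i) = 0" for i
    using eqE[of "\<lambda>y. y" i] mean0 by (simp add: mean_score_def)
  have var_eq: "variance (?Y i) = \<sigma>\<^sup>2" for i
    using eqE[of "\<lambda>y. y\<^sup>2" i] \<sigma>(2) by (simp add: mean)
  have "weak_conv_m (\<lambda>n. distr M borel (\<lambda>\<omega>. (\<Sum>i<n. ?Y i \<omega>) / sqrt (real n * \<sigma>\<^sup>2))) std_normal_distribution"
    by (rule central_limit_theorem_zero_mean[OF _ mean \<sigma>(1) sq var_eq distrY])
       (rule indep_vars_compose2[OF W_indep], simp)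
  moreover have "(\<Sum>i<n. ?Y i \<omega>) / sqrt (real n * \<sigma>\<^sup>2) = score_process n 0 \<omega> / \<sigma>" for n \<omega>
    using \<sigma>(1) mean0 by (simp add: score_process_def real_sqrt_mult)
  ultimately have clt: "weak_conv_m (\<lambda>n. distr M borel (\<lambda>\<omega>. score_process n 0 \<omega> / \<sigma>)) std_normal_distribution"
    by simp
  have "weak_conv_m (\<lambda>n. distr M borel (\<lambda>\<omega>. sqrt (real n) * \<theta> n \<omega>))
     (distr std_normal_distribution borel (\<lambda>x. (- \<sigma> / V) * x))"
  proof (rule weak_conv_scaled_perturbation[OF _ _ real_dist_normal_dist clt])
    fix \<eta> :: real assume "0 < \<eta>"
    have "sqrt (real n) * \<theta> n \<omega> - - \<sigma> / V * (score_process n 0 \<omega> / \<sigma>)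
        = sqrt (real n) * \<theta> n \<omega> + score_process n 0 \<omega> / V" for n \<omega>
      using \<sigma>(1) by simp
    then show "(\<lambda>n. prob {\<omega> \<in> space M. \<eta> < \<bar>sqrt (real n) * \<theta> n \<omega> - - \<sigma> / V * (score_process n 0 \<omega> / \<sigma>)\<bar>}) \<longlonglongrightarrow> 0"
      using minimiser_score_expansion[OF V c T quad curv var meas min tail \<open>0 < \<eta>\<close>] by simp
  qed measurable
  also have "distr std_normal_distribution borel (\<lambda>x. (- \<sigma> / V) * x) = density lborel (normal_density 0 \<bar>- \<sigma> / V\<bar>)"
    by (rule distr_std_normal_scale) (use \<sigma>(1) V in simp)
  also have "\<bar>- \<sigma> / V\<bar> = \<sigma> / V" using \<sigma>(1) V by simp
  finally show ?thesis .
qed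

end

text \<open>
  Pathwise convergence suffices, since the envelope dominates.
\<close>

lemma (in integrated_score_model) score_variation_tendsto:
  assumes K: "0 < K"
    and lim: "AE \<omega> in M. ((\<lambda>r. \<integral>u. indicator {-K..K} u * (q (r * u) (W 0 \<omega>) - q 0 (W 0 \<omega>))\<^sup>2 \<partial>lborel)
      \<longlongrightarrow> 0) (at_right 0)"
  shows "((\<lambda>r. \<integral>u. indicator {-K..K} u * score_variation (r * u) \<partial>lborel) \<longlongrightarrow> 0) (at_right 0)"
proof -
  interpret pair: pair_sigma_finite M lborel ..
  let ?f = "\<lambda>r \<omega> u. indicator {-K..K} u * (q (r * u) (W 0 \<omega>) - q 0 (W 0 \<omega>))\<^sup>2"
  have W_space: "W 0 \<omega> \<in> space N" if "\<omega> \<in> space M" for \<omega>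
    using measurable_space[OF W_measurable that] .
  have sq: "(q s w - q 0 w)\<^sup>2 \<le> 4 * (b w)\<^sup>2" for s w
  proof -
    have "\<bar>q s w - q 0 w\<bar> \<le> \<bar>2 * b w\<bar>" using q_bound[of s w] q_bound[of 0 w] by linarith
    then show ?thesis by (simp add: abs_le_square_iff power_mult_distrib)
  qed
  have path: "integrable lborel (\<lambda>u. ?f r \<omega> u)" if "\<omega> \<in> space M" for r \<omega>
    using sq[of _ "W 0 \<omega>"] W_space[OF that] by (intro integrable_window_bounded[where C = "4 * (b (W 0 \<omega>))\<^sup>2"]) auto
  have bound: "\<bar>\<integral>u. ?f r \<omega> u \<partial>lborel\<bar> \<le> 8 * K * (b (W 0 \<omega>))\<^sup>2" if \<omega>: "\<omega> \<in> space M" for r \<omega>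
  proof -
    have "(\<integral>u. ?f r \<omega> u \<partial>lborel) \<le> (\<integral>u. indicator {-K..K} u * (4 * (b (W 0 \<omega>))\<^sup>2) \<partial>lborel)"
      using K sq[of _ "W 0 \<omega>"] path[OF \<omega>] by (intro integral_mono mult_left_mono) auto
    moreover have "0 \<le> (\<integral>u. ?f r \<omega> u \<partial>lborel)" by (intro Bochner_Integration.integral_nonneg) auto
    ultimately show ?thesis using K by simp
  qed
  have meas: "(\<lambda>\<omega>. \<integral>u. ?f r \<omega> u \<partial>lborel) \<in> borel_measurable M" for r by measurable
  have Fub: "(\<integral>u. indicator {-K..K} u * score_variation (r * u) \<partial>lborel)
      = (\<integral>\<omega>. \<integral>u. ?f r \<omega> u \<partial>lborel \<partial>M)" for r
  proof -
    have "integrable (M \<Otimes>\<^sub>M lborel) (case_prod (?f r))"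
    proof (rule pair.Fubini_integrable)
      show "case_prod (?f r) \<in> borel_measurable (M \<Otimes>\<^sub>M lborel)" by measurable
      show "AE \<omega> in M. integrable lborel (\<lambda>u. case (\<omega>, u) of (\<omega>, u) \<Rightarrow> ?f r \<omega> u)"
        using path by (intro AE_I2) simp
      show "integrable M (\<lambda>\<omega>. \<integral>u. norm (case (\<omega>, u) of (\<omega>, u) \<Rightarrow> ?f r \<omega> u) \<partial>lborel)"
      proof (rule Bochner_Integration.integrable_bound)
        show "integrable M (\<lambda>\<omega>. 8 * K * (b (W 0 \<omega>))\<^sup>2)" using b_square by simp
        show "AE \<omega> in M. norm (\<integral>u. norm (case (\<omega>, u) of (\<omega>, u) \<Rightarrow> ?f r \<omega> u) \<partial>lborel)
            \<le> norm (8 * K * (b (W 0 \<omega>))\<^sup>2)"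
          using bound[of _ r] K by (intro AE_I2) (simp add: abs_mult)
        show "(\<lambda>\<omega>. \<integral>u. norm (case (\<omega>, u) of (\<omega>, u) \<Rightarrow> ?f r \<omega> u) \<partial>lborel) \<in> borel_measurable M"
          unfolding prod.case by measurable
      qed
    qed
    from pair.Fubini_integral[OF this] show ?thesis by (simp add: score_variation_def)
  qed
  show ?thesis
    unfolding tendsto_at_iff_sequentially Fub
  proof safe
    fix R :: "nat \<Rightarrow> real" assume R: "\<forall>i. R i \<in> {0<..} - {0}" "R \<longlonglongrightarrow> 0"
    have "(\<lambda>i. \<integral>\<omega>. \<integral>u. ?f (R i) \<omega> u \<partial>lborel \<partial>M) \<longlonglongrightarrow> (\<integral>\<omega>. 0 \<partial>M)"
    proof (rule integral_dominated_convergence[where w = "\<lambda>\<omega>. 8 * K * (b (W 0 \<omega>))\<^sup>2"])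
      show "integrable M (\<lambda>\<omega>. 8 * K * (b (W 0 \<omega>))\<^sup>2)" using b_square by simp
      show "AE \<omega> in M. (\<lambda>i. \<integral>u. ?f (R i) \<omega> u \<partial>lborel) \<longlonglongrightarrow> 0"
        using lim
      proof eventually_elim
        case (elim \<omega>)
        then show ?case using R unfolding tendsto_at_iff_sequentially comp_def by blast
      qed
      show "AE \<omega> in M. norm (\<integral>u. ?f (R i) \<omega> u \<partial>lborel) \<le> 8 * K * (b (W 0 \<omega>))\<^sup>2" for i
        using bound by (intro AE_I2) simp
    qed (use meas in auto)
    then show "((\<lambda>r. \<integral>\<omega>. \<integral>u. ?f r \<omega> u \<partial>lborel \<partial>M) \<circ> R) \<longlonglongrightarrow> 0" by (simp add: comp_def)
  qed
qed

section \<open>Differences of an even loss along a Lipschitz path\<close>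

lemma deriv_of_even:
  fixes L :: "real \<Rightarrow> real"
  assumes even: "\<And>u. L (- u) = L u" and diff: "\<And>x. (L has_real_derivative L' x) (at x)"
  shows "L' (- x) = - L' x"
proof -
  have "((\<lambda>x. L (- x)) has_real_derivative (L' (- x) * - 1)) (at x)"
    by (rule DERIV_chain2[OF diff]) (auto intro!: derivative_eq_intros)
  then have "(L has_real_derivative - L' (- x)) (at x)" by (simp add: even)
  from DERIV_unique[OF this diff] show ?thesis by simp
qed

lemma second_difference_bound:
  fixes L :: "real \<Rightarrow> real"
  assumes diff: "\<And>x. (L has_real_derivative L' x) (at x)" and lip: "\<And>x y. \<bar>L' x - L' y\<bar> \<le> C * \<bar>x - y\<bar>"
  shows "\<bar>L (z + r) + L (z - r) - 2 * L z\<bar> \<le> 2 * C * r\<^sup>2"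
proof -
  have C: "0 \<le> C" using lip[of 1 0] by simp
  have pos: "\<bar>L (z + r) + L (z - r) - 2 * L z\<bar> \<le> 2 * C * r\<^sup>2" if r: "0 < r" for r
  proof -
    obtain x where x: "z < x" "x < z + r" "L (z + r) - L z = (z + r - z) * L' x"
      using MVT2[of z "z + r" L L'] diff r by auto
    obtain y where y: "z - r < y" "y < z" "L z - L (z - r) = (z - (z - r)) * L' y"
      using MVT2[of "z - r" z L L'] diff r by auto
    have "L (z + r) + L (z - r) - 2 * L z = r * (L' x - L' y)"
      using x(3) y(3) by (simp add: algebra_simps)
    also have "\<bar>\<dots>\<bar> = r * \<bar>L' x - L' y\<bar>" using r by (simp add: abs_mult)
    also have "\<dots> \<le> r * (C * (2 * r))"
      using r C x y by (intro mult_left_mono order_trans[OF lip]) auto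
    finally show ?thesis by (simp add: power2_eq_square mult_ac)
  qed
  consider "r = 0" | "0 < r" | "0 < - r" by linarith
  then show ?thesis
  proof cases
    case 3
    then show ?thesis using pos[of "- r"] by (simp add: add.commute)
  qed (use pos in auto)
qed

text \<open>
  Only one application of L'Hopital's rule is possible, because \<open>L'\<close> need not be differentiable near \<open>z\<close>; the
  remaining limit is the symmetric difference quotient of \<open>L'\<close> at \<open>z\<close>.
\<close>

lemma second_difference_quotient_tendsto:
  fixes L :: "real \<Rightarrow> real"
  assumes diff: "\<And>x. (L has_real_derivative L' x) (at x)" and diff2: "(L' has_real_derivative d) (at z)"
  shows "((\<lambda>r. (L (z + r) + L (z - r) - 2 * L z) / r\<^sup>2) \<longlongrightarrow> d) (at 0)"
proof (rule lhopital)
  have cont: "isCont L x" for x using DERIV_isCont[OF diff] .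
  show "((\<lambda>r. L (z + r) + L (z - r) - 2 * L z) \<longlongrightarrow> 0) (at 0)"
  proof -
    have "isCont (\<lambda>r. L (z + r) + L (z - r) - 2 * L z) 0"
      by (intro continuous_intros isCont_o2[OF _ cont])
    then show ?thesis by (simp add: isCont_def)
  qed
  show "((\<lambda>r::real. r\<^sup>2) \<longlongrightarrow> 0) (at 0)" by (rule tendsto_eq_intros refl | simp)+
  show "\<forall>\<^sub>F r in at 0. ((\<lambda>r. L (z + r) + L (z - r) - 2 * L z) has_real_derivative (L' (z + r) - L' (z - r))) (at r)"
  proof (rule always_eventually, rule allI)
    fix r
    have "((\<lambda>r. L (z + r)) has_real_derivative L' (z + r) * 1) (at r)"
      by (rule DERIV_chain2[OF diff]) (auto intro!: derivative_eq_intros)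
    moreover have "((\<lambda>r. L (z - r)) has_real_derivative L' (z - r) * - 1) (at r)"
      by (rule DERIV_chain2[OF diff]) (auto intro!: derivative_eq_intros)
    ultimately show "((\<lambda>r. L (z + r) + L (z - r) - 2 * L z) has_real_derivative (L' (z + r) - L' (z - r))) (at r)"
      by (auto intro!: derivative_eq_intros)
  qed
  show "\<forall>\<^sub>F r in at 0. ((\<lambda>r::real. r\<^sup>2) has_real_derivative 2 * r) (at r)"
    by (auto intro!: always_eventually derivative_eq_intros)
  show "\<forall>\<^sub>F r in at 0. (2 * r :: real) \<noteq> 0" "\<forall>\<^sub>F r in at 0. (r :: real)\<^sup>2 \<noteq> 0"
    by (auto simp: eventually_at_filter)
  have "((\<lambda>h. L' (z + h) - L' (z - h)) has_real_derivative (d * 1 - d * - 1)) (at 0)"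
    by (rule DERIV_diff; rule DERIV_chain2[where f = L']) (use diff2 in \<open>auto intro!: derivative_eq_intros\<close>)
  then have "((\<lambda>r. (L' (z + r) - L' (z - r)) / r) \<longlongrightarrow> 2 * d) (at 0)" by (simp add: DERIV_def)
  then have "((\<lambda>r. (L' (z + r) - L' (z - r)) / r / 2) \<longlongrightarrow> 2 * d / 2) (at 0)" by (intro tendsto_intros) auto
  then show "((\<lambda>r. (L' (z + r) - L' (z - r)) / (2 * r)) \<longlongrightarrow> d) (at 0)" by (simp add: mult.commute)
qed

lemma second_difference_along_path:
  fixes L f :: "real \<Rightarrow> real"
  assumes diff: "\<And>x. (L has_real_derivative L' x) (at x)" and diff2: "(L' has_real_derivative d) (at z)"
    and f: "(f has_real_derivative a) (at u)"
  shows "((\<lambda>t. (L (z + (f u - f (u - t))) + L (z - (f u - f (u - t))) - 2 * L z) / t\<^sup>2) \<longlongrightarrow> d * a\<^sup>2) (at 0)"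
proof -
  \<comment> \<open>The increment may vanish for \<open>t \<noteq> 0\<close>, so the difference quotient is extended continuously to \<open>0\<close>.\<close>
  define \<kappa> where "\<kappa> r = (if r = 0 then d else (L (z + r) + L (z - r) - 2 * L z) / r\<^sup>2)" for r
  define R where "R t = f u - f (u - t)" for t
  have "(\<kappa> \<longlongrightarrow> \<kappa> 0) (at 0)"
    using second_difference_quotient_tendsto[OF diff diff2]
    by (rule Lim_transform_eventually[THEN tendsto_eq_rhs]) (auto simp: \<kappa>_def eventually_at_filter)
  then have \<kappa>: "isCont \<kappa> 0" by (simp add: isCont_def)
  have "((\<lambda>t. f u - f (u - t)) has_real_derivative (0 - a * - 1)) (at 0)"
    by (rule DERIV_diff; (rule DERIV_chain2[where f = f])?) (use f in \<open>auto intro!: derivative_eq_intros\<close>)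
  then have dR: "(R has_real_derivative a) (at 0)" by (simp add: R_def[abs_def])
  have R0: "R 0 = 0" by (simp add: R_def)
  have "((\<lambda>t. R t / t) \<longlongrightarrow> a) (at 0)" using dR by (simp add: DERIV_def R0)
  moreover have "((\<lambda>t. \<kappa> (R t)) \<longlongrightarrow> d) (at 0)"
  proof -
    have "isCont (\<lambda>t. \<kappa> (R t)) 0" by (rule isCont_o2[OF DERIV_isCont[OF dR]]) (simp add: R0 \<kappa>)
    then show ?thesis by (simp add: isCont_def R0 \<kappa>_def)
  qed
  ultimately have "((\<lambda>t. (\<kappa> (R t)) * (R t / t)\<^sup>2) \<longlongrightarrow> d * a\<^sup>2) (at 0)" by (intro tendsto_intros)
  moreover have "\<kappa> (R t) * (R t / t)\<^sup>2 = (L (z + R t) + L (z - R t) - 2 * L z) / t\<^sup>2" for t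
    by (simp add: \<kappa>_def power_divide)
  ultimately show ?thesis by (simp add: R_def)
qed

text \<open>
  The argument of \<open>L\<close> stays in \<open>{z - 2 * F..z + 2 * F}\<close>, where \<open>L\<close> is Lipschitz, so \<open>t \<mapsto> L (z + f u - f (u - t))\<close> is
  Lipschitz; the chain rule identifies its derivative at almost every \<open>t\<close>.
\<close>

lemma loss_path_eq_integral:
  fixes L f g :: "real \<Rightarrow> real"
  assumes L: "\<And>x. (L has_real_derivative L' x) (at x)" and L'_cont: "continuous_on UNIV L'"
    and f_lip: "C-lipschitz_on UNIV f" and f_bd: "\<And>x. \<bar>f x\<bar> \<le> F"
    and g [measurable]: "g \<in> borel_measurable borel"
    and fg: "AE x in lborel. (f has_real_derivative g x) (at x)"
  shows "L (z + f u - f (u - t)) - L z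
       = (\<integral>s. signed_interval t s * (L' (z + f u - f (u - s)) * g (u - s)) \<partial>lborel)"
proof -
  have [measurable]: "L' \<in> borel_measurable borel" using L'_cont by (rule borel_measurable_continuous_onI)
  have [measurable]: "f \<in> borel_measurable borel"
    using lipschitz_on_continuous_on[OF f_lip] by (rule borel_measurable_continuous_onI)
  define p where "p s = L (z + f u - f (u - s))" for s
  let ?I = "{z - 2 * F..z + 2 * F}"
  have "continuous_on ?I (\<lambda>x. \<bar>L' x\<bar>)"
    using L'_cont by (intro continuous_on_rabs) (rule continuous_on_subset, auto)
  then have "bounded ((\<lambda>x. \<bar>L' x\<bar>) ` ?I)"
    by (intro compact_imp_bounded compact_continuous_image compact_Icc)
  then obtain B where "\<And>y. y \<in> (\<lambda>x. \<bar>L' x\<bar>) ` ?I \<Longrightarrow> norm y \<le> B" unfolding bounded_iff by blast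
  then have B: "\<bar>L' x\<bar> \<le> B" if "x \<in> ?I" for x using that by fastforce
  have F0: "0 \<le> F" using f_bd[of 0] by linarith
  have B0: "0 \<le> B" using B[of z] F0 by (simp add: order_trans[OF abs_ge_zero])
  have arg: "z + f u - f (u - s) \<in> ?I" for s
    using f_bd[of u] f_bd[of "u - s"] by (auto simp: abs_le_iff)
  have L_lip: "\<bar>L x - L y\<bar> \<le> B * \<bar>x - y\<bar>" if "x \<in> ?I" "y \<in> ?I" for x y
    using field_differentiable_bound[of ?I L L' B x y] that B L
    by (simp add: has_field_derivative_at_within)
  have p_lip: "(B * C)-lipschitz_on UNIV p"
  proof (rule lipschitz_onI)
    show "0 \<le> B * C" using B0 lipschitz_on_nonneg[OF f_lip] by simp
    fix x y :: real
    have "dist (p x) (p y) \<le> B * \<bar>f (u - y) - f (u - x)\<bar>"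
      unfolding p_def dist_real_def by (rule order_trans[OF L_lip[OF arg arg]]) simp
    also have "\<dots> \<le> B * (C * dist x y)"
      using lipschitz_onD[OF f_lip, of "u - y" "u - x"] B0
      by (intro mult_left_mono) (simp_all add: dist_real_def)
    finally show "dist (p x) (p y) \<le> B * C * dist x y" by (simp add: mult.assoc)
  qed
  have "AE s in lborel. (f has_real_derivative g (u - s)) (at (u - s))"
    using AE_lborel_affine[OF fg, of "-1" u] by simp
  then have "AE s in lborel. (p has_real_derivative L' (z + f u - f (u - s)) * g (u - s)) (at s)"
  proof eventually_elim
    case (elim s)
    have "((\<lambda>s. f (u - s)) has_real_derivative g (u - s) * - 1) (at s)"
      by (rule DERIV_chain2[where f = f and g = "\<lambda>s. u - s", OF elim]) (auto intro!: derivative_eq_intros)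
    then have "((\<lambda>s. z + f u - f (u - s)) has_real_derivative g (u - s)) (at s)"
      by (auto intro!: derivative_eq_intros)
    from DERIV_chain2[OF L this] show ?case by (simp add: p_def[abs_def])
  qed
  from lipschitz_eq_integral_of_derivative[OF p_lip _ this, of t] show ?thesis by (simp add: p_def)
qed

lemma (in prob_space) AE_distributed_lborel:
  assumes X: "distributed M lborel X \<phi>" and Q: "AE x in lborel. Q x"
  shows "AE \<omega> in M. Q (X \<omega>)"
proof -
  have "AE x in density lborel \<phi>. Q x"
    using Q distributed_borel_measurable[OF X] by (subst AE_density) auto
  then have "AE x in distr M lborel X. Q x" unfolding distributed_distr_eq_density[OF X] .
  then show ?thesis by (rule AE_distrD[OF distributed_measurable[OF X]])
qed

section \<open>The template matching model\<close>

text \<open>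
  The template matching model together with the analytic data that the proof uses: \<open>g\<close> is a bounded Borel
  version of \<open>f'\<close>, and \<open>B\<close> dominates \<open>L'\<close> on all arguments that a noise value and an increment of
  \<open>f\<close> can produce.  Thus Lipschitz losses and losses of quadratic growth are treated together.
\<close>

locale smooth_template_model = template_matching P f lam phi \<theta>s X Y Z
  for P :: "'a measure" and f lam phi :: "real \<Rightarrow> real" and \<theta>s :: real
    and X Y Z :: "nat \<Rightarrow> 'a \<Rightarrow> real" +
  fixes L g B :: "real \<Rightarrow> real" and Cf CL F :: real
  assumes f_lip: "Cf-lipschitz_on UNIV f" and f_bound: "\<And>x. \<bar>f x\<bar> \<le> F"
    and g_measurable [measurable]: "g \<in> borel_measurable borel" and g_bound: "\<And>x. \<bar>g x\<bar> \<le> Cf"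
    and g_deriv: "AE x in lborel. (f has_real_derivative g x) (at x)"
    and L_deriv: "\<And>x. (L has_real_derivative deriv L x) (at x)"
    and L'_lip: "CL-lipschitz_on UNIV (deriv L)"
    and L_even: "\<And>u. L (- u) = L u"
    and phi_even: "\<And>z. phi (- z) = phi z"
    and B_measurable [measurable]: "B \<in> borel_measurable borel"
    and B_bound: "\<And>z r. \<bar>r\<bar> \<le> 2 * F \<Longrightarrow> \<bar>deriv L (z + r)\<bar> \<le> B z"
    and B_square: "integrable P (\<lambda>\<omega>. (B (Z 0 \<omega>))\<^sup>2)"
begin

definition shifted_obs :: "nat \<Rightarrow> 'a \<Rightarrow> real \<times> real" where
  "shifted_obs i \<omega> = (X i \<omega> - \<theta>s, Z i \<omega>)"

definition score_fun :: "real \<Rightarrow> real \<times> real \<Rightarrow> real" where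
  "score_fun s w = deriv L (snd w + f (fst w) - f (fst w - s)) * g (fst w - s)"

lemma X_measurable [measurable]: "X i \<in> borel_measurable P"
  using distributed_measurable[OF X_density[of i]] by simp

lemma Z_measurable [measurable]: "Z i \<in> borel_measurable P"
  using distributed_measurable[OF Z_density[of i]] by simp

lemma f_measurable [measurable]: "f \<in> borel_measurable borel"
  using lipschitz_on_continuous_on[OF f_lip] by (rule borel_measurable_continuous_onI)

lemma L'_continuous: "continuous_on UNIV (deriv L)"
  using L'_lip by (rule lipschitz_on_continuous_on)

lemma L'_measurable [measurable]: "deriv L \<in> borel_measurable borel"
  using L'_continuous by (rule borel_measurable_continuous_onI)

lemma L''_measurable [measurable]: "deriv (deriv L) \<in> borel_measurable borel"
  using L'_continuous by (rule borel_measurable_deriv)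

lemma L_measurable [measurable]: "L \<in> borel_measurable borel"
proof (rule borel_measurable_continuous_onI)
  show "continuous_on UNIV L"
    using DERIV_isCont[OF L_deriv] by (simp add: continuous_on_eq_continuous_at)
qed

lemma L'_lipD: "\<bar>deriv L x - deriv L y\<bar> \<le> CL * \<bar>x - y\<bar>"
  using lipschitz_onD[OF L'_lip, of x y] by (simp add: dist_real_def)

lemma f_lipD: "\<bar>f x - f y\<bar> \<le> Cf * \<bar>x - y\<bar>"
  using lipschitz_onD[OF f_lip, of x y] by (simp add: dist_real_def)

lemma L'_odd: "deriv L (- x) = - deriv L x"
  by (rule deriv_of_even[OF L_even L_deriv])

lemma F_nonneg: "0 \<le> F" using f_bound[of 0] by linarith

lemma Cf_nonneg: "0 \<le> Cf" using f_lip by (rule lipschitz_on_nonneg)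

lemma CL_nonneg: "0 \<le> CL" using L'_lip by (rule lipschitz_on_nonneg)

lemma L'_le_B: "\<bar>deriv L z\<bar> \<le> B z"
  using B_bound[of 0 z] F_nonneg by simp

lemma B_nonneg: "0 \<le> B z"
  using L'_le_B[of z] by linarith

lemma increment_bound: "\<bar>f u - f (u - s)\<bar> \<le> 2 * F"
  using f_bound[of u] f_bound[of "u - s"] by linarith

lemma indep_X_Z: "indep_var borel (X i) borel (Z i)"
proof -
  have "indep_var borel ((\<lambda>x. x i) \<circ> (\<lambda>\<omega> i. X i \<omega>)) borel ((\<lambda>x. x i) \<circ> (\<lambda>\<omega> i. Z i \<omega>))"
    by (rule indep_var_compose[OF X_Z_indep]) (rule measurable_component_singleton, simp)+
  then show ?thesis by (simp add: comp_def)
qed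

lemma distr_X: "distr P borel (X i) = density lborel lam"
  using distributed_distr_eq_density[OF X_density[of i]] by (simp cong: distr_cong)

lemma distr_Z: "distr P borel (Z i) = density lborel phi"
  using distributed_distr_eq_density[OF Z_density[of i]] by (simp cong: distr_cong)

lemma distr_X_Z: "distr P (borel \<Otimes>\<^sub>M borel) (\<lambda>\<omega>. (X i \<omega>, Z i \<omega>)) = density lborel lam \<Otimes>\<^sub>M density lborel phi"
  using indep_X_Z[of i] unfolding indep_var_distribution_eq distr_X distr_Z by simp

text \<open>
  Symmetry of the noise density, combined with independence, makes \<open>(X, Z)\<close> and \<open>(X, - Z)\<close> equal in
  distribution.
\<close>

lemma distr_X_minus_Z:
  "distr P (borel \<Otimes>\<^sub>M borel) (\<lambda>\<omega>. (X i \<omega>, - Z i \<omega>)) = distr P (borel \<Otimes>\<^sub>M borel) (\<lambda>\<omega>. (X i \<omega>, Z i \<omega>))"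
proof -
  have "indep_var borel (id \<circ> X i) borel (uminus \<circ> Z i)"
    by (rule indep_var_compose[OF indep_X_Z]) auto
  then have ind: "indep_var borel (X i) borel (\<lambda>\<omega>. - Z i \<omega>)" by (simp add: comp_def)
  have "distributed P lborel (\<lambda>\<omega>. 0 + - 1 * Z i \<omega>) (\<lambda>x. ennreal (phi ((x - 0) / - 1)) / ennreal \<bar>- 1\<bar>)"
    by (rule distributed_affine[OF Z_density]) simp
  then have "distributed P lborel (\<lambda>\<omega>. - Z i \<omega>) phi" by (simp add: phi_even divide_ennreal_def)
  from distributed_distr_eq_density[OF this]
  have "distr P borel (\<lambda>\<omega>. - Z i \<omega>) = density lborel phi" by (simp cong: distr_cong)
  then show ?thesis using ind unfolding indep_var_distribution_eq distr_X distr_X_Z by simp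
qed

lemma expectation_reflect_noise:
  fixes k :: "real \<Rightarrow> real \<Rightarrow> real"
  assumes k: "(\<lambda>(x, z). k x z) \<in> borel_measurable (borel \<Otimes>\<^sub>M borel)"
  shows "expectation (\<lambda>\<omega>. k (X 0 \<omega>) (- Z 0 \<omega>)) = expectation (\<lambda>\<omega>. k (X 0 \<omega>) (Z 0 \<omega>))"
    and "integrable P (\<lambda>\<omega>. k (X 0 \<omega>) (- Z 0 \<omega>)) \<longleftrightarrow> integrable P (\<lambda>\<omega>. k (X 0 \<omega>) (Z 0 \<omega>))"
proof -
  have m1: "(\<lambda>\<omega>. (X 0 \<omega>, - Z 0 \<omega>)) \<in> measurable P (borel \<Otimes>\<^sub>M borel)"
    and m2: "(\<lambda>\<omega>. (X 0 \<omega>, Z 0 \<omega>)) \<in> measurable P (borel \<Otimes>\<^sub>M borel)" by measurable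
  show "expectation (\<lambda>\<omega>. k (X 0 \<omega>) (- Z 0 \<omega>)) = expectation (\<lambda>\<omega>. k (X 0 \<omega>) (Z 0 \<omega>))"
    using integral_distr[OF m1 k] integral_distr[OF m2 k] distr_X_minus_Z[of 0] by simp
  show "integrable P (\<lambda>\<omega>. k (X 0 \<omega>) (- Z 0 \<omega>)) \<longleftrightarrow> integrable P (\<lambda>\<omega>. k (X 0 \<omega>) (Z 0 \<omega>))"
    using integrable_distr_eq[OF m1 k] integrable_distr_eq[OF m2 k] distr_X_minus_Z[of 0] by simp
qed

lemma expectation_product:
  fixes k l :: "real \<Rightarrow> real"
  assumes [measurable]: "k \<in> borel_measurable borel" "l \<in> borel_measurable borel"
    and "integrable P (\<lambda>\<omega>. k (Z 0 \<omega>))" "integrable P (\<lambda>\<omega>. l (X 0 \<omega> - \<theta>s))"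
  shows "expectation (\<lambda>\<omega>. k (Z 0 \<omega>) * l (X 0 \<omega> - \<theta>s))
       = expectation (\<lambda>\<omega>. k (Z 0 \<omega>)) * expectation (\<lambda>\<omega>. l (X 0 \<omega> - \<theta>s))"
proof -
  have "indep_var borel ((\<lambda>x. l (x - \<theta>s)) \<circ> X 0) borel (k \<circ> Z 0)"
    by (rule indep_var_compose[OF indep_X_Z]) measurable
  then have "indep_var borel (\<lambda>\<omega>. l (X 0 \<omega> - \<theta>s)) borel (\<lambda>\<omega>. k (Z 0 \<omega>))" by (simp add: comp_def)
  from indep_var_lebesgue_integral[OF this assms(4,3)] show ?thesis by (simp add: mult.commute)
qed

lemma AE_shifted_X: "AE x in lborel. Q x \<Longrightarrow> AE \<omega> in P. Q (X 0 \<omega> - \<theta>s)"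
  using AE_distributed_lborel[OF X_density[of 0], of "\<lambda>x. Q (x - \<theta>s)"] AE_lborel_affine[of Q 1 "- \<theta>s"]
  by simp

lemma AE_Z: "AE z in lborel. Q z \<Longrightarrow> AE \<omega> in P. Q (Z 0 \<omega>)"
  by (rule AE_distributed_lborel[OF Z_density[of 0]])

lemma shifted_obs_indep: "indep_vars (\<lambda>_. borel \<Otimes>\<^sub>M borel) shifted_obs UNIV"
  unfolding shifted_obs_def[abs_def]
  using indep_vars_compose2[OF indep_vars_Pair[OF X_indep Z_indep X_Z_indep],
      where Y = "\<lambda>_ w. (fst w - \<theta>s, snd w)" and N = "\<lambda>_. borel \<Otimes>\<^sub>M borel"]
  by simp

lemma shifted_obs_distr:
  "distr P (borel \<Otimes>\<^sub>M borel) (shifted_obs i) = distr P (borel \<Otimes>\<^sub>M borel) (shifted_obs 0)"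
proof -
  have "distr P (borel \<Otimes>\<^sub>M borel) (shifted_obs i)
      = distr (distr P (borel \<Otimes>\<^sub>M borel) (\<lambda>\<omega>. (X i \<omega>, Z i \<omega>))) (borel \<Otimes>\<^sub>M borel) (\<lambda>w. (fst w - \<theta>s, snd w))" for i
    by (subst distr_distr) (auto simp: comp_def shifted_obs_def[abs_def])
  then show ?thesis unfolding distr_X_Z by simp
qed

sublocale score: integrated_score_model P "borel \<Otimes>\<^sub>M borel" shifted_obs score_fun "\<lambda>w. Cf * B (snd w)"
proof unfold_locales
  show "indep_vars (\<lambda>_. borel \<Otimes>\<^sub>M borel) shifted_obs UNIV" by (rule shifted_obs_indep)
  show "distr P (borel \<Otimes>\<^sub>M borel) (shifted_obs i) = distr P (borel \<Otimes>\<^sub>M borel) (shifted_obs 0)" for i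
    by (rule shifted_obs_distr)
  show "(\<lambda>(s, w). score_fun s w) \<in> borel_measurable (borel \<Otimes>\<^sub>M (borel \<Otimes>\<^sub>M borel))"
    unfolding score_fun_def by measurable
  show "(\<lambda>w. Cf * B (snd w)) \<in> borel_measurable (borel \<Otimes>\<^sub>M borel)" by measurable
  show "integrable P (\<lambda>\<omega>. (Cf * B (snd (shifted_obs 0 \<omega>)))\<^sup>2)"
    using B_square by (simp add: shifted_obs_def power_mult_distrib)
  fix s and w :: "real \<times> real"
  have "\<bar>deriv L (snd w + (f (fst w) - f (fst w - s)))\<bar> * \<bar>g (fst w - s)\<bar> \<le> B (snd w) * Cf"
    by (intro mult_mono B_bound increment_bound g_bound B_nonneg) auto
  then show "\<bar>score_fun s w\<bar> \<le> Cf * B (snd w)"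
    by (simp add: score_fun_def abs_mult add_diff_eq mult.commute)
qed

lemma loss_increment_eq:
  "score.loss_increment t w = L (snd w + f (fst w) - f (fst w - t)) - L (snd w)"
  unfolding score.loss_increment_def score_fun_def
  by (rule loss_path_eq_integral[OF L_deriv L'_continuous f_lip f_bound g_measurable g_deriv, symmetric])

lemma loss_increment_obs:
  "score.loss_increment t (shifted_obs i \<omega>)
     = L (Z i \<omega> + (f (X i \<omega> - \<theta>s) - f (X i \<omega> - \<theta>s - t))) - L (Z i \<omega>)"
  by (simp add: loss_increment_eq shifted_obs_def add_diff_eq)

lemma loss_increment_obs_integrable: "integrable P (\<lambda>\<omega>. score.loss_increment t (shifted_obs 0 \<omega>))"
proof (rule Bochner_Integration.integrable_bound)
  show "integrable P (\<lambda>\<omega>. 2 * \<bar>t\<bar> * (Cf * B (snd (shifted_obs 0 \<omega>))))"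
    by (rule integrable_mult_right[OF score.b_integrable])
  show "(\<lambda>\<omega>. score.loss_increment t (shifted_obs 0 \<omega>)) \<in> borel_measurable P"
    unfolding loss_increment_obs by measurable
  show "AE \<omega> in P. norm (score.loss_increment t (shifted_obs 0 \<omega>)) \<le> norm (2 * \<bar>t\<bar> * (Cf * B (snd (shifted_obs 0 \<omega>))))"
  proof (rule AE_I2)
    fix \<omega> assume "\<omega> \<in> space P"
    let ?w = "shifted_obs 0 \<omega>"
    let ?b = "Cf * B (snd ?w)"
    have "\<bar>score.loss_increment t ?w\<bar> \<le> (\<integral>s. \<bar>signed_interval t s * score_fun s ?w\<bar> \<partial>lborel)"
      unfolding score.loss_increment_def by (rule integral_abs_bound)
    also have "\<dots> \<le> (\<integral>s. indicator {- \<bar>t\<bar>..\<bar>t\<bar>} s * ?b \<partial>lborel)"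
    proof (rule integral_mono)
      have "integrable lborel (\<lambda>s. signed_interval t s * score_fun s ?w)"
        by (intro integrable_signed_interval_bounded[where C = ?b])
           (auto intro: score.q_bound score.q_measurable_path simp: space_pair_measure)
      then show "integrable lborel (\<lambda>s. \<bar>signed_interval t s * score_fun s ?w\<bar>)" by (rule integrable_abs)
      show "integrable lborel (\<lambda>s. indicator {- \<bar>t\<bar>..\<bar>t\<bar>} s * ?b)" by simp
      show "\<bar>signed_interval t s * score_fun s ?w\<bar> \<le> indicator {- \<bar>t\<bar>..\<bar>t\<bar>} s * ?b" for s
        unfolding abs_mult using abs_signed_interval_le[of t s] score.q_bound[of s ?w] score.b_nonneg[of ?w]
        by (intro mult_mono) auto
    qed
    also have "\<dots> = 2 * \<bar>t\<bar> * ?b" by simp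
    also have "\<dots> \<le> \<bar>2 * \<bar>t\<bar> * ?b\<bar>" by (rule abs_ge_self)
    finally show "norm (score.loss_increment t ?w) \<le> norm (2 * \<bar>t\<bar> * ?b)" by simp
  qed
qed

text \<open>
  Averaging the excess risk over \<open>Z\<close> and \<open>- Z\<close> removes the first order term in the increment of \<open>f\<close>.  What is
  left is of second order pointwise, so that dominated convergence applies after division by \<open>t\<^sup>2\<close>.
\<close>

lemma excess_risk_symmetrised:
  "score.excess_risk t = expectation (\<lambda>\<omega>.
     (L (Z 0 \<omega> + (f (X 0 \<omega> - \<theta>s) - f (X 0 \<omega> - \<theta>s - t)))
      + L (Z 0 \<omega> - (f (X 0 \<omega> - \<theta>s) - f (X 0 \<omega> - \<theta>s - t))) - 2 * L (Z 0 \<omega>)) / 2)"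
proof -
  define k where "k x z = L (z + (f (x - \<theta>s) - f (x - \<theta>s - t))) - L z" for x z
  have km: "(\<lambda>(x, z). k x z) \<in> borel_measurable (borel \<Otimes>\<^sub>M borel)" unfolding k_def by measurable
  have R: "score.excess_risk t = expectation (\<lambda>\<omega>. k (X 0 \<omega>) (Z 0 \<omega>))"
    unfolding score.excess_risk_def loss_increment_obs k_def ..
  have int: "integrable P (\<lambda>\<omega>. k (X 0 \<omega>) (Z 0 \<omega>))"
    using loss_increment_obs_integrable[of t] unfolding loss_increment_obs k_def .
  have int': "integrable P (\<lambda>\<omega>. k (X 0 \<omega>) (- Z 0 \<omega>))"
    using expectation_reflect_noise(2)[OF km] int by simp
  have refl: "k (X 0 \<omega>) (- Z 0 \<omega>) = L (Z 0 \<omega> - (f (X 0 \<omega> - \<theta>s) - f (X 0 \<omega> - \<theta>s - t))) - L (Z 0 \<omega>)" for \<omega>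
    using L_even[of "Z 0 \<omega> - (f (X 0 \<omega> - \<theta>s) - f (X 0 \<omega> - \<theta>s - t))"] by (simp add: k_def L_even)
  have "score.excess_risk t = (expectation (\<lambda>\<omega>. k (X 0 \<omega>) (Z 0 \<omega>)) + expectation (\<lambda>\<omega>. k (X 0 \<omega>) (- Z 0 \<omega>))) / 2"
    unfolding R expectation_reflect_noise(1)[OF km] by simp
  also have "\<dots> = expectation (\<lambda>\<omega>. (k (X 0 \<omega>) (Z 0 \<omega>) + k (X 0 \<omega>) (- Z 0 \<omega>)) / 2)"
    using int int' by simp
  finally show ?thesis unfolding refl unfolding k_def by (simp add: algebra_simps)
qed

lemma L''_AE: "AE z in lborel. (deriv L has_real_derivative deriv (deriv L) z) (at z) \<and> \<bar>deriv (deriv L) z\<bar> \<le> CL"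
proof -
  obtain k where "k \<in> borel_measurable borel" and k: "\<And>x. \<bar>k x\<bar> \<le> CL"
    and "\<And>a b. a \<le> b \<Longrightarrow> deriv L b - deriv L a = (\<integral>x. indicator {a..b} x * k x \<partial>lborel)"
    and k_deriv: "AE z in lborel. (deriv L has_real_derivative k z) (at z)"
    using lipschitz_eq_integral_of_bounded_density[OF L'_lip] by blast
  from k_deriv show ?thesis
  proof eventually_elim
    case (elim z)
    then show ?case using k[of z] by (simp add: DERIV_imp_deriv[OF elim])
  qed
qed

lemma L''_integrable: "integrable P (\<lambda>\<omega>. deriv (deriv L) (Z 0 \<omega>))"
proof (rule integrable_const_bound[where B = CL])
  show "AE \<omega> in P. norm (deriv (deriv L) (Z 0 \<omega>)) \<le> CL"
    using AE_Z[OF L''_AE] by eventually_elim simp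
qed measurable

lemma g_square_integrable: "integrable P (\<lambda>\<omega>. (g (X 0 \<omega> - \<theta>s))\<^sup>2)"
proof (rule integrable_const_bound[where B = "Cf\<^sup>2"])
  show "AE \<omega> in P. norm ((g (X 0 \<omega> - \<theta>s))\<^sup>2) \<le> Cf\<^sup>2"
    using g_bound Cf_nonneg by (intro AE_I2) (simp add: abs_le_square_iff[symmetric])
qed measurable

lemma g_integrable: "integrable P (\<lambda>\<omega>. g (X 0 \<omega> - \<theta>s))"
  by (rule expectation_abs_le_sqrt(1)) (use g_square_integrable in auto)

lemma L'_square_integrable: "integrable P (\<lambda>\<omega>. (deriv L (Z 0 \<omega>))\<^sup>2)"
  by (rule Bochner_Integration.integrable_bound[OF B_square])
     (use L'_le_B B_nonneg in \<open>auto simp: abs_le_square_iff[symmetric]\<close>)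

lemma L'_integrable: "integrable P (\<lambda>\<omega>. deriv L (Z 0 \<omega>))"
  by (rule expectation_abs_le_sqrt(1)) (use L'_square_integrable in auto)

lemma expected_L'_zero: "expectation (\<lambda>\<omega>. deriv L (Z 0 \<omega>)) = 0"
  using expectation_reflect_noise(1)[of "\<lambda>x z. deriv L z"] by (simp add: L'_odd)

lemma mean_score_0: "score.mean_score 0 = 0"
proof -
  have "score.mean_score 0 = expectation (\<lambda>\<omega>. deriv L (Z 0 \<omega>) * g (X 0 \<omega> - \<theta>s))"
    by (simp add: score.mean_score_def score_fun_def shifted_obs_def)
  also have "\<dots> = 0"
    using expectation_product[OF _ _ L'_integrable g_integrable] by (simp add: expected_L'_zero)
  finally show ?thesis .
qed

lemma score_0_second_moment:
  "expectation (\<lambda>\<omega>. (score_fun 0 (shifted_obs 0 \<omega>))\<^sup>2)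
     = expectation (\<lambda>\<omega>. (deriv L (Z 0 \<omega>))\<^sup>2) * expectation (\<lambda>\<omega>. (g (X 0 \<omega> - \<theta>s))\<^sup>2)"
  using expectation_product[of "\<lambda>z. (deriv L z)\<^sup>2" "\<lambda>x. (g x)\<^sup>2", OF _ _ L'_square_integrable g_square_integrable]
  by (simp add: score_fun_def shifted_obs_def power_mult_distrib)

lemma excess_risk_curvature:
  "((\<lambda>t. score.excess_risk t / t\<^sup>2) \<longlongrightarrow>
     expectation (\<lambda>\<omega>. deriv (deriv L) (Z 0 \<omega>)) * expectation (\<lambda>\<omega>. (g (X 0 \<omega> - \<theta>s))\<^sup>2) / 2) (at 0)"
  unfolding tendsto_at_iff_sequentially
proof (intro allI impI)
  fix T :: "nat \<Rightarrow> real" assume T: "\<forall>i. T i \<in> UNIV - {0}" "T \<longlonglongrightarrow> 0"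
  define D where "D t \<omega> = L (Z 0 \<omega> + (f (X 0 \<omega> - \<theta>s) - f (X 0 \<omega> - \<theta>s - t)))
      + L (Z 0 \<omega> - (f (X 0 \<omega> - \<theta>s) - f (X 0 \<omega> - \<theta>s - t))) - 2 * L (Z 0 \<omega>)" for t \<omega>
  have [measurable]: "D t \<in> borel_measurable P" for t unfolding D_def[abs_def] by measurable
  have "(\<lambda>i. expectation (\<lambda>\<omega>. D (T i) \<omega> / 2 / (T i)\<^sup>2))
     \<longlonglongrightarrow> expectation (\<lambda>\<omega>. deriv (deriv L) (Z 0 \<omega>) * (g (X 0 \<omega> - \<theta>s))\<^sup>2 / 2)"
  proof (rule integral_dominated_convergence[where w = "\<lambda>_. CL * Cf\<^sup>2"])
    show "AE \<omega> in P. (\<lambda>i. D (T i) \<omega> / 2 / (T i)\<^sup>2)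
        \<longlonglongrightarrow> deriv (deriv L) (Z 0 \<omega>) * (g (X 0 \<omega> - \<theta>s))\<^sup>2 / 2"
      using AE_Z[OF L''_AE] AE_shifted_X[OF g_deriv]
    proof eventually_elim
      case (elim \<omega>)
      from second_difference_along_path[OF L_deriv conjunct1[OF elim(1)] elim(2)]
      have "((\<lambda>t. D t \<omega> / t\<^sup>2) \<longlongrightarrow> deriv (deriv L) (Z 0 \<omega>) * (g (X 0 \<omega> - \<theta>s))\<^sup>2) (at 0)"
        by (simp add: D_def)
      then have "(\<lambda>i. D (T i) \<omega> / (T i)\<^sup>2) \<longlonglongrightarrow> deriv (deriv L) (Z 0 \<omega>) * (g (X 0 \<omega> - \<theta>s))\<^sup>2"
        using T unfolding tendsto_at_iff_sequentially comp_def by blast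
      then have "(\<lambda>i. D (T i) \<omega> / (T i)\<^sup>2 / 2) \<longlonglongrightarrow> deriv (deriv L) (Z 0 \<omega>) * (g (X 0 \<omega> - \<theta>s))\<^sup>2 / 2"
        by (intro tendsto_intros) auto
      then show ?case by (simp add: mult.commute)
    qed
    show "AE \<omega> in P. norm (D (T i) \<omega> / 2 / (T i)\<^sup>2) \<le> CL * Cf\<^sup>2" for i
    proof (rule AE_I2)
      fix \<omega>
      let ?r = "f (X 0 \<omega> - \<theta>s) - f (X 0 \<omega> - \<theta>s - T i)"
      have t: "0 < (T i)\<^sup>2" using T(1) by simp
      have "?r\<^sup>2 \<le> (Cf * T i)\<^sup>2"
        using f_lipD[of "X 0 \<omega> - \<theta>s" "X 0 \<omega> - \<theta>s - T i"] Cf_nonneg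
        by (simp add: abs_le_square_iff[symmetric] abs_mult)
      then have "2 * CL * ?r\<^sup>2 \<le> 2 * CL * (Cf * T i)\<^sup>2" using CL_nonneg by (intro mult_left_mono) auto
      moreover have "\<bar>D (T i) \<omega>\<bar> \<le> 2 * CL * ?r\<^sup>2"
        unfolding D_def by (rule second_difference_bound[OF L_deriv L'_lipD])
      ultimately have "\<bar>D (T i) \<omega>\<bar> \<le> 2 * (CL * Cf\<^sup>2) * (T i)\<^sup>2" by (simp add: power_mult_distrib)
      then have "\<bar>D (T i) \<omega>\<bar> / (T i)\<^sup>2 \<le> 2 * (CL * Cf\<^sup>2)" using t by (simp only: pos_divide_le_eq)
      then show "norm (D (T i) \<omega> / 2 / (T i)\<^sup>2) \<le> CL * Cf\<^sup>2" by (simp add: abs_divide)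
    qed
  qed (simp_all, measurable)
  moreover have "expectation (\<lambda>\<omega>. deriv (deriv L) (Z 0 \<omega>) * (g (X 0 \<omega> - \<theta>s))\<^sup>2 / 2)
     = expectation (\<lambda>\<omega>. deriv (deriv L) (Z 0 \<omega>)) * expectation (\<lambda>\<omega>. (g (X 0 \<omega> - \<theta>s))\<^sup>2) / 2"
    using expectation_product[of "deriv (deriv L)" "\<lambda>x. (g x)\<^sup>2", OF _ _ L''_integrable g_square_integrable] by simp
  moreover have "score.excess_risk t / t\<^sup>2 = expectation (\<lambda>\<omega>. D t \<omega> / 2 / t\<^sup>2)" for t
    unfolding excess_risk_symmetrised D_def by simp
  ultimately show "((\<lambda>t. score.excess_risk t / t\<^sup>2) \<circ> T) \<longlonglongrightarrow>
     expectation (\<lambda>\<omega>. deriv (deriv L) (Z 0 \<omega>)) * expectation (\<lambda>\<omega>. (g (X 0 \<omega> - \<theta>s))\<^sup>2) / 2"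
    by (simp add: comp_def)
qed

text \<open>
  The score changes either through the argument of \<open>L'\<close>, which is Lipschitz, or through \<open>g\<close>, which is merely
  bounded and measurable; the latter change is small near Lebesgue points only.
\<close>

lemma score_increment_square_le:
  "(score_fun s w - score_fun 0 w)\<^sup>2
     \<le> 2 * (CL * Cf\<^sup>2 * s)\<^sup>2 + 2 * (B (snd w))\<^sup>2 * (g (fst w - s) - g (fst w))\<^sup>2"
proof -
  obtain u z where w: "w = (u, z)" by (cases w)
  let ?a = "(deriv L (z + f u - f (u - s)) - deriv L z) * g (u - s)"
  let ?c = "deriv L z * (g (u - s) - g u)"
  have "\<bar>?a\<bar> \<le> (CL * (Cf * \<bar>s\<bar>)) * Cf"
    unfolding abs_mult
  proof (rule mult_mono)
    have "\<bar>deriv L (z + f u - f (u - s)) - deriv L z\<bar> \<le> CL * \<bar>f u - f (u - s)\<bar>"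
      by (rule order_trans[OF L'_lipD]) (simp add: algebra_simps)
    also have "\<dots> \<le> CL * (Cf * \<bar>s\<bar>)"
      using f_lipD[of u "u - s"] CL_nonneg by (intro mult_left_mono) auto
    finally show "\<bar>deriv L (z + f u - f (u - s)) - deriv L z\<bar> \<le> CL * (Cf * \<bar>s\<bar>)" .
  qed (use g_bound CL_nonneg Cf_nonneg in auto)
  also have "\<dots> = \<bar>CL * Cf\<^sup>2 * s\<bar>" using CL_nonneg by (simp add: abs_mult power2_eq_square)
  finally have a: "?a\<^sup>2 \<le> (CL * Cf\<^sup>2 * s)\<^sup>2" by (simp add: abs_le_square_iff)
  have "(deriv L z)\<^sup>2 \<le> (B z)\<^sup>2" using L'_le_B[of z] B_nonneg[of z] by (simp add: abs_le_square_iff[symmetric])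
  then have c: "?c\<^sup>2 \<le> (B z)\<^sup>2 * (g (u - s) - g u)\<^sup>2"
    unfolding power_mult_distrib by (rule mult_right_mono) simp
  have "score_fun s w - score_fun 0 w = ?a + ?c" by (simp add: score_fun_def w algebra_simps)
  also have "(?a + ?c)\<^sup>2 \<le> 2 * ?a\<^sup>2 + 2 * ?c\<^sup>2"
  proof -
    have "(x + y)\<^sup>2 \<le> 2 * x\<^sup>2 + 2 * y\<^sup>2" for x y :: real
      using zero_le_power2[of "x - y"] by (simp add: power2_diff power2_sum)
    then show ?thesis .
  qed
  finally show ?thesis using a c by (simp add: w)
qed

lemma score_variation_tendsto_0:
  assumes K: "0 < K"
  shows "((\<lambda>r. \<integral>u. indicator {-K..K} u * score.score_variation (r * u) \<partial>lborel) \<longlongrightarrow> 0) (at_right 0)"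
proof (rule score.score_variation_tendsto[OF K])
  have "AE \<omega> in P. ((\<lambda>r. \<integral>u. indicator {-K..K} u * (g (X 0 \<omega> - \<theta>s - r * u) - g (X 0 \<omega> - \<theta>s))\<^sup>2 \<partial>lborel)
            \<longlongrightarrow> 0) (at_right 0)"
    using K by (intro AE_shifted_X square_oscillation_in_shrinking_window_tendsto_AE[OF g_measurable g_bound]) simp
  then show "AE \<omega> in P. ((\<lambda>r. \<integral>u. indicator {-K..K} u *
      (score_fun (r * u) (shifted_obs 0 \<omega>) - score_fun 0 (shifted_obs 0 \<omega>))\<^sup>2 \<partial>lborel) \<longlongrightarrow> 0) (at_right 0)"
    using AE_space
  proof eventually_elim
    case (elim \<omega>)
    let ?w = "shifted_obs 0 \<omega>"
    let ?osc = "\<lambda>r. \<integral>u. indicator {-K..K} u * (g (X 0 \<omega> - \<theta>s - r * u) - g (X 0 \<omega> - \<theta>s))\<^sup>2 \<partial>lborel"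
    let ?up = "\<lambda>r. 2 * (CL * Cf\<^sup>2 * K * r)\<^sup>2 * (2 * K) + 2 * (B (snd ?w))\<^sup>2 * ?osc r"
    show ?case
    proof (rule tendsto_sandwich[of "\<lambda>_. 0" _ _ ?up])
      have "(?up \<longlongrightarrow> 2 * (CL * Cf\<^sup>2 * K * 0)\<^sup>2 * (2 * K) + 2 * (B (snd ?w))\<^sup>2 * 0) (at_right 0)"
        by (intro tendsto_intros elim(1))
      then show "(?up \<longlongrightarrow> 0) (at_right 0)" by simp
      show "\<forall>\<^sub>F r in at_right 0. 0 \<le> (\<integral>u. indicator {-K..K} u * (score_fun (r * u) ?w - score_fun 0 ?w)\<^sup>2 \<partial>lborel)"
        by (intro always_eventually allI Bochner_Integration.integral_nonneg) simp
      have "(\<integral>u. indicator {-K..K} u * (score_fun (r * u) ?w - score_fun 0 ?w)\<^sup>2 \<partial>lborel) \<le> ?up r" for r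
      proof -
        let ?d = "\<lambda>u. (g (X 0 \<omega> - \<theta>s - r * u) - g (X 0 \<omega> - \<theta>s))\<^sup>2"
        have d: "\<bar>?d u\<bar> \<le> (2 * Cf)\<^sup>2" for u
        proof -
          have "\<bar>g (X 0 \<omega> - \<theta>s - r * u) - g (X 0 \<omega> - \<theta>s)\<bar> \<le> \<bar>2 * Cf\<bar>"
            using g_bound[of "X 0 \<omega> - \<theta>s - r * u"] g_bound[of "X 0 \<omega> - \<theta>s"] by linarith
          then show ?thesis by (simp add: abs_le_square_iff)
        qed
        have intd: "integrable lborel (\<lambda>u. indicator {-K..K} u * ?d u)"
          using d by (intro integrable_window_bounded) auto
        have int2: "integrable lborel (\<lambda>u. 2 * (CL * Cf\<^sup>2 * K * r)\<^sup>2 * indicator {-K..K} u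
            + 2 * (B (snd ?w))\<^sup>2 * (indicator {-K..K} u * ?d u))"
          using intd K by (intro Bochner_Integration.integrable_add integrable_mult_right) auto
        have "(\<integral>u. indicator {-K..K} u * (score_fun (r * u) ?w - score_fun 0 ?w)\<^sup>2 \<partial>lborel)
          \<le> (\<integral>u. 2 * (CL * Cf\<^sup>2 * K * r)\<^sup>2 * indicator {-K..K} u
            + 2 * (B (snd ?w))\<^sup>2 * (indicator {-K..K} u * ?d u) \<partial>lborel)"
        proof (rule integral_mono'[OF int2])
          fix u
          show "indicator {-K..K} u * (score_fun (r * u) ?w - score_fun 0 ?w)\<^sup>2
            \<le> 2 * (CL * Cf\<^sup>2 * K * r)\<^sup>2 * indicator {-K..K} u + 2 * (B (snd ?w))\<^sup>2 * (indicator {-K..K} u * ?d u)"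
          proof (cases "u \<in> {-K..K}")
            case True
            then have "\<bar>u\<bar> \<le> K" by auto
            then have "\<bar>CL * Cf\<^sup>2 * r\<bar> * \<bar>u\<bar> \<le> \<bar>CL * Cf\<^sup>2 * r\<bar> * K" by (rule mult_left_mono) simp
            then have "\<bar>CL * Cf\<^sup>2 * (r * u)\<bar> \<le> \<bar>CL * Cf\<^sup>2 * K * r\<bar>"
              using K by (simp add: abs_mult mult_ac)
            then have "(CL * Cf\<^sup>2 * (r * u))\<^sup>2 \<le> (CL * Cf\<^sup>2 * K * r)\<^sup>2" by (simp only: abs_le_square_iff)
            then show ?thesis
              using score_increment_square_le[of "r * u" ?w] True by (simp add: shifted_obs_def)
          qed simp
          show "0 \<le> 2 * (CL * Cf\<^sup>2 * K * r)\<^sup>2 * indicator {-K..K} u + 2 * (B (snd ?w))\<^sup>2 * (indicator {-K..K} u * ?d u)"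
            by simp
        qed
        also have "\<dots> = ?up r"
          using intd K by (subst Bochner_Integration.integral_add) (auto simp: mult.commute)
        finally show ?thesis .
      qed
      then show "\<forall>\<^sub>F r in at_right 0. (\<integral>u. indicator {-K..K} u * (score_fun (r * u) ?w - score_fun 0 ?w)\<^sup>2 \<partial>lborel) \<le> ?up r"
        by (intro always_eventually allI)
    qed simp
  qed
qed

text \<open>
  By monotonicity and evenness of \<open>L\<close>, its derivative is nonnegative on the right of \<open>0\<close> and nonpositive on the
  left.  A zero of \<open>L'\<close> other than \<open>0\<close> is therefore a local extremum of \<open>L'\<close>, where the second derivative
  vanishes if it exists.  So \<open>L' (Z) = 0\<close> almost surely would force \<open>E L'' (Z) = 0\<close>.
\<close>

lemma expected_L'_square_pos:
  assumes mono: "mono_on {0..} L" and nz: "expectation (\<lambda>\<omega>. deriv (deriv L) (Z 0 \<omega>)) \<noteq> 0"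
  shows "0 < expectation (\<lambda>\<omega>. (deriv L (Z 0 \<omega>))\<^sup>2)"
proof (rule ccontr)
  assume "\<not> ?thesis"
  moreover have "0 \<le> expectation (\<lambda>\<omega>. (deriv L (Z 0 \<omega>))\<^sup>2)" by simp
  ultimately have "expectation (\<lambda>\<omega>. (deriv L (Z 0 \<omega>))\<^sup>2) = 0" by linarith
  then have "AE \<omega> in P. (deriv L (Z 0 \<omega>))\<^sup>2 = 0"
    using integral_nonneg_eq_0_iff_AE[OF L'_square_integrable] by simp
  moreover have "AE \<omega> in P. Z 0 \<omega> \<noteq> 0" by (rule AE_Z[OF AE_lborel_singleton])
  ultimately have "AE \<omega> in P. deriv (deriv L) (Z 0 \<omega>) = 0"
    using AE_Z[OF L''_AE]
  proof eventually_elim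
    case (elim \<omega>)
    let ?z = "Z 0 \<omega>"
    have pos: "0 \<le> deriv L x" if "0 < x" for x
      by (rule mono_on_imp_deriv_nonneg[OF mono L_deriv]) (use that in \<open>simp add: interior_real_atLeast\<close>)
    have neg: "deriv L x \<le> 0" if "x < 0" for x
      using pos[of "- x"] that by (simp add: L'_odd)
    have z: "deriv L ?z = 0" "?z \<noteq> 0" using elim by auto
    have d: "(deriv L has_real_derivative deriv (deriv L) ?z) (at ?z)" using elim by blast
    show ?case
    proof (cases "0 < ?z")
      case True
      show ?thesis
        by (rule DERIV_local_min[OF d True]) (use z pos in auto)
    next
      case False
      then have "0 < - ?z" using z by simp
      show ?thesis
        by (rule DERIV_local_max[OF d \<open>0 < - ?z\<close>]) (use z neg in auto)
    qed
  qed
  then have "expectation (\<lambda>\<omega>. deriv (deriv L) (Z 0 \<omega>)) = 0"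
    by (subst integral_cong_AE[where g = "\<lambda>_. 0"]) auto
  with nz show False by simp
qed

text \<open>
  Near \<open>0\<close> the curvature gives the bound, and at a distance from \<open>0\<close> the separation of the minimum does, since
  \<open>t\<^sup>2\<close> is at most \<open>T\<^sup>2\<close>.
\<close>

lemma quadratic_risk_lower_bound:
  assumes V: "0 < V" and T: "0 < T"
    and curv: "((\<lambda>t. score.excess_risk t / t\<^sup>2) \<longlongrightarrow> V / 2) (at 0)"
    and sep: "\<And>d. 0 < d \<Longrightarrow> \<exists>e>0. \<forall>t. d \<le> \<bar>t\<bar> \<longrightarrow> e \<le> score.excess_risk t"
  shows "\<exists>c>0. \<forall>t. \<bar>t\<bar> \<le> T \<longrightarrow> c * t\<^sup>2 \<le> score.excess_risk t"
proof -
  have "\<forall>\<^sub>F t in at 0. V / 4 < score.excess_risk t / t\<^sup>2"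
    by (rule order_tendstoD(1)[OF curv]) (use V in simp)
  then obtain d where d: "0 < d" and near: "\<And>t. t \<noteq> 0 \<Longrightarrow> \<bar>t\<bar> < d \<Longrightarrow> V / 4 < score.excess_risk t / t\<^sup>2"
    by (auto simp: eventually_at dist_real_def)
  obtain e where e: "0 < e" and away: "\<And>t. d \<le> \<bar>t\<bar> \<Longrightarrow> e \<le> score.excess_risk t"
    using sep[OF d] by blast
  define c where "c = min (V / 4) (e / T\<^sup>2)"
  have c_le: "c \<le> V / 4" "c \<le> e / T\<^sup>2" by (simp_all only: c_def min.cobounded1 min.cobounded2)
  have "c * t\<^sup>2 \<le> score.excess_risk t" if t: "\<bar>t\<bar> \<le> T" for t
  proof -
    consider "t = 0" | "t \<noteq> 0" "\<bar>t\<bar> < d" | "d \<le> \<bar>t\<bar>" by linarith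
    then show ?thesis
    proof cases
      case 1
      then show ?thesis by (simp add: score.excess_risk_def)
    next
      case 2
      have "c * t\<^sup>2 \<le> V / 4 * t\<^sup>2" by (intro mult_right_mono c_le) simp
      also have "\<dots> \<le> score.excess_risk t"
        using near[OF 2] 2(1) by (simp add: pos_less_divide_eq)
      finally show ?thesis .
    next
      case 3
      have "c * t\<^sup>2 \<le> e / T\<^sup>2 * T\<^sup>2"
        using e t T by (intro mult_mono c_le) (auto simp: abs_le_square_iff[symmetric])
      also have "\<dots> = e" using T by simp
      also have "\<dots> \<le> score.excess_risk t" by (rule away[OF 3])
      finally show ?thesis .
    qed
  qed
  moreover have "0 < c" using V e T by (simp add: c_def)
  ultimately show ?thesis by blast
qed

text \<open>
  The excess risk is nonnegative by separation, so its curvature \<open>V\<close>, a nonzero product, is positive.  Beyond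
  \<open>T\<close> the shifted template no longer meets the support of the design density, and the criterion is constant
  almost surely.
\<close>

theorem shift_estimator_asymptotically_normal:
  fixes \<theta>hat :: "nat \<Rightarrow> 'a \<Rightarrow> real"
  assumes mono: "mono_on {0..} L"
    and f_supp: "compactly_supported f" and lam_supp: "compactly_supported lam"
    and sep: "\<And>d. 0 < d \<Longrightarrow> \<exists>e>0. \<forall>t. d \<le> \<bar>t\<bar> \<longrightarrow> e \<le> score.excess_risk t"
    and nz_f: "expectation (\<lambda>\<omega>. (deriv f (X 0 \<omega> - \<theta>s))\<^sup>2) \<noteq> 0"
    and nz_L: "expectation (\<lambda>\<omega>. deriv (deriv L) (Z 0 \<omega>)) \<noteq> 0"
    and meas [measurable]: "\<And>n. \<theta>hat n \<in> borel_measurable P"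
    and min: "\<And>n. n \<ge> 1 \<Longrightarrow>
        AE \<omega> in P. \<forall>\<theta>. emp_risk L f X Y n \<omega> (\<theta>hat n \<omega>) \<le> emp_risk L f X Y n \<omega> \<theta>"
  shows "weak_conv_m (\<lambda>n. distr P borel (\<lambda>\<omega>. sqrt (real n) * (\<theta>hat n \<omega> - \<theta>s)))
           (density lborel (normal_density 0 (sqrt (asym_var P L f \<theta>s X Z))))"
proof -
  define G where "G = expectation (\<lambda>\<omega>. (g (X 0 \<omega> - \<theta>s))\<^sup>2)"
  define \<kappa> where "\<kappa> = expectation (\<lambda>\<omega>. deriv (deriv L) (Z 0 \<omega>))"
  define J where "J = expectation (\<lambda>\<omega>. (deriv L (Z 0 \<omega>))\<^sup>2)"
  have deriv_f_meas [measurable]: "deriv f \<in> borel_measurable borel"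
    using lipschitz_on_continuous_on[OF f_lip] by (rule borel_measurable_deriv)
  have G_eq: "expectation (\<lambda>\<omega>. (deriv f (X 0 \<omega> - \<theta>s))\<^sup>2) = G"
    unfolding G_def
  proof (rule integral_cong_AE)
    show "AE \<omega> in P. (deriv f (X 0 \<omega> - \<theta>s))\<^sup>2 = (g (X 0 \<omega> - \<theta>s))\<^sup>2"
      using AE_shifted_X[OF g_deriv] by eventually_elim (simp add: DERIV_imp_deriv)
  qed measurable
  have G: "0 < G"
  proof -
    have "0 \<le> G" by (simp add: G_def)
    with nz_f G_eq show ?thesis by simp
  qed
  have curv: "((\<lambda>t. score.excess_risk t / t\<^sup>2) \<longlongrightarrow> \<kappa> * G / 2) (at 0)"
    using excess_risk_curvature by (simp add: \<kappa>_def G_def)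
  have risk_nonneg: "0 \<le> score.excess_risk t" for t
  proof (cases "t = 0")
    case False
    then obtain e where "0 < e" "e \<le> score.excess_risk t" using sep[of "\<bar>t\<bar>"] by auto
    then show ?thesis by simp
  qed (simp add: score.excess_risk_def)
  have "0 \<le> \<kappa> * G / 2"
    by (rule tendsto_lowerbound[OF curv]) (auto intro!: always_eventually divide_nonneg_nonneg risk_nonneg)
  then have \<kappa>: "0 < \<kappa>" using G nz_L by (simp add: \<kappa>_def zero_le_mult_iff)
  have V: "0 < \<kappa> * G" using \<kappa> G by simp
  have J: "0 < J" unfolding J_def by (rule expected_L'_square_pos[OF mono nz_L])

  obtain a where a: "\<And>x. f x \<noteq> 0 \<Longrightarrow> \<bar>x\<bar> \<le> a"
  proof -
    have "bounded (closure {x. f x \<noteq> 0})" using f_supp compact_imp_bounded unfolding compactly_supported_def by blast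
    then obtain a where "\<And>x. x \<in> closure {x. f x \<noteq> 0} \<Longrightarrow> norm x \<le> a" unfolding bounded_iff by blast
    then show ?thesis using that[of a] closure_subset[of "{x. f x \<noteq> 0}"] by auto
  qed
  obtain l where l: "\<And>x. lam x \<noteq> 0 \<Longrightarrow> \<bar>x\<bar> \<le> l"
  proof -
    have "bounded (closure {x. lam x \<noteq> 0})" using lam_supp compact_imp_bounded unfolding compactly_supported_def by blast
    then obtain a where "\<And>x. x \<in> closure {x. lam x \<noteq> 0} \<Longrightarrow> norm x \<le> a" unfolding bounded_iff by blast
    then show ?thesis using that[of a] closure_subset[of "{x. lam x \<noteq> 0}"] by auto
  qed
  define T where "T = \<bar>a\<bar> + \<bar>l\<bar> + \<bar>\<theta>s\<bar> + 1"
  have T: "0 < T" by (simp add: T_def)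
  have "AE \<omega> in P. \<forall>i. \<bar>X i \<omega>\<bar> \<le> l"
    unfolding AE_all_countable
  proof
    fix i
    have lm: "(\<lambda>x. ennreal (lam x)) \<in> borel_measurable lborel"
      by (rule distributed_borel_measurable[OF X_density])
    have "AE x in density lborel lam. \<bar>x\<bar> \<le> l"
      using lm by (subst AE_density) (auto simp: l)
    then have "AE x in distr P lborel (X i). \<bar>x\<bar> \<le> l"
      unfolding distributed_distr_eq_density[OF X_density] .
    then show "AE \<omega> in P. \<bar>X i \<omega>\<bar> \<le> l"
      by (rule AE_distrD[OF distributed_measurable[OF X_density]])
  qed
  then have tail: "AE \<omega> in P. \<forall>n t. T \<le> \<bar>t\<bar> \<longrightarrow>
      (\<Sum>i<n. score.loss_increment t (shifted_obs i \<omega>)) = (\<Sum>i<n. score.loss_increment T (shifted_obs i \<omega>))"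
  proof eventually_elim
    case (elim \<omega>)
    have vanish: "f (X i \<omega> - \<theta>s - t) = 0" if t: "T \<le> \<bar>t\<bar>" for i t
    proof (rule ccontr)
      assume "f (X i \<omega> - \<theta>s - t) \<noteq> 0"
      then have "\<bar>X i \<omega> - \<theta>s - t\<bar> \<le> a" by (rule a)
      moreover have "\<bar>X i \<omega>\<bar> \<le> l" using elim by blast
      ultimately show False using t unfolding T_def by linarith
    qed
    show ?case
    proof (intro allI impI sum.cong refl)
      fix n t i assume "T \<le> \<bar>t\<bar>"
      then show "score.loss_increment t (shifted_obs i \<omega>) = score.loss_increment T (shifted_obs i \<omega>)"
        unfolding loss_increment_obs using vanish[of t i] vanish[of T i] T by simp
    qed
  qed
  have min': "AE \<omega> in P. \<forall>t. (\<Sum>i<n. score.loss_increment (\<theta>hat n \<omega> - \<theta>s) (shifted_obs i \<omega>))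
      \<le> (\<Sum>i<n. score.loss_increment t (shifted_obs i \<omega>))" if n: "1 \<le> n" for n
    using min[OF n] AE_space
  proof eventually_elim
    case (elim \<omega>)
    have emp: "emp_risk L f X Y n \<omega> (\<theta>s + t)
        = ((\<Sum>i<n. score.loss_increment t (shifted_obs i \<omega>)) + (\<Sum>i<n. L (Z i \<omega>))) / real n" for t
      unfolding emp_risk_def m_loss_def loss_increment_obs sum.distrib[symmetric]
      using elim(2) by (simp add: Y_eq algebra_simps)
    show ?case
    proof
      fix t
      have "emp_risk L f X Y n \<omega> (\<theta>s + (\<theta>hat n \<omega> - \<theta>s)) \<le> emp_risk L f X Y n \<omega> (\<theta>s + t)"
        using elim(1) by simp
      then show "(\<Sum>i<n. score.loss_increment (\<theta>hat n \<omega> - \<theta>s) (shifted_obs i \<omega>))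
          \<le> (\<Sum>i<n. score.loss_increment t (shifted_obs i \<omega>))"
        unfolding emp using n by (simp add: divide_le_cancel)
    qed
  qed
  obtain c where c: "0 < c" and quad: "\<And>t. \<bar>t\<bar> \<le> T \<Longrightarrow> c * t\<^sup>2 \<le> score.excess_risk t"
    using quadratic_risk_lower_bound[OF V T curv sep] by blast
  have \<sigma>: "0 < sqrt (J * G)" "expectation (\<lambda>\<omega>. (score_fun 0 (shifted_obs 0 \<omega>))\<^sup>2) = (sqrt (J * G))\<^sup>2"
    using J G unfolding score_0_second_moment by (simp_all add: J_def[symmetric] G_def[symmetric])
  have "weak_conv_m (\<lambda>n. distr P borel (\<lambda>\<omega>. sqrt (real n) * (\<theta>hat n \<omega> - \<theta>s)))
           (density lborel (normal_density 0 (sqrt (J * G) / (\<kappa> * G))))"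
    by (rule score.minimiser_asymptotically_normal[OF V c T quad curv score_variation_tendsto_0 _ min' tail mean_score_0 \<sigma>])
      auto
  also have "sqrt (J * G) / (\<kappa> * G) = sqrt (asym_var P L f \<theta>s X Z)"
  proof -
    have "sqrt (J * G) / (\<kappa> * G) = sqrt ((J * G) / (\<kappa> * G)\<^sup>2)"
      using V by (simp add: real_sqrt_divide)
    also have "(J * G) / (\<kappa> * G)\<^sup>2 = J / \<kappa>\<^sup>2 / G"
      using G by (simp add: power2_eq_square)
    also have "\<dots> = asym_var P L f \<theta>s X Z"
      by (simp add: asym_var_def C_noise_def G_eq J_def \<kappa>_def)
    finally show ?thesis .
  qed
  finally show ?thesis .
qed

end

text \<open>
  It remains to provide the density \<open>g\<close> and the envelope \<open>B\<close>, and to turn the statement about the infimum of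
  the risk into a bound on the excess risk.  The risk is bounded below because the loss is nonnegative, which
  makes the infimum a lower bound.
\<close>

theorem theorem3p2:
  fixes P :: "'a measure"
    and f lam phi L :: "real \<Rightarrow> real"
    and \<theta>s :: real
    and X Y Z :: "nat \<Rightarrow> 'a \<Rightarrow> real"
    and \<theta>hat :: "nat \<Rightarrow> 'a \<Rightarrow> real"
  assumes model: "template_matching P f lam phi \<theta>s X Y Z"
    and f_supp: "compactly_supported f"
    and f_cadlag: "cadlag f"
    and f_discont: "finite {x. \<not> isCont f x}"
    and identifiable:
      "\<And>\<theta>. \<theta> \<noteq> \<theta>s \<Longrightarrow> (\<integral>x. (f (x - \<theta>s) - f (x - \<theta>))\<^sup>2 * lam x \<partial>lborel) > 0"
    and lam_supp: "compactly_supported lam"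
    and phi_even: "\<And>z. phi (- z) = phi z"
    and L_nonneg: "\<And>u. 0 \<le> L u"
    and L_even: "\<And>u. L (- u) = L u"
    and L_mono: "mono_on {0..} L"
    and L_nonconst: "\<exists>u v. L u \<noteq> L v"
    and L_regular: "lipschitz_fun L \<or> has_lipschitz_deriv L"
    and M_finite: "\<And>\<theta>. integrable P (\<lambda>\<omega>. m_loss L f \<theta> (X 0 \<omega>) (Y 0 \<omega>))"
    and M_unique_min: "\<And>\<theta>. \<theta> \<noteq> \<theta>s \<Longrightarrow> risk P L f X Y \<theta>s < risk P L f X Y \<theta>"
    and M_separated:
      "\<And>\<delta>. \<delta> > 0 \<Longrightarrow> (INF \<theta>\<in>{\<theta>. \<bar>\<theta> - \<theta>s\<bar> \<ge> \<delta>}. risk P L f X Y \<theta>) > risk P L f X Y \<theta>s"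
    and f_lipschitz: "lipschitz_fun f"
    and lam_lipschitz:
      "\<exists>U C. open U \<and> closure {x. f (x - \<theta>s) \<noteq> 0} \<subseteq> U \<and> C-lipschitz_on U lam"
    and L_smooth: "has_lipschitz_deriv L"
    and noise_moment: "\<not> lipschitz_fun L \<Longrightarrow> integrable P (\<lambda>\<omega>. (Z 0 \<omega>)\<^sup>2)"
    and denom_f_nonzero: "(\<integral>\<omega>. (deriv f (X 0 \<omega> - \<theta>s))\<^sup>2 \<partial>P) \<noteq> 0"
    and denom_L_nonzero: "(\<integral>\<omega>. deriv (deriv L) (Z 0 \<omega>) \<partial>P) \<noteq> 0"
    and estimator_measurable: "\<And>n. \<theta>hat n \<in> borel_measurable P"
    and estimator_min:
      "\<And>n. n \<ge> 1 \<Longrightarrow>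
        AE \<omega> in P. \<forall>\<theta>. emp_risk L f X Y n \<omega> (\<theta>hat n \<omega>) \<le> emp_risk L f X Y n \<omega> \<theta>"
  shows "weak_conv_m (\<lambda>n. distr P borel (\<lambda>\<omega>. sqrt (real n) * (\<theta>hat n \<omega> - \<theta>s)))
           (density lborel (normal_density 0 (sqrt (asym_var P L f \<theta>s X Z))))"
proof -
  interpret template_matching P f lam phi \<theta>s X Y Z by (rule model)
  obtain Cf where Cf: "Cf-lipschitz_on UNIV f" using f_lipschitz unfolding lipschitz_fun_def by blast
  obtain CL where CL: "CL-lipschitz_on UNIV (deriv L)"
    using L_smooth unfolding has_lipschitz_deriv_def lipschitz_fun_def by blast
  have L_deriv: "(L has_real_derivative deriv L x) (at x)" for x
    using L_smooth unfolding has_lipschitz_deriv_def DERIV_deriv_iff_real_differentiable by blast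
  obtain g where g: "g \<in> borel_measurable borel" "\<And>x. \<bar>g x\<bar> \<le> Cf"
    "\<And>a b. a \<le> b \<Longrightarrow> f b - f a = (\<integral>x. indicator {a..b} x * g x \<partial>lborel)"
    "AE x in lborel. (f has_real_derivative g x) (at x)"
    using lipschitz_eq_integral_of_bounded_density[OF Cf] by blast
  obtain F where F: "\<And>x. \<bar>f x\<bar> \<le> F"
  proof -
    have "compact (closure {x. f x \<noteq> 0})" using f_supp by (simp add: compactly_supported_def)
    then have "bounded (f ` closure {x. f x \<noteq> 0})"
      by (intro compact_imp_bounded compact_continuous_image
            continuous_on_subset[OF lipschitz_on_continuous_on[OF Cf] subset_UNIV])
    then obtain b where b: "\<And>y. y \<in> f ` closure {x. f x \<noteq> 0} \<Longrightarrow> norm y \<le> b"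
      unfolding bounded_iff by blast
    have "\<bar>f x\<bar> \<le> \<bar>b\<bar>" for x
    proof (cases "f x = 0")
      case False
      then have "x \<in> closure {x. f x \<noteq> 0}" by (intro subsetD[OF closure_subset]) simp
      then have "norm (f x) \<le> b" by (intro b imageI)
      then show ?thesis by simp
    qed simp
    then show ?thesis by (rule that)
  qed
  have F0: "0 \<le> F" using F[of 0] by linarith
  have CL0: "0 \<le> CL" using CL by (rule lipschitz_on_nonneg)
  have Zm: "Z 0 \<in> borel_measurable P" using distributed_measurable[OF Z_density[of 0]] by simp
  \<comment> \<open>A square integrable envelope for the derivative of the loss: constant for Lipschitz losses,
    of linear growth otherwise.\<close>
  obtain B where Bm: "B \<in> borel_measurable borel"
    and B: "\<And>z r. \<bar>r\<bar> \<le> 2 * F \<Longrightarrow> \<bar>deriv L (z + r)\<bar> \<le> B z"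
    and B_sq: "integrable P (\<lambda>\<omega>. (B (Z 0 \<omega>))\<^sup>2)"
  proof (cases "lipschitz_fun L")
    case True
    then obtain D where D: "D-lipschitz_on UNIV L" unfolding lipschitz_fun_def by blast
    have "\<bar>deriv L x\<bar> \<le> D" for x
    proof (rule tendsto_upperbound[OF tendsto_rabs])
      show "((\<lambda>h. (L (x + h) - L x) / h) \<longlongrightarrow> deriv L x) (at 0)"
        using L_deriv[of x] by (simp add: DERIV_def)
      show "\<forall>\<^sub>F h in at 0. \<bar>(L (x + h) - L x) / h\<bar> \<le> D"
        using lipschitz_onD[OF D, of "x + _" x]
        by (auto simp: eventually_at_filter divide_simps dist_real_def)
    qed simp
    then show ?thesis by (intro that[of "\<lambda>_. D"]) auto
  next
    case False
    then have Z2: "integrable P (\<lambda>\<omega>. (Z 0 \<omega>)\<^sup>2)" by (rule noise_moment)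
    have Z1: "integrable P (Z 0)" by (rule expectation_abs_le_sqrt(1)[OF Zm Z2])
    have zero: "deriv L 0 = 0" using deriv_of_even[OF L_even L_deriv, of 0] by simp
    show ?thesis
    proof (rule that[of "\<lambda>z. CL * (\<bar>z\<bar> + 2 * F)"])
      fix z r assume "\<bar>r\<bar> \<le> 2 * F"
      then have "CL * \<bar>z + r\<bar> \<le> CL * (\<bar>z\<bar> + 2 * F)" using CL0 by (intro mult_left_mono) auto
      then show "\<bar>deriv L (z + r)\<bar> \<le> CL * (\<bar>z\<bar> + 2 * F)"
        using lipschitz_onD[OF CL, of "z + r" 0] by (simp add: dist_real_def zero)
    next
      have "integrable P (\<lambda>\<omega>. CL\<^sup>2 * ((Z 0 \<omega>)\<^sup>2 + 4 * F * \<bar>Z 0 \<omega>\<bar> + 4 * F\<^sup>2))"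
        using Z1 Z2 by (intro integrable_mult_right Bochner_Integration.integrable_add) auto
      moreover have "(CL * (\<bar>z\<bar> + 2 * F))\<^sup>2 = CL\<^sup>2 * (z\<^sup>2 + 4 * F * \<bar>z\<bar> + 4 * F\<^sup>2)" for z
        by (simp add: power_mult_distrib power2_sum)
      ultimately show "integrable P (\<lambda>\<omega>. (CL * (\<bar>Z 0 \<omega>\<bar> + 2 * F))\<^sup>2)" by simp
    qed simp
  qed
  interpret smooth_template_model P f lam phi \<theta>s X Y Z L g B Cf CL F
    by unfold_locales (fact Cf F g(1) g(2) g(4) L_deriv CL L_even phi_even Bm B B_sq)+
  have int_m: "integrable P (\<lambda>\<omega>. L (Z 0 \<omega> + (f (X 0 \<omega> - \<theta>s) - f (X 0 \<omega> - \<theta>s - t))))"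
    and risk_eq: "risk P L f X Y (\<theta>s + t) = expectation (\<lambda>\<omega>. L (Z 0 \<omega> + (f (X 0 \<omega> - \<theta>s) - f (X 0 \<omega> - \<theta>s - t))))" for t
  proof -
    have eq: "m_loss L f (\<theta>s + t) (X 0 \<omega>) (Y 0 \<omega>) = L (Z 0 \<omega> + (f (X 0 \<omega> - \<theta>s) - f (X 0 \<omega> - \<theta>s - t)))"
      if "\<omega> \<in> space P" for \<omega>
      using that by (simp add: m_loss_def Y_eq algebra_simps)
    show "integrable P (\<lambda>\<omega>. L (Z 0 \<omega> + (f (X 0 \<omega> - \<theta>s) - f (X 0 \<omega> - \<theta>s - t))))"
      using M_finite[of "\<theta>s + t"] by (simp only: eq cong: Bochner_Integration.integrable_cong)
    show "risk P L f X Y (\<theta>s + t) = expectation (\<lambda>\<omega>. L (Z 0 \<omega> + (f (X 0 \<omega> - \<theta>s) - f (X 0 \<omega> - \<theta>s - t))))"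
      unfolding risk_def by (rule Bochner_Integration.integral_cong[OF refl eq])
  qed
  have excess: "score.excess_risk t = risk P L f X Y (\<theta>s + t) - risk P L f X Y \<theta>s" for t
    using int_m[of t] int_m[of 0] risk_eq[of t] risk_eq[of 0]
    unfolding score.excess_risk_def loss_increment_obs by simp
  have "\<exists>e>0. \<forall>t. d \<le> \<bar>t\<bar> \<longrightarrow> e \<le> score.excess_risk t" if d: "0 < d" for d
  proof (intro exI conjI allI impI)
    let ?S = "{\<theta>. \<bar>\<theta> - \<theta>s\<bar> \<ge> d}"
    show "0 < (INF \<theta>\<in>?S. risk P L f X Y \<theta>) - risk P L f X Y \<theta>s" using M_separated[OF d] by simp
    fix t assume t: "d \<le> \<bar>t\<bar>"
    have "bdd_below (risk P L f X Y ` ?S)"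
      by (rule bdd_belowI2[where m = 0]) (simp add: risk_def m_loss_def L_nonneg)
    then have "(INF \<theta>\<in>?S. risk P L f X Y \<theta>) \<le> risk P L f X Y (\<theta>s + t)"
      by (rule cINF_lower) (use t in simp)
    then show "(INF \<theta>\<in>?S. risk P L f X Y \<theta>) - risk P L f X Y \<theta>s \<le> score.excess_risk t"
      by (simp add: excess)
  qed
  then show ?thesis
    by (rule shift_estimator_asymptotically_normal[OF L_mono f_supp lam_supp _ denom_f_nonzero denom_L_nonzero
          estimator_measurable estimator_min])
qed

end
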